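(* $$\beta_*\in\left[\frac{\log\left(8\cdot\frac76\right)}{\log 3},\ \frac{\log\left(8\cdot\frac32\right)}{\log 3}\right],$$ where $\beta_*=\sup\{\beta>0:(\mathcal{E}_\beta,\mathcal{F}_\beta)\text{ is a regular Dirichlet form on }L^2(K;\nu)\}$ is the walk dimension of the Sierpinski carpet $K$.
   Context: In $\mathbb{R}^2$ let $p_0=(0,0)$, $p_1=(\frac12,0)$, $p_2=(1,0)$, $p_3=(1,\frac12)$, $p_4=(1,1)$, $p_5=(\frac12,1)$, $p_6=(0,1)$, $p_7=(0,\frac12)$, and $f_i(x)=(x+2p_i)/3$ for $i=0,\ldots,7$. The Sierpinski carpet $K$ is the unique non-empty compact set with $K=\bigcup_{i=0}^7 f_i(K)$. Let $\alpha=\log 8/\log 3$ be its Hausdorff dimension and $\nu$ the normalized $\alpha$-dimensional Hausdorff measure on $K$ ($\nu(K)=1$). For $\beta>0$ let $$\mathcal{E}_\beta(u,u)=\int_K\int_K\frac{(u(x)-u(y))^2}{|x-y|^{\alpha+\beta}}\,\nu(dx)\,\nu(dy),\qquad \mathcal{F}_\beta=\{u\in L^2(K;\nu):\mathcal{E}_\beta(u,u)<+\infty\},$$ where $|\cdot|$ is the Euclidean norm. *)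

theory Defs
  imports "HOL-Analysis.Analysis"
begin

(* The \<open>s\<close>-th power of the diameter, with the usual conventions diam {} ^ s = 0 and
   diam A ^ 0 = 1 for nonempty A (note that 0 powr 0 = 0). *)
definition diam_power :: "real \<Rightarrow> 'a::metric_space set \<Rightarrow> ennreal" where
  "diam_power s A =
     (if A = {} then 0 else if s = 0 then 1 else ennreal (diameter A powr s))"

(* Boundedness is required because the real-valued \<open>diameter\<close> is only meaningful for
   bounded sets. If there is no admissible cover, the infimum is infinite. *)
definition hausdorff_premeasure :: "real \<Rightarrow> real \<Rightarrow> 'a::metric_space set \<Rightarrow> ennreal" where
  "hausdorff_premeasure s \<delta> A =
     (INF U \<in> {U :: nat \<Rightarrow> 'a set. A \<subseteq> (\<Union>i. U i) \<and> (\<forall>i. bounded (U i) \<and> diameter (U i) \<le> \<delta>)}.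
        \<Sum>i. diam_power s (U i))"

definition hausdorff_outer_measure :: "real \<Rightarrow> 'a::metric_space set \<Rightarrow> ennreal" where
  "hausdorff_outer_measure s A = (SUP \<delta> \<in> {0<..}. hausdorff_premeasure s \<delta> A)"

definition hausdorff_measure :: "real \<Rightarrow> 'a::metric_space measure" where
  "hausdorff_measure s = measure_of UNIV (sets borel) (hausdorff_outer_measure s)"

(* Elements of \<open>L\<^sup>2(M)\<close> are represented by square integrable functions. A domain is a set of
   functions closed under almost everywhere equality, and a form must not depend on the
   choice of representatives. *)
definition L2_funs :: "'a measure \<Rightarrow> ('a \<Rightarrow> real) set" where
  "L2_funs M = {u \<in> borel_measurable M. integrable M (\<lambda>x. (u x)\<^sup>2)}"

(* The standing assumptions of Fukushima, Oshima and Takeda: the underlying space is a locally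
   compact separable metric space, and the measure is a Radon measure of full support. *)
definition dirichlet_base ::
    "'a::{metric_space, second_countable_topology} measure \<Rightarrow> bool" where
  "dirichlet_base M \<longleftrightarrow>
     locally compact (space M) \<and>
     sets M = sets (restrict_space borel (space M)) \<and>
     (\<forall>C. compact C \<longrightarrow> C \<subseteq> space M \<longrightarrow> emeasure M C < \<infinity>) \<and>
     (\<forall>U. openin (top_of_set (space M)) U \<longrightarrow> U \<noteq> {} \<longrightarrow> emeasure M U > 0)"

definition symmetric_form ::
    "'a measure \<Rightarrow> (('a \<Rightarrow> real) \<Rightarrow> ('a \<Rightarrow> real) \<Rightarrow> real) \<Rightarrow> ('a \<Rightarrow> real) set \<Rightarrow> bool" where
  "symmetric_form M E F \<longleftrightarrow>
     F \<subseteq> L2_funs M \<and>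
     (\<forall>u\<in>F. \<forall>v\<in>L2_funs M. (AE x in M. u x = v x) \<longrightarrow> v \<in> F) \<and>
     (\<lambda>x. 0) \<in> F \<and>
     (\<forall>u\<in>F. \<forall>v\<in>F. (\<lambda>x. u x + v x) \<in> F) \<and>
     (\<forall>c. \<forall>u\<in>F. (\<lambda>x. c * u x) \<in> F) \<and>
     (\<forall>u\<in>L2_funs M. \<forall>e>0. \<exists>v\<in>F. (\<integral>x. (u x - v x)\<^sup>2 \<partial>M) < e) \<and>
     (\<forall>u\<in>F. \<forall>u'\<in>F. \<forall>v\<in>F. (AE x in M. u x = u' x) \<longrightarrow> E u v = E u' v) \<and>
     (\<forall>u\<in>F. \<forall>v\<in>F. E u v = E v u) \<and>
     (\<forall>u\<in>F. \<forall>v\<in>F. \<forall>w\<in>F. E (\<lambda>x. u x + v x) w = E u w + E v w) \<and>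
     (\<forall>c. \<forall>u\<in>F. \<forall>v\<in>F. E (\<lambda>x. c * u x) v = c * E u v) \<and>
     (\<forall>u\<in>F. E u u \<ge> 0)"

definition form_1 ::
    "'a measure \<Rightarrow> (('a \<Rightarrow> real) \<Rightarrow> ('a \<Rightarrow> real) \<Rightarrow> real) \<Rightarrow> ('a \<Rightarrow> real) \<Rightarrow> ('a \<Rightarrow> real) \<Rightarrow> real" where
  "form_1 M E u v = E u v + (\<integral>x. u x * v x \<partial>M)"

(* The squared distance of \<open>u\<close> and \<open>v\<close> in the norm of the form domain. *)
definition form_1_sqdist ::
    "'a measure \<Rightarrow> (('a \<Rightarrow> real) \<Rightarrow> ('a \<Rightarrow> real) \<Rightarrow> real) \<Rightarrow> ('a \<Rightarrow> real) \<Rightarrow> ('a \<Rightarrow> real) \<Rightarrow> real" where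
  "form_1_sqdist M E u v = form_1 M E (\<lambda>x. u x - v x) (\<lambda>x. u x - v x)"

definition closed_form ::
    "'a measure \<Rightarrow> (('a \<Rightarrow> real) \<Rightarrow> ('a \<Rightarrow> real) \<Rightarrow> real) \<Rightarrow> ('a \<Rightarrow> real) set \<Rightarrow> bool" where
  "closed_form M E F \<longleftrightarrow>
     (\<forall>u :: nat \<Rightarrow> 'a \<Rightarrow> real. (\<forall>n. u n \<in> F) \<longrightarrow>
        (\<forall>e>0. \<exists>N. \<forall>m\<ge>N. \<forall>n\<ge>N. form_1_sqdist M E (u m) (u n) < e) \<longrightarrow>
        (\<exists>w\<in>F. (\<lambda>n. form_1_sqdist M E (u n) w) \<longlonglongrightarrow> 0))"

definition markovian_form ::
    "(('a \<Rightarrow> real) \<Rightarrow> ('a \<Rightarrow> real) \<Rightarrow> real) \<Rightarrow> ('a \<Rightarrow> real) set \<Rightarrow> bool" where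
  "markovian_form E F \<longleftrightarrow>
     (\<forall>u\<in>F. let v = (\<lambda>x. min (max 0 (u x)) 1) in v \<in> F \<and> E v v \<le> E u u)"

definition dirichlet_form ::
    "'a measure \<Rightarrow> (('a \<Rightarrow> real) \<Rightarrow> ('a \<Rightarrow> real) \<Rightarrow> real) \<Rightarrow> ('a \<Rightarrow> real) set \<Rightarrow> bool" where
  "dirichlet_form M E F \<longleftrightarrow> symmetric_form M E F \<and> closed_form M E F \<and> markovian_form E F"

(* The functions whose restriction to \<open>X\<close> is continuous with compact support in \<open>X\<close>. *)
definition Cc_funs :: "'a::topological_space set \<Rightarrow> ('a \<Rightarrow> real) set" where
  "Cc_funs X = {u. continuous_on X u \<and> (\<exists>C. compact C \<and> C \<subseteq> X \<and> (\<forall>x\<in>X - C. u x = 0))}"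

definition regular_dirichlet_form ::
    "'a::{metric_space, second_countable_topology} measure \<Rightarrow>
     (('a \<Rightarrow> real) \<Rightarrow> ('a \<Rightarrow> real) \<Rightarrow> real) \<Rightarrow> ('a \<Rightarrow> real) set \<Rightarrow> bool" where
  "regular_dirichlet_form M E F \<longleftrightarrow>
     dirichlet_base M \<and> dirichlet_form M E F \<and>
     (\<forall>u\<in>F. \<forall>e>0. \<exists>v\<in>F \<inter> Cc_funs (space M). form_1_sqdist M E u v < e) \<and>
     (\<forall>g\<in>Cc_funs (space M). \<forall>e>0. \<exists>v\<in>F \<inter> Cc_funs (space M). \<forall>x\<in>space M. \<bar>g x - v x\<bar> < e)"

(* The norm of the product type \<open>real \<times> real\<close> is the Euclidean one. *)
definition carpet_points :: "(real \<times> real) list" where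
  "carpet_points =
     [(0, 0), (1/2, 0), (1, 0), (1, 1/2), (1, 1), (1/2, 1), (0, 1), (0, 1/2)]"

definition carpet_map :: "nat \<Rightarrow> real \<times> real \<Rightarrow> real \<times> real" where
  "carpet_map i x = (x + 2 *\<^sub>R (carpet_points ! i)) /\<^sub>R 3"

definition carpet :: "(real \<times> real) set" where
  "carpet = (THE K. K \<noteq> {} \<and> compact K \<and> K = (\<Union>i\<in>{0..7}. carpet_map i ` K))"

definition carpet_dim :: real where
  "carpet_dim = ln 8 / ln 3"

(* \<open>uniform_measure M A\<close> is normalized to have total mass one but still lives on the whole plane;
   the restriction turns it into a measure with underlying space \<open>carpet\<close>. *)
definition carpet_measure :: "(real \<times> real) measure" where
  "carpet_measure = restrict_space (uniform_measure (hausdorff_measure carpet_dim) carpet) carpet"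

definition carpet_energy :: "real \<Rightarrow> (real \<times> real \<Rightarrow> real) \<Rightarrow> ennreal" where
  "carpet_energy \<beta> u =
     (\<integral>\<^sup>+x. \<integral>\<^sup>+y. ennreal ((u x - u y)\<^sup>2 / norm (x - y) powr (carpet_dim + \<beta>))
        \<partial>carpet_measure \<partial>carpet_measure)"

definition carpet_domain :: "real \<Rightarrow> (real \<times> real \<Rightarrow> real) set" where
  "carpet_domain \<beta> = {u \<in> L2_funs carpet_measure. carpet_energy \<beta> u < \<infinity>}"

(* The bilinear form obtained from the quadratic form \<open>carpet_energy\<close> by polarization;
   \<open>carpet_form \<beta> u u\<close> is the energy of \<open>u\<close> for every \<open>u \<in> carpet_domain \<beta>\<close>. *)
definition carpet_form ::
    "real \<Rightarrow> (real \<times> real \<Rightarrow> real) \<Rightarrow> (real \<times> real \<Rightarrow> real) \<Rightarrow> real" where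
  "carpet_form \<beta> u v =
     (\<integral>x. \<integral>y. (u x - u y) * (v x - v y) / norm (x - y) powr (carpet_dim + \<beta>)
        \<partial>carpet_measure \<partial>carpet_measure)"

(* The supremum is taken in the extended reals, so that membership in a real interval entails
   that the set is nonempty and bounded above. *)
definition carpet_walk_dim :: ereal where
  "carpet_walk_dim =
     Sup {ereal \<beta> |\<beta>. \<beta> > 0 \<and>
            regular_dirichlet_form carpet_measure (carpet_form \<beta>) (carpet_domain \<beta>)}"

end

theory Submission
  imports Defs
begin

text \<open>
  The exponent \<open>\<beta>\<close> enters through the number \<open>3 powr \<beta>\<close>. At level \<open>n\<close> the carpet consists of
  \<open>8 ^ n\<close> cells of measure \<open>1 / 8 ^ n\<close> and diameter about \<open>1 / 3 ^ n\<close>, so the part of the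
  energy that comes from pairs of points at distance about \<open>1 / 3 ^ n\<close> is, up to constants,
  \<open>(3 powr \<beta> / 8) ^ n\<close> times the energy \<open>D n\<close> of \<open>u\<close> on the electrical network of cells of
  level \<open>n\<close>. The two bounds are the shorting bound \<open>7/6\<close> and the cutting bound \<open>3/2\<close> for the
  growth rate of the resistance of these networks.

  Lower bound. Shorting the columns of the network at every level leads to an explicit
  potential: the distribution function \<open>singular\<close> of the Bernoulli measure with digit weights
  2/7, 3/7, 2/7, applied to one coordinate. Its network energy is \<open>(6/7) ^ n\<close>, so its energy
  is finite for \<open>3 powr \<beta> < 8 * (7/6)\<close> (\<open>singular_coord_domain\<close>). It is continuous and
  strictly increasing, so the two functions obtained from the two coordinates separate the
  points of the carpet. For \<open>\<beta> > carpet_dim\<close> a Morrey inequality (\<open>morrey\<close>) embeds the domain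
  into the continuous functions. It makes the form closed and reduces regularity to the
  Stone-Weierstrass theorem (\<open>regular_if_separating\<close>).

  Upper bound. Cutting the network so that in every cell only the top and the bottom row
  remain leaves \<open>2 ^ n\<close> disjoint straight paths of \<open>3 ^ n\<close> cells, which lie over the middle
  third Cantor set. A unit flow spread evenly over these paths has energy \<open>(3/2) ^ n\<close>. If \<open>u\<close>
  is continuous with finite energy, then \<open>D n\<close> is at most of order \<open>(8 / 3 powr \<beta>) ^ n\<close>, so
  for \<open>3 powr \<beta> > 8 * (3/2)\<close> the mean difference of \<open>u\<close> between the ends of the paths vanishes
  in the limit. This holds in every cell and in both directions, so \<open>u\<close> is constant
  (\<open>continuous_form_domain_constant\<close>), and the form cannot be regular.

  Both parts rest on the fact that the normalized Hausdorff measure gives the mass \<open>1 / 8 ^ n\<close>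
  to each cell of level \<open>n\<close>. This requires that Borel sets are measurable for the Hausdorff
  outer measure and that the outer measure of the carpet is positive and finite
  (\<open>carpet_H_ge\<close>, \<open>carpet_H_le\<close>).
\<close>

section \<open>Hausdorff measures on Borel sets\<close>

lemma diam_power_empty [simp]: "diam_power s {} = 0"
  by (simp add: diam_power_def)

lemma hausdorff_premeasure_le:
  assumes "A \<subseteq> (\<Union>i. U i)" "\<And>i. bounded (U i)" "\<And>i. diameter (U i) \<le> \<delta>"
  shows "hausdorff_premeasure s \<delta> A \<le> (\<Sum>i. diam_power s (U i))"
  unfolding hausdorff_premeasure_def using assms by (intro INF_lower) auto

lemma hausdorff_premeasure_greatest:
  assumes "\<And>U :: nat \<Rightarrow> 'a::metric_space set. A \<subseteq> (\<Union>i. U i) \<Longrightarrow> (\<And>i. bounded (U i)) \<Longrightarrow>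
    (\<And>i. diameter (U i) \<le> \<delta>) \<Longrightarrow> c \<le> (\<Sum>i. diam_power s (U i))"
  shows "c \<le> hausdorff_premeasure s \<delta> A"
  unfolding hausdorff_premeasure_def using assms by (intro INF_greatest) auto

lemma hausdorff_premeasure_antimono:
  assumes "\<delta> \<le> \<delta>'"
  shows "hausdorff_premeasure s \<delta>' A \<le> hausdorff_premeasure s \<delta> A"
  using assms
  by (intro hausdorff_premeasure_greatest hausdorff_premeasure_le) (auto intro: order_trans)

lemma hausdorff_premeasure_mono:
  assumes "A \<subseteq> B"
  shows "hausdorff_premeasure s \<delta> A \<le> hausdorff_premeasure s \<delta> B"
  using assms by (intro hausdorff_premeasure_greatest hausdorff_premeasure_le) auto

lemma hausdorff_premeasure_empty:
  assumes "\<delta> \<ge> 0"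
  shows "hausdorff_premeasure s \<delta> {} = 0"
  using hausdorff_premeasure_le[of "{}" "\<lambda>_. {}" \<delta> s] assms by simp

lemma hausdorff_premeasure_le_outer:
  "\<delta> > 0 \<Longrightarrow> hausdorff_premeasure s \<delta> A \<le> hausdorff_outer_measure s A"
  unfolding hausdorff_outer_measure_def by (intro SUP_upper) auto

lemma ennreal_sum_half_powers: "(\<Sum>i. ennreal (e * (1/2) ^ Suc i)) = ennreal e" if "e \<ge> 0"
proof -
  have "(\<lambda>i. e * (1/2) ^ Suc i) sums (e * 1)"
    by (intro sums_mult power_half_series)
  then show ?thesis
    using that by (intro suminf_ennreal_eq) (auto simp: zero_le_mult_iff)
qed

lemma hausdorff_premeasure_countably_subadditive:
  fixes A :: "nat \<Rightarrow> 'a::metric_space set"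
  shows "hausdorff_premeasure s \<delta> (\<Union>i. A i) \<le> (\<Sum>i. hausdorff_premeasure s \<delta> (A i))"
proof (cases "(\<Sum>i. hausdorff_premeasure s \<delta> (A i)) = top")
  case False
  have fin: "hausdorff_premeasure s \<delta> (A i) < top" for i
    using False ennreal_suminf_lessD less_top by blast
  show ?thesis
  proof (rule ennreal_le_epsilon)
    fix e :: real assume e: "e > 0"
    have "\<exists>U :: nat \<Rightarrow> 'a set. A i \<subseteq> (\<Union>j. U j) \<and> (\<forall>j. bounded (U j) \<and> diameter (U j) \<le> \<delta>) \<and>
        (\<Sum>j. diam_power s (U j)) \<le> hausdorff_premeasure s \<delta> (A i) + ennreal (e * (1/2) ^ Suc i)" for i
    proof -
      have "hausdorff_premeasure s \<delta> (A i) < hausdorff_premeasure s \<delta> (A i) + ennreal (e * (1/2) ^ Suc i)"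
        using fin[of i] e by (simp add: ennreal_add_left_cancel_less)
      then show ?thesis
        unfolding hausdorff_premeasure_def[of s \<delta> "A i"] INF_less_iff
        by (auto intro: less_imp_le)
    qed
    then obtain U :: "nat \<Rightarrow> nat \<Rightarrow> 'a set" where U: "\<And>i. A i \<subseteq> (\<Union>j. U i j)"
      "\<And>i j. bounded (U i j)" "\<And>i j. diameter (U i j) \<le> \<delta>"
      "\<And>i. (\<Sum>j. diam_power s (U i j)) \<le> hausdorff_premeasure s \<delta> (A i) + ennreal (e * (1/2) ^ Suc i)"
      by metis
    define V where "V k = (case prod_decode k of (i, j) \<Rightarrow> U i j)" for k
    have "(\<Union>i. A i) \<subseteq> (\<Union>k. V k)"
    proof
      fix x assume "x \<in> (\<Union>i. A i)"
      then obtain i j where "x \<in> U i j" using U(1) by blast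
      then have "x \<in> V (prod_encode (i, j))" by (simp add: V_def)
      then show "x \<in> (\<Union>k. V k)" by blast
    qed
    then have "hausdorff_premeasure s \<delta> (\<Union>i. A i) \<le> (\<Sum>k. diam_power s (V k))"
      using U(2,3) by (intro hausdorff_premeasure_le) (auto simp: V_def split: prod.split)
    also have "\<dots> = (\<Sum>k. (\<lambda>(i, j). diam_power s (U i j)) (prod_decode k))"
      by (intro suminf_cong) (auto simp: V_def split: prod.split)
    also have "\<dots> = (\<Sum>i. \<Sum>j. diam_power s (U i j))"
      by (rule suminf_ennreal_2dimen) auto
    also have "\<dots> \<le> (\<Sum>i. hausdorff_premeasure s \<delta> (A i) + ennreal (e * (1/2) ^ Suc i))"
      by (intro suminf_le U(4)) auto
    also have "\<dots> = (\<Sum>i. hausdorff_premeasure s \<delta> (A i)) + ennreal e"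
      using e by (subst suminf_add[symmetric]) (simp_all only: ennreal_sum_half_powers less_imp_le summableI)
    finally show "hausdorff_premeasure s \<delta> (\<Union>i. A i) \<le> (\<Sum>i. hausdorff_premeasure s \<delta> (A i)) + ennreal e" .
  qed
qed simp

lemma hausdorff_outer_measure_countably_subadditive:
  "hausdorff_outer_measure s (\<Union>i::nat. A i) \<le> (\<Sum>i. hausdorff_outer_measure s (A i))"
proof -
  have "hausdorff_premeasure s \<delta> (\<Union>i. A i) \<le> (\<Sum>i. hausdorff_outer_measure s (A i))" if "\<delta> > 0" for \<delta>
    by (rule order_trans[OF hausdorff_premeasure_countably_subadditive])
       (intro suminf_le hausdorff_premeasure_le_outer that, auto)
  then show ?thesis
    unfolding hausdorff_outer_measure_def[of s "\<Union>i. A i"] by (intro SUP_least) auto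
qed

lemma hausdorff_outer_measure_mono:
  "A \<subseteq> B \<Longrightarrow> hausdorff_outer_measure s A \<le> hausdorff_outer_measure s B"
  unfolding hausdorff_outer_measure_def by (intro SUP_mono) (auto intro: hausdorff_premeasure_mono)

lemma hausdorff_outer_measure_empty [simp]: "hausdorff_outer_measure s {} = 0"
proof -
  have "hausdorff_outer_measure s ({}::'a set) \<le> 0"
    unfolding hausdorff_outer_measure_def
    by (intro SUP_least) (simp add: hausdorff_premeasure_empty)
  then show ?thesis by simp
qed

text \<open>A set of diameter at most \<open>\<delta>\<close> meets at most one of two sets that are farther than \<open>\<delta>\<close> apart,
  so every admissible cover of the union splits into a cover of each of the two sets.\<close>

lemma hausdorff_premeasure_separated:
  fixes A B :: "'a::metric_space set"
  assumes sep: "\<And>x y. x \<in> A \<Longrightarrow> y \<in> B \<Longrightarrow> dist x y > \<delta>"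
  shows "hausdorff_premeasure s \<delta> A + hausdorff_premeasure s \<delta> B \<le> hausdorff_premeasure s \<delta> (A \<union> B)"
proof (rule hausdorff_premeasure_greatest)
  fix U :: "nat \<Rightarrow> 'a set"
  assume U: "A \<union> B \<subseteq> (\<Union>i. U i)" "\<And>i. bounded (U i)" "\<And>i. diameter (U i) \<le> \<delta>"
  have \<delta>: "\<delta> \<ge> 0" using diameter_ge_0[OF U(2)] U(3) order_trans by blast
  define V where "V C i = (if U i \<inter> C = {} then {} else U i)" for C i
  have cover: "hausdorff_premeasure s \<delta> C \<le> (\<Sum>i. diam_power s (V C i))" if "C \<subseteq> A \<union> B" for C
  proof (rule hausdorff_premeasure_le)
    show "C \<subseteq> (\<Union>i. V C i)" using U(1) that by (force simp: V_def)
  qed (use U \<delta> in \<open>auto simp: V_def\<close>)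
  have disj: "U i \<inter> A = {} \<or> U i \<inter> B = {}" for i
  proof (rule ccontr)
    assume "\<not> ?thesis"
    then obtain x y where "x \<in> U i" "y \<in> U i" "x \<in> A" "y \<in> B"
      by auto
    then show False
      using sep[of x y] diameter_bounded_bound[OF U(2), of x i y] U(3)[of i] by simp
  qed
  have "hausdorff_premeasure s \<delta> A + hausdorff_premeasure s \<delta> B
      \<le> (\<Sum>i. diam_power s (V A i)) + (\<Sum>i. diam_power s (V B i))"
    by (intro add_mono cover) auto
  also have "\<dots> = (\<Sum>i. diam_power s (V A i) + diam_power s (V B i))"
    by (intro suminf_add) auto
  also have "\<dots> \<le> (\<Sum>i. diam_power s (U i))"
  proof (rule suminf_le)
    show "diam_power s (V A i) + diam_power s (V B i) \<le> diam_power s (U i)" for i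
      using disj[of i] by (auto simp: V_def)
  qed auto
  finally show "hausdorff_premeasure s \<delta> A + hausdorff_premeasure s \<delta> B \<le> (\<Sum>i. diam_power s (U i))" .
qed

lemma hausdorff_outer_measure_separated:
  fixes A B :: "'a::metric_space set"
  assumes d: "d > 0" and sep: "\<And>x y. x \<in> A \<Longrightarrow> y \<in> B \<Longrightarrow> dist x y \<ge> d"
  shows "hausdorff_outer_measure s A + hausdorff_outer_measure s B \<le> hausdorff_outer_measure s (A \<union> B)"
proof -
  have *: "hausdorff_premeasure s \<delta>1 A + hausdorff_premeasure s \<delta>2 B \<le> hausdorff_outer_measure s (A \<union> B)"
    if "\<delta>1 > 0" "\<delta>2 > 0" for \<delta>1 \<delta>2
  proof -
    define \<delta> where "\<delta> = min (min \<delta>1 \<delta>2) (d/2)"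
    have \<delta>: "\<delta> > 0" "\<delta> \<le> \<delta>1" "\<delta> \<le> \<delta>2" "\<delta> < d" using that d by (auto simp: \<delta>_def)
    have "hausdorff_premeasure s \<delta>1 A + hausdorff_premeasure s \<delta>2 B
        \<le> hausdorff_premeasure s \<delta> A + hausdorff_premeasure s \<delta> B"
      by (intro add_mono hausdorff_premeasure_antimono \<delta>)
    also have "\<dots> \<le> hausdorff_premeasure s \<delta> (A \<union> B)"
      using sep \<delta> by (intro hausdorff_premeasure_separated) force
    also have "\<dots> \<le> hausdorff_outer_measure s (A \<union> B)"
      by (rule hausdorff_premeasure_le_outer[OF \<delta>(1)])
    finally show ?thesis .
  qed
  have "hausdorff_premeasure s \<delta>1 A + hausdorff_outer_measure s B \<le> hausdorff_outer_measure s (A \<union> B)"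
    if "\<delta>1 > 0" for \<delta>1
    unfolding hausdorff_outer_measure_def[of s B] using *[OF that]
    by (subst ennreal_SUP_add_right) (auto intro!: SUP_least)
  then show ?thesis
    unfolding hausdorff_outer_measure_def[of s A]
    by (subst ennreal_SUP_add_left[symmetric]) (auto intro!: SUP_least)
qed

text \<open>Caratheodory's criterion for metric outer measures. The set \<open>T - C\<close> is exhausted by the parts
  \<open>T' n\<close> at distance at least \<open>1/(n+1)\<close> from \<open>C\<close>, for which the separation hypothesis gives
  \<open>\<mu> (T \<inter> C) + \<mu> (T' n) \<le> \<mu> T\<close>. What is missing from \<open>T' n\<close> is covered by the shells \<open>R k\<close> with
  \<open>k \<ge> n\<close>. The total measure of all shells is at most \<open>2 * \<mu> T\<close>, so this error vanishes as
  \<open>n\<close> grows. To avoid a subtraction, the shells before \<open>n\<close> are added on both sides.\<close>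

lemma caratheodory_criterion:
  fixes \<mu> :: "'a::metric_space set \<Rightarrow> ennreal"
  assumes empty: "\<mu> {} = 0"
    and mono: "\<And>A B. A \<subseteq> B \<Longrightarrow> \<mu> A \<le> \<mu> B"
    and subadd: "\<And>A :: nat \<Rightarrow> 'a set. \<mu> (\<Union>i. A i) \<le> (\<Sum>i. \<mu> (A i))"
    and sep: "\<And>A B d. d > 0 \<Longrightarrow> (\<And>x y. x \<in> A \<Longrightarrow> y \<in> B \<Longrightarrow> dist x y \<ge> d) \<Longrightarrow> \<mu> A + \<mu> B \<le> \<mu> (A \<union> B)"
    and C: "closed C"
  shows "\<mu> (T \<inter> C) + \<mu> (T - C) \<le> \<mu> T"
proof (cases "C = {} \<or> \<mu> T = top")
  case True
  then show ?thesis using empty by auto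
next
  case False
  define D where "D x = infdist x C" for x
  have D_lip: "D x \<le> D y + dist x y" for x y
    unfolding D_def by (rule infdist_triangle)
  define R where "R k = {x \<in> T. 1 / real (k + 2) \<le> D x \<and> D x < 1 / real (k + 1)}" for k
  define T' where "T' n = {x \<in> T. 1 / real (n + 1) \<le> D x}" for n
  have subadd2: "\<mu> (A \<union> B) \<le> \<mu> A + \<mu> B" for A B
  proof -
    have "\<mu> (\<Union>i. binaryset A B i) \<le> (\<Sum>i. \<mu> (binaryset A B i))" by (rule subadd)
    also have "\<dots> = \<mu> A + \<mu> B" using empty by (simp add: suminf_binaryset_eq)
    finally show ?thesis by (simp add: UN_binaryset_eq)
  qed
  \<comment> \<open>Shells whose indices have the same parity are at positive distance from each other.\<close>
  have shells: "(\<Sum>k<N. \<mu> (R (2 * k + c))) \<le> \<mu> T" for N c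
  proof -
    have "(\<Sum>k<N. \<mu> (R (2 * k + c))) \<le> \<mu> (\<Union>k<N. R (2 * k + c))"
    proof (induction N)
      case (Suc N)
      have "(\<Sum>k<Suc N. \<mu> (R (2 * k + c))) \<le> \<mu> (\<Union>k<N. R (2 * k + c)) + \<mu> (R (2 * N + c))"
        using Suc by (simp add: add_right_mono)
      also have "\<dots> \<le> \<mu> ((\<Union>k<N. R (2 * k + c)) \<union> R (2 * N + c))"
      proof (cases "N = 0")
        case True
        then show ?thesis using empty by simp
      next
        case N: False
        show ?thesis
        proof (rule sep)
          show "0 < 1 / real (2 * N + c) - 1 / real (2 * N + c + 1)"
            using divide_strict_left_mono[of "real (2 * N + c)" "real (2 * N + c + 1)" 1] N by simp
          fix x y assume "x \<in> (\<Union>k<N. R (2 * k + c))" and y: "y \<in> R (2 * N + c)"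
          then obtain k where k: "k < N" "x \<in> R (2 * k + c)" by auto
          have "1 / real (2 * N + c) \<le> 1 / real (2 * k + c + 2)"
            using k by (intro divide_left_mono) auto
          then have "1 / real (2 * N + c) \<le> D x" using k by (auto simp: R_def)
          moreover have "D y < 1 / real (2 * N + c + 1)" using y by (auto simp: R_def)
          ultimately show "1 / real (2 * N + c) - 1 / real (2 * N + c + 1) \<le> dist x y"
            using D_lip[of x y] by linarith
        qed
      qed
      also have "(\<Union>k<N. R (2 * k + c)) \<union> R (2 * N + c) = (\<Union>k<Suc N. R (2 * k + c))"
        by (auto simp: lessThan_Suc)
      finally show ?case .
    qed (simp add: empty)
    also have "\<dots> \<le> \<mu> T" by (intro mono) (auto simp: R_def)
    finally show ?thesis .
  qed
  define S where "S = (\<Sum>k. \<mu> (R k))"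
  have "S \<le> 2 * \<mu> T"
    unfolding S_def
  proof (rule suminf_le_const)
    fix n
    have "(\<Sum>k<n. \<mu> (R k)) \<le> (\<Sum>k<2*n. \<mu> (R k))"
      by (intro sum_mono2) auto
    also have "\<dots> = (\<Sum>k<n. \<mu> (R (2 * k))) + (\<Sum>k<n. \<mu> (R (2 * k + 1)))"
      by (induction n) (auto simp: algebra_simps)
    also have "\<dots> \<le> 2 * \<mu> T"
      using add_mono[OF shells[where N = n and c = 0] shells[where N = n and c = 1]] by (simp add: mult_2)
    finally show "(\<Sum>k<n. \<mu> (R k)) \<le> 2 * \<mu> T" .
  qed auto
  then have S_fin: "S < top"
    using False by (simp add: ennreal_mult_less_top less_top le_less_trans)
  have main: "\<mu> (T \<inter> C) + \<mu> (T - C) + (\<Sum>k<n. \<mu> (R k)) \<le> \<mu> T + S" for n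
  proof -
    have "T - C \<subseteq> T' n \<union> (\<Union>k. R (k + n))"
    proof
      fix x assume x: "x \<in> T - C"
      then have pos: "D x > 0"
        using C False by (simp add: D_def infdist_pos_not_in_closed)
      show "x \<in> T' n \<union> (\<Union>k. R (k + n))"
      proof (cases "1 / real (n + 1) \<le> D x")
        case True
        then show ?thesis using x by (auto simp: T'_def)
      next
        case far: False
        define m where "m = (LEAST m. 1 / real (m + 1) \<le> D x)"
        obtain m0 where m0: "1 / real (m0 + 1) < D x"
          using reals_Archimedean[OF pos] by (auto simp: inverse_eq_divide)
        have m: "1 / real (m + 1) \<le> D x"
          unfolding m_def by (rule LeastI[of _ m0]) (use m0 in simp)
        have "n < m"
        proof (rule ccontr)
          assume "\<not> n < m"
          then have "1 / real (n + 1) \<le> 1 / real (m + 1)" by (intro divide_left_mono) auto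
          then show False using m far by simp
        qed
        then obtain k where k: "m = k + n + 1" using less_iff_Suc_add[of n m] by auto
        have "\<not> 1 / real (k + n + 1) \<le> D x"
          using not_less_Least[of "k + n" "\<lambda>m. 1 / real (m + 1) \<le> D x"] k
          unfolding m_def by simp
        moreover have "1 / real (k + n + 2) \<le> D x" using m k by (simp add: algebra_simps)
        ultimately have "x \<in> R (k + n)" using x by (auto simp: R_def)
        then show ?thesis by auto
      qed
    qed
    then have "\<mu> (T - C) \<le> \<mu> (T' n) + \<mu> (\<Union>k. R (k + n))"
      by (intro order_trans[OF mono subadd2])
    also have "\<dots> \<le> \<mu> (T' n) + (\<Sum>k. \<mu> (R (k + n)))"
      by (intro add_left_mono subadd)
    finally have 1: "\<mu> (T - C) \<le> \<mu> (T' n) + (\<Sum>k. \<mu> (R (k + n)))" .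
    have 2: "\<mu> (T \<inter> C) + \<mu> (T' n) \<le> \<mu> T"
    proof -
      have "\<mu> (T \<inter> C) + \<mu> (T' n) \<le> \<mu> ((T \<inter> C) \<union> T' n)"
      proof (rule sep)
        fix x y assume "x \<in> T \<inter> C" "y \<in> T' n"
        then show "1 / real (n + 1) \<le> dist x y"
          using infdist_le[of x C y] by (auto simp: T'_def D_def dist_commute)
      qed simp
      also have "\<dots> \<le> \<mu> T" by (intro mono) (auto simp: T'_def)
      finally show ?thesis .
    qed
    have 3: "(\<Sum>k. \<mu> (R (k + n))) + (\<Sum>k<n. \<mu> (R k)) = S"
      unfolding S_def by (rule suminf_offset[symmetric]) auto
    have "\<mu> (T \<inter> C) + \<mu> (T - C) + (\<Sum>k<n. \<mu> (R k))
        \<le> \<mu> (T \<inter> C) + (\<mu> (T' n) + (\<Sum>k. \<mu> (R (k + n)))) + (\<Sum>k<n. \<mu> (R k))"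
      by (intro add_mono 1) auto
    also have "\<dots> = (\<mu> (T \<inter> C) + \<mu> (T' n)) + S"
      by (simp add: 3[symmetric] ac_simps)
    also have "\<dots> \<le> \<mu> T + S" by (intro add_mono 2) auto
    finally show ?thesis .
  qed
  have "\<mu> (T \<inter> C) + \<mu> (T - C) + S \<le> \<mu> T + S"
  proof (rule LIMSEQ_le_const2)
    show "(\<lambda>n. \<mu> (T \<inter> C) + \<mu> (T - C) + (\<Sum>k<n. \<mu> (R k))) \<longlonglongrightarrow> \<mu> (T \<inter> C) + \<mu> (T - C) + S"
      unfolding S_def by (intro tendsto_add tendsto_const summable_LIMSEQ) auto
  qed (use main in auto)
  then show ?thesis
    using S_fin by (simp add: ennreal_add_left_cancel_le add.commute[of _ S] less_top[symmetric])
qed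

text \<open>The value of \<open>measure_of\<close> is the given set function only if that function is countably additive.
  By the criterion above, closed sets, hence Borel sets, lie in the Caratheodory sigma algebra of the
  Hausdorff outer measure, where this is the case.\<close>

theorem emeasure_hausdorff_measure:
  fixes A :: "'a::metric_space set"
  assumes "A \<in> sets borel"
  shows "emeasure (hausdorff_measure s) A = hausdorff_outer_measure s A"
proof -
  let ?H = "hausdorff_outer_measure s :: 'a set \<Rightarrow> ennreal"
  let ?L = "lambda_system UNIV (Pow UNIV) ?H"
  have subadd: "countably_subadditive (Pow UNIV) ?H"
    unfolding countably_subadditive_def using hausdorff_outer_measure_countably_subadditive by auto
  have outer: "outer_measure_space (Pow UNIV) ?H"
    using subadd
    by (auto simp: outer_measure_space_def positive_def increasing_def hausdorff_outer_measure_mono)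
  interpret P: sigma_algebra "UNIV :: 'a set" "Pow UNIV"
    by (rule sigma_algebra_Pow)
  have L: "measure_space UNIV ?L ?H"
    using P.caratheodory_lemma[OF outer] by simp
  then interpret L: sigma_algebra UNIV ?L by (simp add: measure_space_def)
  have "closed C \<Longrightarrow> C \<in> ?L" for C :: "'a set"
  proof -
    assume C: "closed C"
    have "?H (T \<inter> C) + ?H (T - C) = ?H T" for T
    proof (rule antisym)
      show "?H (T \<inter> C) + ?H (T - C) \<le> ?H T"
        by (rule caratheodory_criterion[OF _ _ _ _ C])
           (auto intro: hausdorff_outer_measure_mono hausdorff_outer_measure_countably_subadditive
             hausdorff_outer_measure_separated)
      have "?H (\<Union>i. binaryset (T \<inter> C) (T - C) i) \<le> (\<Sum>i. ?H (binaryset (T \<inter> C) (T - C) i))"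
        by (rule hausdorff_outer_measure_countably_subadditive)
      then show "?H T \<le> ?H (T \<inter> C) + ?H (T - C)"
        by (simp add: suminf_binaryset_eq UN_binaryset_eq Int_Diff_Un)
    qed
    then show "C \<in> ?L" by (subst P.lambda_system_eq) simp
  qed
  then have "sigma_sets UNIV (Collect closed) \<subseteq> ?L"
    by (intro L.sigma_sets_subset) auto
  then have sub: "sets borel \<subseteq> ?L"
    by (simp add: borel_eq_closed)
  have "measure_space UNIV (sets borel) ?H"
    using measure_down[OF L _ sub] sets.sigma_algebra_axioms[of "borel :: 'a measure"] by simp
  then show ?thesis
    unfolding hausdorff_measure_def
    using assms by (intro emeasure_measure_of_sigma) (auto simp: measure_space_def)
qed

lemma sets_hausdorff_measure [measurable_cong, simp]:
  "sets (hausdorff_measure s :: 'a::metric_space measure) = sets borel"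
  unfolding hausdorff_measure_def by (metis sets.sigma_sets_eq sets_measure_of sets.space_closed space_borel)

lemma space_hausdorff_measure [simp]: "space (hausdorff_measure s) = UNIV"
  unfolding hausdorff_measure_def by (rule space_measure_of_conv)

lemma diameter_leI:
  fixes U :: "'a::metric_space set"
  assumes "d \<ge> 0" "\<And>x y. x \<in> U \<Longrightarrow> y \<in> U \<Longrightarrow> dist x y \<le> d"
  shows "diameter U \<le> d"
proof (cases "U = {}")
  case False
  then have "diameter U = (SUP (x, y)\<in>U \<times> U. dist x y)"
    by (simp add: diameter_def)
  also have "\<dots> \<le> d" using False assms by (intro cSUP_least) auto
  finally show ?thesis .
qed (simp add: assms)

lemma hausdorff_outer_measure_lipschitz_image:
  fixes f :: "'a::metric_space \<Rightarrow> 'b::metric_space"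
  assumes L: "L > 0" and s: "s > 0"
    and lip: "\<And>x y. dist (f x) (f y) \<le> L * dist x y"
  shows "hausdorff_outer_measure s (f ` A) \<le> ennreal (L powr s) * hausdorff_outer_measure s A"
proof -
  have im: "bounded (f ` U) \<and> diameter (f ` U) \<le> L * diameter U" if "bounded U" for U
  proof -
    have d: "dist (f x) (f y) \<le> L * diameter U" if "x \<in> U" "y \<in> U" for x y
      using lip[of x y] diameter_bounded_bound[OF \<open>bounded U\<close> that] L
      by (meson mult_left_mono less_imp_le order_trans)
    have "bounded (f ` U)"
      unfolding bounded_two_points using d by auto
    moreover have "diameter (f ` U) \<le> L * diameter U"
      using d diameter_ge_0[OF that] L by (intro diameter_leI) auto
    ultimately show ?thesis by blast
  qed
  have "hausdorff_premeasure s \<delta> (f ` A) \<le> ennreal (L powr s) * hausdorff_outer_measure s A" if "\<delta> > 0" for \<delta>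
  proof -
    have "ennreal (1 / L powr s) * hausdorff_premeasure s \<delta> (f ` A) \<le> hausdorff_premeasure s (\<delta> / L) A"
    proof (rule hausdorff_premeasure_greatest)
      fix U :: "nat \<Rightarrow> 'a set"
      assume U: "A \<subseteq> (\<Union>i. U i)" "\<And>i. bounded (U i)" "\<And>i. diameter (U i) \<le> \<delta> / L"
      have dp: "diam_power s (f ` U i) \<le> ennreal (L powr s) * diam_power s (U i)" for i
      proof (cases "U i = {}")
        case False
        have "diameter (f ` U i) powr s \<le> (L * diameter (U i)) powr s"
          using im[OF U(2)] diameter_ge_0 s by (intro powr_mono2) auto
        also have "\<dots> = L powr s * diameter (U i) powr s"
          using L diameter_ge_0[OF U(2)] by (simp add: powr_mult)
        finally show ?thesis
          using False s L by (simp add: diam_power_def ennreal_mult[symmetric] ennreal_leI)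
      qed simp
      have "hausdorff_premeasure s \<delta> (f ` A) \<le> (\<Sum>i. diam_power s (f ` U i))"
      proof (rule hausdorff_premeasure_le)
        show "f ` A \<subseteq> (\<Union>i. f ` U i)" using U(1) by blast
        show "bounded (f ` U i)" for i using im[OF U(2)] by blast
        show "diameter (f ` U i) \<le> \<delta>" for i
          using im[OF U(2), of i] U(3)[of i] L by (simp add: field_simps)
      qed
      also have "\<dots> \<le> (\<Sum>i. ennreal (L powr s) * diam_power s (U i))"
        by (intro suminf_le dp) auto
      also have "\<dots> = ennreal (L powr s) * (\<Sum>i. diam_power s (U i))"
        by simp
      finally have "ennreal (1 / L powr s) * hausdorff_premeasure s \<delta> (f ` A)
          \<le> ennreal (1 / L powr s) * (ennreal (L powr s) * (\<Sum>i. diam_power s (U i)))"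
        by (rule mult_left_mono) simp
      also have "\<dots> = (\<Sum>i. diam_power s (U i))"
        using L by (simp add: mult.assoc[symmetric] ennreal_mult[symmetric])
      finally show "ennreal (1 / L powr s) * hausdorff_premeasure s \<delta> (f ` A) \<le> (\<Sum>i. diam_power s (U i))" .
    qed
    also have "\<dots> \<le> hausdorff_outer_measure s A"
      using that L by (intro hausdorff_premeasure_le_outer) simp
    finally have "ennreal (L powr s) * (ennreal (1 / L powr s) * hausdorff_premeasure s \<delta> (f ` A))
        \<le> ennreal (L powr s) * hausdorff_outer_measure s A"
      by (rule mult_left_mono) simp
    then show ?thesis
      using L by (simp add: mult.assoc[symmetric] ennreal_mult[symmetric])
  qed
  then show ?thesis
    unfolding hausdorff_outer_measure_def[of s "f ` A"] by (intro SUP_least) auto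
qed

section \<open>The carpet and its cells\<close>

text \<open>The doubled fixed points \<open>2 p\<^sub>i\<close>. With them each contraction reads \<open>(x + d) / 3\<close>, so that a cell
  of level \<open>n\<close> is a copy of the carpet, reduced by the factor \<open>3 ^ n\<close> and translated by an integer
  vector divided by \<open>3 ^ n\<close>. Cells are therefore indexed by integer positions instead of words.\<close>

definition carpet_digits :: "(nat \<times> nat) set" where
  "carpet_digits = {(0, 0), (1, 0), (2, 0), (2, 1), (2, 2), (1, 2), (0, 2), (0, 1)}"

primrec carpet_pos :: "nat \<Rightarrow> (nat \<times> nat) set" where
  "carpet_pos 0 = {(0, 0)}"
| "carpet_pos (Suc n) =
     (\<lambda>((i, j), (a, b)). (3 * i + a, 3 * j + b)) ` (carpet_pos n \<times> carpet_digits)"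

definition cell_map :: "nat \<Rightarrow> nat \<times> nat \<Rightarrow> real \<times> real \<Rightarrow> real \<times> real" where
  "cell_map n p z = ((real (fst p) + fst z) / 3 ^ n, (real (snd p) + snd z) / 3 ^ n)"

definition cell :: "nat \<Rightarrow> nat \<times> nat \<Rightarrow> (real \<times> real) set" where
  "cell n p = cell_map n p ` carpet"

lemma cell_map_dist: "dist (cell_map n p x) (cell_map n p y) = dist x y / 3 ^ n"
proof -
  have "cell_map n p x - cell_map n p y = (1 / 3 ^ n) *\<^sub>R (x - y)"
    by (auto simp: cell_map_def prod_eq_iff field_simps)
  then show ?thesis by (simp add: dist_norm)
qed

lemma inj_cell_map: "inj (cell_map n p)"
proof (rule injI)
  fix x y assume "cell_map n p x = cell_map n p y"
  then have "dist (cell_map n p x) (cell_map n p y) = 0" by simp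
  then show "x = y" unfolding cell_map_dist by simp
qed

lemma continuous_on_cell_map: "continuous_on A (cell_map n p)"
  unfolding cell_map_def by (intro continuous_intros) auto

lemma cell_map_0 [simp]: "cell_map 0 (0, 0) = id"
  by (auto simp: cell_map_def)

lemma cell_map_comp:
  "cell_map k (i, j) (cell_map m (a, b) z) = cell_map (k + m) (3 ^ m * i + a, 3 ^ m * j + b) z"
  by (auto simp: cell_map_def field_simps power_add)

lemma finite_carpet_digits [simp]: "finite carpet_digits"
  by (simp add: carpet_digits_def)

lemma carpet_map_cell_map:
  "(\<Union>k\<in>{0..7}. carpet_map k ` K) = (\<Union>p\<in>carpet_digits. cell_map 1 p ` K)"
proof -
  have "{0..7} = {0, 1, 2, 3, 4, 5, 6, 7 :: nat}" by auto
  moreover have "carpet_map k = cell_map 1 (nat \<lfloor>2 * fst (carpet_points ! k)\<rfloor>, nat \<lfloor>2 * snd (carpet_points ! k)\<rfloor>)"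
    if "k \<in> {0, 1, 2, 3, 4, 5, 6, 7}" for k
    using that by (auto simp: carpet_map_def cell_map_def carpet_points_def fun_eq_iff prod_eq_iff)
  ultimately show ?thesis
    by (simp add: carpet_digits_def carpet_points_def)
qed

definition carpet_like :: "(real \<times> real) set \<Rightarrow> bool" where
  "carpet_like K \<longleftrightarrow> K \<noteq> {} \<and> compact K \<and> K = (\<Union>p\<in>carpet_digits. cell_map 1 p ` K)"

text \<open>At a point of \<open>K\<close> at the largest distance from \<open>L\<close> the self-similarity of both sets bounds this
  distance by a third of itself. Applied in both directions this is the uniqueness of the carpet.\<close>

lemma carpet_like_subset:
  assumes K: "carpet_like K" and L: "carpet_like L"
  shows "K \<subseteq> L"
proof -
  have "compact K" "K \<noteq> {}" "continuous_on K (\<lambda>x. infdist x L)"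
    using K by (auto simp: carpet_like_def intro: continuous_intros)
  then obtain x where x: "x \<in> K" "\<And>y. y \<in> K \<Longrightarrow> infdist y L \<le> infdist x L"
    using continuous_attains_sup by metis
  have "x \<in> (\<Union>p\<in>carpet_digits. cell_map 1 p ` K)"
    using x(1) K unfolding carpet_like_def by blast
  then obtain p y where y: "p \<in> carpet_digits" "y \<in> K" "x = cell_map 1 p y"
    by blast
  have L': "closed L" "L \<noteq> {}" using L by (auto simp: carpet_like_def compact_imp_closed)
  obtain z where z: "z \<in> L" "infdist y L = dist y z"
    using infdist_attains_inf[OF L'] by metis
  have "cell_map 1 p z \<in> L" using L z y unfolding carpet_like_def by blast
  then have "infdist x L \<le> dist (cell_map 1 p y) (cell_map 1 p z)"
    unfolding y(3) by (rule infdist_le)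
  also have "\<dots> = infdist y L / 3" by (simp add: cell_map_dist z)
  also have "\<dots> \<le> infdist x L / 3" using x(2)[OF y(2)] by simp
  finally have "infdist x L \<le> 0" by simp
  then have "infdist w L = 0" if "w \<in> K" for w
    using x(2)[OF that] infdist_nonneg[of w L] by simp
  then show ?thesis using in_closed_iff_infdist_zero[OF L'] by auto
qed

text \<open>Three corners suffice: the two edges of the unit square that meet at the origin are the ones along
  which the values of a function are compared later.\<close>

definition carpet_corners :: "(real \<times> real) set" where
  "carpet_corners = {(0, 0), (1, 0), (0, 1)}"

text \<open>The carpet is the intersection of the decreasing images of the unit square under the Hutchinson
  operator. Because there are only finitely many contractions and they are injective, the operator
  commutes with this intersection. The corners are fixed points of contractions and hence survive.\<close>

lemma carpet_like_exists: "\<exists>K. carpet_like K \<and> K \<subseteq> {0..1} \<times> {0..1} \<and> carpet_corners \<subseteq> K"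
proof -
  define F where "F A = (\<Union>p\<in>carpet_digits. cell_map 1 p ` A)" for A
  define S where "S n = (F ^^ n) ({0..1} \<times> {0..1})" for n
  have S_0: "S 0 = {0..1} \<times> {0..1}" and S_Suc: "S (Suc n) = F (S n)" for n
    by (auto simp: S_def)
  have F_mono: "A \<subseteq> B \<Longrightarrow> F A \<subseteq> F B" for A B unfolding F_def by blast
  have dec1: "S (Suc n) \<subseteq> S n" for n
  proof (induction n)
    case 0
    show ?case unfolding S_Suc S_0
      by (auto simp: F_def cell_map_def carpet_digits_def)
  qed (simp add: S_Suc F_mono)
  then have dec: "decseq S" by (rule decseq_SucI)
  have corners: "carpet_corners \<subseteq> S n" for n
  proof (induction n)
    case (Suc n)
    have "(0, 0) = cell_map 1 (0, 0) (0, 0)" "(1, 0) = cell_map 1 (2, 0) (1, 0)"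
      "(0, 1) = cell_map 1 (0, 2) (0, 1)"
      by (auto simp: cell_map_def)
    then have "carpet_corners \<subseteq> F (carpet_corners)"
      unfolding F_def carpet_corners_def by (auto simp: carpet_digits_def)
    also have "\<dots> \<subseteq> F (S n)" by (rule F_mono[OF Suc])
    finally show ?case by (simp add: S_Suc)
  qed (simp add: S_0 carpet_corners_def)
  have compact: "compact (S n)" for n
    by (induction n)
       (auto simp: S_0 S_Suc F_def intro!: compact_Times compact_UN compact_continuous_image continuous_on_cell_map)
  define K where "K = (\<Inter>n. S n)"
  have "compact (S 0 \<inter> K)" unfolding K_def
    by (intro compact_Int_closed closed_INT ballI compact_imp_closed compact)
  moreover have "S 0 \<inter> K = K" by (auto simp: K_def)
  ultimately have "compact K" by simp
  moreover have "K \<noteq> {}" "carpet_corners \<subseteq> K" using corners by (auto simp: K_def carpet_corners_def)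
  moreover have "F K \<subseteq> K"
    unfolding K_def
  proof (rule INT_greatest)
    fix n
    have "F K \<subseteq> F (S n)" by (rule F_mono) (auto simp: K_def)
    then show "F (\<Inter>n. S n) \<subseteq> S n" using dec1[of n] by (auto simp: S_Suc K_def)
  qed
  moreover have "K \<subseteq> F K"
  proof
    fix x assume x: "x \<in> K"
    show "x \<in> F K"
    proof (rule ccontr)
      assume contra: "x \<notin> F K"
      have "\<exists>n. x \<notin> cell_map 1 p ` S n" if p: "p \<in> carpet_digits" for p
      proof (rule ccontr)
        assume "\<nexists>n. x \<notin> cell_map 1 p ` S n"
        then have "\<forall>n. \<exists>y. y \<in> S n \<and> x = cell_map 1 p y" by blast
        from choice[OF this] obtain y where y: "\<And>n. y n \<in> S n" "\<And>n. x = cell_map 1 p (y n)" by blast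
        have const: "y n = y 0" for n
          by (rule injD[OF inj_cell_map]) (rule trans[OF y(2)[symmetric] y(2)])
        have "y 0 \<in> S n" for n using y(1)[of n] unfolding const[of n] .
        then have "y 0 \<in> K" unfolding K_def by blast
        then show False using contra y(2)[of 0] p by (auto simp: F_def)
      qed
      then have "\<forall>p\<in>carpet_digits. \<exists>n. x \<notin> cell_map 1 p ` S n" by blast
      from bchoice[OF this] obtain N where N: "\<And>p. p \<in> carpet_digits \<Longrightarrow> x \<notin> cell_map 1 p ` S (N p)" by blast
      define M where "M = Max (N ` carpet_digits)"
      have "x \<in> S (Suc M)" using x by (auto simp: K_def)
      then obtain p where p: "p \<in> carpet_digits" "x \<in> cell_map 1 p ` S M" by (auto simp: S_Suc F_def)
      moreover have "S M \<subseteq> S (N p)"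
        using p(1) by (intro decseqD[OF dec]) (auto simp: M_def)
      ultimately show False using N by blast
    qed
  qed
  ultimately have "carpet_like K" unfolding carpet_like_def F_def by blast
  moreover have "K \<subseteq> {0..1} \<times> {0..1}" unfolding K_def using S_0 by blast
  ultimately show ?thesis using \<open>carpet_corners \<subseteq> K\<close> by blast
qed

lemma carpet_like_carpet: "carpet_like carpet"
  and carpet_unit_square: "carpet \<subseteq> {0..1} \<times> {0..1}"
  and carpet_corners_subset: "carpet_corners \<subseteq> carpet"
proof -
  obtain K where K: "carpet_like K" "K \<subseteq> {0..1} \<times> {0..1}" "carpet_corners \<subseteq> K"
    using carpet_like_exists by blast
  have "carpet = (THE K. carpet_like K)"
    unfolding carpet_def carpet_like_def carpet_map_cell_map ..
  also have "\<dots> = K"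
    using K(1) carpet_like_subset by (intro the_equality) blast+
  finally show "carpet_like carpet" "carpet \<subseteq> {0..1} \<times> {0..1}" "carpet_corners \<subseteq> carpet"
    using K by auto
qed

lemma compact_carpet: "compact carpet" and carpet_nonempty: "carpet \<noteq> {}"
  using carpet_like_carpet by (auto simp: carpet_like_def)

lemma corner_in_carpet [simp]: "(0, 0) \<in> carpet" "(1, 0) \<in> carpet" "(0, 1) \<in> carpet"
  using carpet_corners_subset by (auto simp: carpet_corners_def)

lemma carpet_coordD:
  "z \<in> carpet \<Longrightarrow> 0 \<le> fst z \<and> fst z \<le> 1 \<and> 0 \<le> snd z \<and> snd z \<le> 1"
  using carpet_unit_square by auto

lemma finite_carpet_pos [simp]: "finite (carpet_pos n)"
  by (induction n) auto

lemma carpet_digits_less: "(a, b) \<in> carpet_digits \<Longrightarrow> a < 3 \<and> b < 3"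
  by (auto simp: carpet_digits_def)

lemma inj_on_subdivision:
  "inj_on (\<lambda>((i, j), (a, b)). (3 * i + a, 3 * j + b)) (A \<times> carpet_digits)"
  by (rule inj_on_inverseI[where g = "\<lambda>(x, y). ((x div 3, y div 3), (x mod 3, y mod 3))"])
     (auto dest: carpet_digits_less)

lemma card_carpet_digits: "card carpet_digits = 8"
  by (simp add: carpet_digits_def)

lemma card_carpet_pos: "card (carpet_pos n) = 8 ^ n"
  by (induction n) (simp_all add: card_image inj_on_subdivision card_cartesian_product card_carpet_digits)

lemma carpet_pos_SucI:
  "(i, j) \<in> carpet_pos n \<Longrightarrow> (a, b) \<in> carpet_digits \<Longrightarrow> (3 * i + a, 3 * j + b) \<in> carpet_pos (Suc n)"
  by force

lemma carpet_pos_SucE: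
  assumes "p \<in> carpet_pos (Suc n)"
  obtains i j a b where "p = (3 * i + a, 3 * j + b)" "(i, j) \<in> carpet_pos n" "(a, b) \<in> carpet_digits"
  using assms by auto

lemma carpet_pos_addI:
  assumes "(i, j) \<in> carpet_pos k" "(a, b) \<in> carpet_pos m"
  shows "(3 ^ m * i + a, 3 ^ m * j + b) \<in> carpet_pos (k + m)"
  using assms(2)
proof (induction m arbitrary: a b)
  case 0
  then show ?case using assms(1) by simp
next
  case (Suc m)
  from Suc.prems obtain c d a' b' where *: "(a, b) = (3 * c + a', 3 * d + b')"
    "(c, d) \<in> carpet_pos m" "(a', b') \<in> carpet_digits"
    by (rule carpet_pos_SucE)
  have "(3 * (3 ^ m * i + c) + a', 3 * (3 ^ m * j + d) + b') \<in> carpet_pos (Suc (k + m))"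
    by (intro carpet_pos_SucI Suc.IH *)
  then show ?case using *(1) by (simp add: algebra_simps del: carpet_pos.simps)
qed

lemma carpet_pos_addE:
  assumes "p \<in> carpet_pos (k + m)"
  obtains i j a b where "p = (3 ^ m * i + a, 3 ^ m * j + b)" "(i, j) \<in> carpet_pos k" "(a, b) \<in> carpet_pos m"
proof -
  have "\<exists>i j a b. p = (3 ^ m * i + a, 3 ^ m * j + b) \<and> (i, j) \<in> carpet_pos k \<and> (a, b) \<in> carpet_pos m"
    using assms
  proof (induction m arbitrary: p)
    case 0
    then show ?case by (cases p) auto
  next
    case (Suc m)
    from Suc.prems have "p \<in> carpet_pos (Suc (k + m))" by simp
    then obtain i j a b where *: "p = (3 * i + a, 3 * j + b)" "(i, j) \<in> carpet_pos (k + m)"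
      "(a, b) \<in> carpet_digits" by (rule carpet_pos_SucE)
    obtain i' j' c d where **: "i = 3 ^ m * i' + c" "j = 3 ^ m * j' + d" "(i', j') \<in> carpet_pos k"
      "(c, d) \<in> carpet_pos m" using Suc.IH[OF *(2)] by blast
    have "p = (3 ^ Suc m * i' + (3 * c + a), 3 ^ Suc m * j' + (3 * d + b))"
      unfolding * ** by (simp add: algebra_simps)
    then show ?case using **(3) carpet_pos_SucI[OF **(4) *(3)] by blast
  qed
  then show ?thesis using that by blast
qed

lemma cell_subdivide: "cell n (i, j) = (\<Union>(a, b)\<in>carpet_digits. cell (Suc n) (3 * i + a, 3 * j + b))"
proof -
  have "cell n (i, j) = cell_map n (i, j) ` (\<Union>p\<in>carpet_digits. cell_map 1 p ` carpet)"
    unfolding cell_def using carpet_like_carpet by (simp add: carpet_like_def)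
  also have "\<dots> = (\<Union>(a, b)\<in>carpet_digits. cell (Suc n) (3 * i + a, 3 * j + b))"
    by (force simp: cell_def image_UN image_image cell_map_comp split: prod.splits)
  finally show ?thesis .
qed

lemma carpet_eq_cells: "carpet = (\<Union>p\<in>carpet_pos n. cell n p)"
proof (induction n)
  case 0
  show ?case by (simp add: cell_def)
next
  case (Suc n)
  have "(\<Union>p\<in>carpet_pos n. cell n p) = (\<Union>p\<in>carpet_pos (Suc n). cell (Suc n) p)"
  proof -
    have "(\<Union>p\<in>carpet_pos n. cell n p) = (\<Union>(i, j)\<in>carpet_pos n. cell n (i, j))" by auto
    also have "\<dots> = (\<Union>(i, j)\<in>carpet_pos n. \<Union>(a, b)\<in>carpet_digits. cell (Suc n) (3 * i + a, 3 * j + b))"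
      unfolding cell_subdivide[of n] ..
    also have "\<dots> = (\<Union>p\<in>carpet_pos (Suc n). cell (Suc n) p)" by auto
    finally show ?thesis .
  qed
  with Suc show ?case by simp
qed

lemma cell_subset_carpet: "p \<in> carpet_pos n \<Longrightarrow> cell n p \<subseteq> carpet"
  using carpet_eq_cells[of n] by blast

lemma cell_add_subset:
  assumes "(a, b) \<in> carpet_pos m"
  shows "cell (k + m) (3 ^ m * i + a, 3 ^ m * j + b) \<subseteq> cell k (i, j)"
  using cell_subset_carpet[OF assms] unfolding cell_def
  by (auto simp: cell_map_comp[symmetric])

lemma compact_cell: "compact (cell n p)"
  unfolding cell_def by (intro compact_continuous_image continuous_on_cell_map compact_carpet)

lemma cell_coords:
  assumes "z \<in> cell n (i, j)"
  shows "real i \<le> 3 ^ n * fst z" "3 ^ n * fst z \<le> real i + 1"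
    "real j \<le> 3 ^ n * snd z" "3 ^ n * snd z \<le> real j + 1"
  using assms carpet_coordD by (auto simp: cell_def cell_map_def)

lemma corner_in_cell: "(real i / 3 ^ n, real j / 3 ^ n) \<in> cell n (i, j)"
proof -
  have "cell_map n (i, j) (0, 0) \<in> cell n (i, j)" unfolding cell_def by (intro imageI) simp
  then show ?thesis by (simp add: cell_map_def)
qed

lemma dist_pair_le:
  fixes z w :: "real \<times> real"
  assumes "\<bar>fst z - fst w\<bar> \<le> c" "\<bar>snd z - snd w\<bar> \<le> c"
  shows "dist z w \<le> 3 / 2 * c"
proof -
  have c: "c \<ge> 0" using assms by linarith
  have "(dist z w)\<^sup>2 = (fst z - fst w)\<^sup>2 + (snd z - snd w)\<^sup>2"
    by (simp add: dist_prod_def dist_real_def)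
  also have "\<dots> \<le> c\<^sup>2 + c\<^sup>2"
    using assms c by (intro add_mono) (simp_all add: abs_le_square_iff[symmetric])
  also have "\<dots> \<le> (3 / 2 * c)\<^sup>2" by (simp add: power2_eq_square)
  finally show ?thesis by (rule power2_le_imp_le) (use c in simp)
qed

lemma abs_diff_scaled: "\<bar>3 ^ n * s - 3 ^ n * t\<bar> = 3 ^ n * \<bar>s - t\<bar>" for s t :: real
proof -
  have "3 ^ n * s - 3 ^ n * t = 3 ^ n * (s - t)" by (simp add: algebra_simps)
  then show ?thesis by (simp only: abs_mult) simp
qed

lemma dist_near_cells:
  assumes "z \<in> cell n (i, j)" "w \<in> cell n (i', j')"
    and "i \<le> i' + 1" "i' \<le> i + 1" "j \<le> j' + 1" "j' \<le> j + 1"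
  shows "dist z w \<le> 3 / 3 ^ n"
proof -
  have "\<bar>3 ^ n * fst z - 3 ^ n * fst w\<bar> \<le> 2" "\<bar>3 ^ n * snd z - 3 ^ n * snd w\<bar> \<le> 2"
    using cell_coords[OF assms(1)] cell_coords[OF assms(2)] assms(3-6) by linarith+
  then have "3 ^ n * \<bar>fst z - fst w\<bar> \<le> 2" "3 ^ n * \<bar>snd z - snd w\<bar> \<le> 2"
    unfolding abs_diff_scaled by simp_all
  then have "dist z w \<le> 3 / 2 * (2 / 3 ^ n)"
    by (intro dist_pair_le) (simp_all add: field_simps)
  then show ?thesis by simp
qed

lemma dist_cell_le:
  assumes "z \<in> cell n p" "w \<in> cell n p"
  shows "dist z w \<le> 2 / 3 ^ n"
proof -
  obtain i j where p: "p = (i, j)" by fastforce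
  have "\<bar>3 ^ n * fst z - 3 ^ n * fst w\<bar> \<le> 1" "\<bar>3 ^ n * snd z - 3 ^ n * snd w\<bar> \<le> 1"
    using cell_coords[of z n i j] cell_coords[of w n i j] assms unfolding p by linarith+
  then have "3 ^ n * \<bar>fst z - fst w\<bar> \<le> 1" "3 ^ n * \<bar>snd z - snd w\<bar> \<le> 1"
    unfolding abs_diff_scaled by simp_all
  then have "dist z w \<le> 3 / 2 * (1 / 3 ^ n)"
    by (intro dist_pair_le) (simp_all add: field_simps)
  also have "\<dots> \<le> 2 / 3 ^ n" by (simp add: field_simps)
  finally show ?thesis .
qed

definition near_cells :: "nat \<Rightarrow> real \<times> real \<Rightarrow> (nat \<times> nat) set" where
  "near_cells n x = {p \<in> carpet_pos n. \<exists>z\<in>cell n p. dist z x \<le> 1 / 3 ^ n}"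

lemma finite_near_cells [simp]: "finite (near_cells n x)"
  by (auto simp: near_cells_def)

lemma card_nat_window:
  fixes t :: real
  shows "\<exists>m. {i::nat. t - 2 \<le> real i \<and> real i \<le> t + 1} \<subseteq> {m..m + 3}"
proof
  show "{i::nat. t - 2 \<le> real i \<and> real i \<le> t + 1} \<subseteq> {nat \<lceil>t - 2\<rceil>..nat \<lceil>t - 2\<rceil> + 3}"
    by auto linarith+
qed

text \<open>Each coordinate of the position of such a cell lies in a window of length three, which contains at
  most four integers.
  Bounded overlap of cells and the upper bound for the measure of small sets follow from this count.\<close>

lemma card_near_cells: "card (near_cells n x) \<le> 16"
proof -
  have window: "3 ^ n * t - 2 \<le> real i \<and> real i \<le> 3 ^ n * t + 1"
    if "real i \<le> 3 ^ n * s" "3 ^ n * s \<le> real i + 1" "\<bar>s - t\<bar> \<le> 1 / 3 ^ n" for s t :: real and i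
  proof -
    have "3 ^ n * \<bar>s - t\<bar> \<le> 1" using that(3) by (simp add: field_simps)
    then have "\<bar>3 ^ n * s - 3 ^ n * t\<bar> \<le> 1" unfolding abs_diff_scaled by simp
    then show ?thesis using that by linarith
  qed
  obtain m where m: "{i::nat. 3 ^ n * fst x - 2 \<le> real i \<and> real i \<le> 3 ^ n * fst x + 1} \<subseteq> {m..m + 3}"
    using card_nat_window[of "3 ^ n * fst x"] by (rule exE)
  obtain m' where m': "{i::nat. 3 ^ n * snd x - 2 \<le> real i \<and> real i \<le> 3 ^ n * snd x + 1} \<subseteq> {m'..m' + 3}"
    using card_nat_window[of "3 ^ n * snd x"] by (rule exE)
  have "near_cells n x \<subseteq> {m..m + 3} \<times> {m'..m' + 3}"
  proof
    fix p assume "p \<in> near_cells n x"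
    then obtain i j z where p: "p = (i, j)" "z \<in> cell n (i, j)" "dist z x \<le> 1 / 3 ^ n"
      by (cases p) (auto simp: near_cells_def)
    have "\<bar>fst z - fst x\<bar> \<le> 1 / 3 ^ n" "\<bar>snd z - snd x\<bar> \<le> 1 / 3 ^ n"
      using p(3) dist_fst_le[of z x] dist_snd_le[of z x] by (auto simp: dist_real_def)
    then have "3 ^ n * fst x - 2 \<le> real i \<and> real i \<le> 3 ^ n * fst x + 1"
      "3 ^ n * snd x - 2 \<le> real j \<and> real j \<le> 3 ^ n * snd x + 1"
      using window[OF cell_coords(1,2)[OF p(2)]] window[OF cell_coords(3,4)[OF p(2)]] by blast+
    then have "i \<in> {m..m + 3}" "j \<in> {m'..m' + 3}" using m m' by blast+
    then show "p \<in> {m..m + 3} \<times> {m'..m' + 3}" by (simp add: p(1))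
  qed
  then have "card (near_cells n x) \<le> card ({m..m + 3} \<times> {m'..m' + 3})"
    by (intro card_mono) auto
  then show ?thesis by (simp add: card_cartesian_product)
qed

section \<open>Positivity and finiteness of the Hausdorff measure of the carpet\<close>

lemma carpet_dim_pos [simp]: "carpet_dim > 0"
  by (simp add: carpet_dim_def)

lemma carpet_dim_nonzero [simp]: "carpet_dim \<noteq> 0"
  by (rule less_imp_neq[OF carpet_dim_pos, symmetric])

lemma three_powr_carpet_dim: "3 powr carpet_dim = 8"
  by (simp add: carpet_dim_def powr_def)

lemma three_power_powr_carpet_dim: "(3 ^ n) powr carpet_dim = 8 ^ n"
proof -
  have "(3 ^ n) powr carpet_dim = (3 powr carpet_dim) powr real n"
    by (simp add: powr_powr powr_realpow[symmetric] mult.commute)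
  also have "\<dots> = 8 ^ n" unfolding three_powr_carpet_dim by (simp add: powr_realpow)
  finally show ?thesis .
qed

lemma scale_powr_carpet_dim: "c \<ge> 0 \<Longrightarrow> (c / 3 ^ n) powr carpet_dim = c powr carpet_dim / 8 ^ n"
  by (simp add: powr_divide three_power_powr_carpet_dim)

abbreviation carpet_H :: "(real \<times> real) set \<Rightarrow> ennreal" where
  "carpet_H \<equiv> hausdorff_outer_measure carpet_dim"

text \<open>Both inequalities are the Lipschitz bound, once for the cell map and once for its inverse.\<close>

lemma carpet_H_cell: "carpet_H (cell n p) = ennreal (1 / 8 ^ n) * carpet_H carpet"
proof (rule antisym)
  have "carpet_H (cell_map n p ` carpet) \<le> ennreal ((1 / 3 ^ n) powr carpet_dim) * carpet_H carpet"
    by (intro hausdorff_outer_measure_lipschitz_image) (auto simp: cell_map_dist)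
  then show "carpet_H (cell n p) \<le> ennreal (1 / 8 ^ n) * carpet_H carpet"
    by (simp add: scale_powr_carpet_dim cell_def)
next
  define g where "g = (\<lambda>z. (3 ^ n * fst z - real (fst p), 3 ^ n * snd z - real (snd p)) :: real \<times> real)"
  have g: "g (cell_map n p z) = z" for z
    by (simp add: g_def cell_map_def prod_eq_iff)
  have g': "cell_map n p (g z) = z" for z
    by (simp add: g_def cell_map_def prod_eq_iff)
  have "dist (g x) (g y) = 3 ^ n * dist x y" for x y
    using cell_map_dist[of n p "g x" "g y"] by (simp add: g' field_simps)
  then have "carpet_H (g ` cell n p) \<le> ennreal ((3 ^ n) powr carpet_dim) * carpet_H (cell n p)"
    by (intro hausdorff_outer_measure_lipschitz_image) auto
  moreover have "g ` cell n p = carpet"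
    by (simp add: cell_def image_image g)
  ultimately have "carpet_H carpet \<le> ennreal (8 ^ n) * carpet_H (cell n p)"
    by (simp add: three_power_powr_carpet_dim)
  then have "ennreal (1 / 8 ^ n) * carpet_H carpet
      \<le> ennreal (1 / 8 ^ n) * (ennreal (8 ^ n) * carpet_H (cell n p))"
    by (rule mult_left_mono) simp
  also have "\<dots> = carpet_H (cell n p)"
    by (simp add: mult.assoc[symmetric] ennreal_mult[symmetric])
  finally show "ennreal (1 / 8 ^ n) * carpet_H carpet \<le> carpet_H (cell n p)" .
qed

lemma carpet_H_le: "carpet_H carpet \<le> ennreal (2 powr carpet_dim)"
  unfolding hausdorff_outer_measure_def
proof (rule SUP_least)
  fix \<delta> :: real assume "\<delta> \<in> {0<..}"
  then have "\<delta> > 0" by simp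
  then obtain n where "(1 / 3) ^ n < \<delta> / 2"
    using real_arch_pow_inv[of "\<delta> / 2" "1 / 3"] by auto
  then have n: "2 / 3 ^ n \<le> \<delta>" by (simp add: power_one_over field_simps)
  obtain h where h: "bij_betw h {0..<8 ^ n :: nat} (carpet_pos n)"
    using ex_bij_betw_nat_finite[OF finite_carpet_pos[of n]] unfolding card_carpet_pos by blast
  define U where "U k = (if k < 8 ^ n then cell n (h k) else {})" for k :: nat
  have diam: "diameter (U k) \<le> 2 / 3 ^ n" for k
    by (rule diameter_leI) (use dist_cell_le in \<open>auto simp: U_def split: if_splits\<close>)
  have bdd: "bounded (U k)" for k by (simp add: U_def compact_cell compact_imp_bounded)
  have cover: "carpet \<subseteq> (\<Union>k. U k)"
  proof
    fix x assume "x \<in> carpet"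
    then obtain p where "p \<in> carpet_pos n" "x \<in> cell n p" using carpet_eq_cells[of n] by blast
    moreover obtain k where "k < 8 ^ n" "h k = p"
      using bij_betw_imp_surj_on[OF h] \<open>p \<in> carpet_pos n\<close> by (metis atLeastLessThan_iff imageE)
    ultimately show "x \<in> (\<Union>k. U k)" by (auto simp: U_def)
  qed
  have "hausdorff_premeasure carpet_dim \<delta> carpet \<le> (\<Sum>k. diam_power carpet_dim (U k))"
    by (rule hausdorff_premeasure_le[OF cover bdd order_trans[OF diam n]])
  also have "\<dots> = (\<Sum>k<8 ^ n :: nat. diam_power carpet_dim (U k))"
    by (rule suminf_finite) (auto simp: U_def)
  also have "\<dots> \<le> (\<Sum>k<8 ^ n :: nat. ennreal (2 powr carpet_dim / 8 ^ n))"
  proof (rule sum_mono)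
    fix k :: nat
    have "diameter (U k) powr carpet_dim \<le> (2 / 3 ^ n) powr carpet_dim"
      using diam diameter_ge_0[OF bdd] by (intro powr_mono2) (auto simp: less_imp_le)
    then show "diam_power carpet_dim (U k) \<le> ennreal (2 powr carpet_dim / 8 ^ n)"
      using carpet_dim_pos
      by (auto simp: diam_power_def scale_powr_carpet_dim intro!: ennreal_leI)
  qed
  also have "\<dots> = ennreal (8 ^ n * (2 powr carpet_dim / 8 ^ n))"
    by (subst sum_ennreal) auto
  finally show "hausdorff_premeasure carpet_dim \<delta> carpet \<le> ennreal (2 powr carpet_dim)" by simp
qed

text \<open>All these cells descend from the at most 16 cells of level \<open>k\<close> near one point of \<open>V\<close>.\<close>

lemma card_cells_meeting_small_set:
  assumes small: "\<And>x y. x \<in> V \<Longrightarrow> y \<in> V \<Longrightarrow> dist x y \<le> 1 / 3 ^ k" and "k \<le> N"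
  shows "card {p \<in> carpet_pos N. cell N p \<inter> V \<noteq> {}} \<le> 16 * 8 ^ (N - k)"
proof (cases "V = {}")
  case False
  then obtain x where x: "x \<in> V" by blast
  define m where "m = N - k"
  have N: "N = k + m" using assms by (simp add: m_def)
  have "{p \<in> carpet_pos N. cell N p \<inter> V \<noteq> {}}
      \<subseteq> (\<lambda>((i, j), (a, b)). (3 ^ m * i + a, 3 ^ m * j + b)) ` (near_cells k x \<times> carpet_pos m)"
  proof
    fix p assume p: "p \<in> {p \<in> carpet_pos N. cell N p \<inter> V \<noteq> {}}"
    then have "p \<in> carpet_pos (k + m)" by (simp add: N)
    then obtain i j a b where ij: "p = (3 ^ m * i + a, 3 ^ m * j + b)" "(i, j) \<in> carpet_pos k"
      "(a, b) \<in> carpet_pos m" by (rule carpet_pos_addE)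
    obtain z where "z \<in> cell N p" "z \<in> V" using p by blast
    then have "z \<in> cell k (i, j)" "dist z x \<le> 1 / 3 ^ k"
      using cell_add_subset[OF ij(3), of k i j] small x by (auto simp: N ij(1))
    then have "(i, j) \<in> near_cells k x" using ij by (auto simp: near_cells_def)
    then show "p \<in> (\<lambda>((i, j), (a, b)). (3 ^ m * i + a, 3 ^ m * j + b)) ` (near_cells k x \<times> carpet_pos m)"
      using ij by force
  qed
  then have "card {p \<in> carpet_pos N. cell N p \<inter> V \<noteq> {}} \<le> card (near_cells k x \<times> carpet_pos m)"
    by (rule surj_card_le[rotated]) auto
  also have "\<dots> \<le> 16 * 8 ^ m"
    by (simp add: card_cartesian_product card_carpet_pos card_near_cells)
  finally show ?thesis by (simp add: m_def)
qed simp

text \<open>The level \<open>k\<close> is the one whose cells have about the size \<open>r\<close>. The alternative \<open>k = 0\<close> takes care of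
  large \<open>r\<close>.\<close>

lemma triadic_scale:
  fixes r :: real
  assumes "r > 0"
  obtains k where "k = 0 \<or> r \<le> 1 / 3 ^ k" "1 / 8 ^ k \<le> 8 * r powr carpet_dim"
proof -
  obtain m where "(1 / 3) ^ m < r"
    using real_arch_pow_inv[of r "1 / 3"] assms by auto
  then have ex: "1 / 3 ^ Suc m < r"
    by (simp add: power_one_over field_simps)
  define k where "k = (LEAST k. 1 / 3 ^ Suc k < r)"
  have k: "1 / 3 ^ Suc k < r" unfolding k_def by (rule LeastI[of _ m]) (rule ex)
  have "(1 / 3 ^ Suc k) powr carpet_dim \<le> r powr carpet_dim"
    using k by (intro powr_mono2) (auto simp: less_imp_le)
  then have "1 / 8 ^ Suc k \<le> r powr carpet_dim"
    by (subst (asm) scale_powr_carpet_dim) auto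
  then have "1 / 8 ^ k \<le> 8 * r powr carpet_dim" by (simp add: field_simps)
  moreover have "k = 0 \<or> r \<le> 1 / 3 ^ k"
  proof (cases k)
    case (Suc l)
    then have "\<not> 1 / 3 ^ Suc l < r"
      using not_less_Least[of l "\<lambda>k. 1 / 3 ^ Suc k < r"] unfolding k_def by simp
    then show ?thesis by (simp add: Suc)
  qed simp
  ultimately show ?thesis using that by blast
qed

text \<open>The mass distribution principle with the number of cells in place of a mass. By compactness finitely
  many \<open>V i\<close> cover the carpet. At a level \<open>N\<close> finer than all of them, the set \<open>V i\<close> meets at most
  about \<open>r i powr carpet_dim\<close> times all \<open>8 ^ N\<close> cells, while together the sets meet every cell.\<close>

lemma cover_sum_lower_bound:
  fixes V :: "nat \<Rightarrow> (real \<times> real) set"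
  assumes op: "\<And>i. open (V i)" and cover: "carpet \<subseteq> (\<Union>i. V i)" and r: "\<And>i. r i > 0"
    and small: "\<And>i x y. x \<in> V i \<Longrightarrow> y \<in> V i \<Longrightarrow> dist x y \<le> r i"
  shows "ennreal (1 / 128) \<le> (\<Sum>i. ennreal (r i powr carpet_dim))"
proof -
  have "\<exists>k. (k = 0 \<or> r i \<le> 1 / 3 ^ k) \<and> 1 / 8 ^ k \<le> 8 * r i powr carpet_dim" for i
    using triadic_scale[OF r[of i]] by metis
  from choice[OF allI[OF this]] obtain k where
    "\<forall>i. (k i = 0 \<or> r i \<le> 1 / 3 ^ k i) \<and> 1 / 8 ^ k i \<le> 8 * r i powr carpet_dim" ..
  then have k: "\<And>i. k i = 0 \<or> r i \<le> 1 / 3 ^ k i" "\<And>i. 1 / 8 ^ k i \<le> 8 * r i powr carpet_dim"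
    by blast+
  obtain I where I: "finite I" "carpet \<subseteq> (\<Union>i\<in>I. V i)"
    using compactE_image[OF compact_carpet, of UNIV V] op cover by auto
  define N where "N = Max (insert 0 (k ` I))"
  have kN: "k i \<le> N" if "i \<in> I" for i using that I(1) by (simp add: N_def)
  have bound: "real (card {p \<in> carpet_pos N. cell N p \<inter> V i \<noteq> {}}) \<le> 16 * 8 ^ N / 8 ^ k i" if i: "i \<in> I" for i
  proof -
    have "card {p \<in> carpet_pos N. cell N p \<inter> V i \<noteq> {}} \<le> 16 * 8 ^ (N - k i)"
    proof (cases "k i = 0")
      case True
      have "card {p \<in> carpet_pos N. cell N p \<inter> V i \<noteq> {}} \<le> card (carpet_pos N)"
        by (intro card_mono) auto
      then show ?thesis by (simp add: True card_carpet_pos)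
    next
      case False
      then have "r i \<le> 1 / 3 ^ k i" using k(1)[of i] by simp
      then show ?thesis
        by (intro card_cells_meeting_small_set[OF order_trans[OF small] kN[OF i]])
    qed
    then have "real (card {p \<in> carpet_pos N. cell N p \<inter> V i \<noteq> {}}) \<le> real (16 * 8 ^ (N - k i))"
      by (simp only: of_nat_le_iff)
    also have "\<dots> = 16 * (8 ^ N / 8 ^ k i)"
      using power_diff[of "8::real", OF _ kN[OF i]] by simp
    also have "\<dots> = 16 * 8 ^ N / 8 ^ k i" by simp
    finally show ?thesis .
  qed
  have "carpet_pos N \<subseteq> (\<Union>i\<in>I. {p \<in> carpet_pos N. cell N p \<inter> V i \<noteq> {}})"
  proof
    fix p assume p: "p \<in> carpet_pos N"
    obtain z where "z \<in> cell N p" using carpet_nonempty unfolding cell_def by blast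
    moreover then obtain i where "i \<in> I" "z \<in> V i" using cell_subset_carpet[OF p] I(2) by blast
    ultimately show "p \<in> (\<Union>i\<in>I. {p \<in> carpet_pos N. cell N p \<inter> V i \<noteq> {}})" using p by blast
  qed
  then have "card (carpet_pos N) \<le> (\<Sum>i\<in>I. card {p \<in> carpet_pos N. cell N p \<inter> V i \<noteq> {}})"
    using I(1) by (intro order_trans[OF card_mono card_UN_le]) auto
  then have "8 ^ N \<le> (\<Sum>i\<in>I. real (card {p \<in> carpet_pos N. cell N p \<inter> V i \<noteq> {}}))"
    unfolding card_carpet_pos by (metis (mono_tags) of_nat_le_iff of_nat_numeral of_nat_power of_nat_sum)
  also have "\<dots> \<le> (\<Sum>i\<in>I. 16 * 8 ^ N / 8 ^ k i)" by (intro sum_mono bound)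
  also have "\<dots> = 16 * 8 ^ N * (\<Sum>i\<in>I. 1 / 8 ^ k i)" by (simp add: sum_distrib_left)
  finally have "1 / 16 \<le> (\<Sum>i\<in>I. 1 / 8 ^ k i :: real)" by (simp add: field_simps)
  also have "\<dots> \<le> (\<Sum>i\<in>I. 8 * r i powr carpet_dim)" by (intro sum_mono k(2))
  also have "\<dots> = 8 * (\<Sum>i\<in>I. r i powr carpet_dim)" by (simp add: sum_distrib_left)
  finally have "ennreal (1 / 128) \<le> ennreal (\<Sum>i\<in>I. r i powr carpet_dim)"
    by (intro ennreal_leI) simp
  also have "\<dots> = (\<Sum>i\<in>I. ennreal (r i powr carpet_dim))" by simp
  also have "\<dots> \<le> (\<Sum>i. ennreal (r i powr carpet_dim))" by (rule sum_le_suminf[OF _ I(1)]) auto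
  finally show ?thesis .
qed

lemma carpet_H_ge: "ennreal (1 / 256) \<le> carpet_H carpet"
proof -
  have "ennreal (1 / 256) \<le> hausdorff_premeasure carpet_dim 1 carpet"
  proof (rule hausdorff_premeasure_greatest)
    fix U :: "nat \<Rightarrow> (real \<times> real) set"
    assume U: "carpet \<subseteq> (\<Union>i. U i)" "\<And>i. bounded (U i)" "\<And>i. diameter (U i) \<le> 1"
    define d where "d i = diameter (U i)" for i
    have d0: "d i \<ge> 0" for i unfolding d_def by (rule diameter_ge_0[OF U(2)])
    \<comment> \<open>A cover by arbitrary sets is enlarged to an open one at the cost of \<open>1/256\<close>.\<close>
    have "\<exists>\<eta>>0. (d i + 2 * \<eta>) powr carpet_dim < d i powr carpet_dim + (1 / 256) * (1 / 2) ^ Suc i" for i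
    proof -
      have "((\<lambda>\<eta>. (d i + 2 * \<eta>) powr carpet_dim) \<longlongrightarrow> (d i + 2 * 0) powr carpet_dim) (at_right 0)"
        using d0[of i] by (intro tendsto_intros tendsto_powr') (auto simp: eventually_at_filter less_imp_le)
      then have "eventually (\<lambda>\<eta>. (d i + 2 * \<eta>) powr carpet_dim < d i powr carpet_dim + (1 / 256) * (1 / 2) ^ Suc i) (at_right 0)"
        by (rule order_tendstoD) simp
      moreover have "eventually (\<lambda>\<eta>. \<eta> > 0) (at_right (0::real))" by (simp add: eventually_at_filter)
      ultimately have "eventually (\<lambda>\<eta>. \<eta> > 0 \<and> (d i + 2 * \<eta>) powr carpet_dim < d i powr carpet_dim + (1 / 256) * (1 / 2) ^ Suc i) (at_right (0::real))"
        by eventually_elim simp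
      then show ?thesis using eventually_happens'[OF trivial_limit_at_right_real] by blast
    qed
    from choice[OF allI[OF this]] obtain \<eta> where
      "\<forall>i. \<eta> i > 0 \<and> (d i + 2 * \<eta> i) powr carpet_dim < d i powr carpet_dim + (1 / 256) * (1 / 2) ^ Suc i" ..
    then have \<eta>: "\<And>i. \<eta> i > 0"
      "\<And>i. (d i + 2 * \<eta> i) powr carpet_dim < d i powr carpet_dim + (1 / 256) * (1 / 2) ^ Suc i" by blast+
    define V where "V i = (\<Union>x\<in>U i. ball x (\<eta> i))" for i
    have 1: "ennreal (1 / 128) \<le> (\<Sum>i. ennreal ((d i + 2 * \<eta> i) powr carpet_dim))"
    proof (rule cover_sum_lower_bound[where V = V])
      show "open (V i)" for i by (auto simp: V_def)
      show "carpet \<subseteq> (\<Union>i. V i)"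
      proof
        fix x assume "x \<in> carpet"
        then obtain i where "x \<in> U i" using U(1) by blast
        then have "x \<in> V i" unfolding V_def using \<eta>(1)[of i] by (intro UN_I[of x]) auto
        then show "x \<in> (\<Union>i. V i)" by blast
      qed
      show "d i + 2 * \<eta> i > 0" for i using d0[of i] \<eta>(1)[of i] by simp
      fix i x y assume "x \<in> V i" "y \<in> V i"
      then obtain x' y' where "x' \<in> U i" "y' \<in> U i" "dist x' x < \<eta> i" "dist y' y < \<eta> i"
        by (auto simp: V_def)
      moreover then have "dist x' y' \<le> d i" unfolding d_def by (intro diameter_bounded_bound U)
      ultimately show "dist x y \<le> d i + 2 * \<eta> i"
        using dist_triangle[of x y x'] dist_triangle[of x' y y'] by (simp add: dist_commute)
    qed
    have dp: "ennreal (d i powr carpet_dim) \<le> diam_power carpet_dim (U i)" for i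
      using carpet_dim_pos by (auto simp: diam_power_def d_def)
    have "ennreal (1 / 128) \<le> (\<Sum>i. diam_power carpet_dim (U i) + ennreal ((1 / 256) * (1 / 2) ^ Suc i))"
    proof (rule order_trans[OF 1], rule suminf_le)
      fix i
      have "ennreal ((d i + 2 * \<eta> i) powr carpet_dim) \<le> ennreal (d i powr carpet_dim + (1 / 256) * (1 / 2) ^ Suc i)"
        using \<eta>(2)[of i] by (intro ennreal_leI) simp
      also have "\<dots> = ennreal (d i powr carpet_dim) + ennreal ((1 / 256) * (1 / 2) ^ Suc i)"
        by (intro ennreal_plus) auto
      also have "\<dots> \<le> diam_power carpet_dim (U i) + ennreal ((1 / 256) * (1 / 2) ^ Suc i)"
        by (intro add_right_mono dp)
      finally show "ennreal ((d i + 2 * \<eta> i) powr carpet_dim)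
        \<le> diam_power carpet_dim (U i) + ennreal ((1 / 256) * (1 / 2) ^ Suc i)" .
    qed auto
    also have "\<dots> = (\<Sum>i. diam_power carpet_dim (U i)) + (\<Sum>i. ennreal ((1 / 256) * (1 / 2) ^ Suc i))"
      by (intro suminf_add[symmetric]) auto
    also have "(\<Sum>i. ennreal ((1 / 256) * (1 / 2) ^ Suc i)) = ennreal (1 / 256)"
      by (rule ennreal_sum_half_powers) simp
    also have "(\<Sum>i. diam_power carpet_dim (U i)) + ennreal (1 / 256)
        = ennreal (1 / 256) + (\<Sum>i. diam_power carpet_dim (U i))"
      by (rule add.commute)
    finally have "ennreal (1 / 256) + ennreal (1 / 256) \<le> ennreal (1 / 256) + (\<Sum>i. diam_power carpet_dim (U i))"
      by (subst ennreal_plus[symmetric]) auto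
    then show "ennreal (1 / 256) \<le> (\<Sum>i. diam_power carpet_dim (U i))"
      unfolding ennreal_add_left_cancel_le by simp
  qed
  then show ?thesis
    by (rule order_trans) (rule hausdorff_premeasure_le_outer, simp)
qed

lemma carpet_H_finite: "carpet_H carpet < top" and carpet_H_pos: "carpet_H carpet > 0"
proof -
  show "carpet_H carpet < top" using carpet_H_le by (rule le_less_trans) simp
  show "carpet_H carpet > 0" using carpet_H_ge by (rule less_le_trans[rotated]) simp
qed

section \<open>The normalized measure\<close>

lemma carpet_closed: "closed carpet" by (simp add: compact_carpet compact_imp_closed)

lemma space_carpet_measure [simp]: "space carpet_measure = carpet"
  by (simp add: carpet_measure_def space_restrict_space)

lemma sets_carpet_measure: "sets carpet_measure = sets (restrict_space borel carpet)"
  by (simp add: carpet_measure_def sets_restrict_space)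

lemma emeasure_carpet_measure:
  assumes "A \<in> sets borel" "A \<subseteq> carpet"
  shows "emeasure carpet_measure A = carpet_H A / carpet_H carpet"
proof -
  have b: "carpet \<in> sets borel" using carpet_closed by simp
  have "emeasure carpet_measure A = emeasure (uniform_measure (hausdorff_measure carpet_dim) carpet) A"
    unfolding carpet_measure_def using assms b by (intro emeasure_restrict_space) auto
  also have "\<dots> = emeasure (hausdorff_measure carpet_dim) (carpet \<inter> A) / emeasure (hausdorff_measure carpet_dim) carpet"
    using assms b by (intro emeasure_uniform_measure) auto
  also have "carpet \<inter> A = A" using assms by blast
  finally show ?thesis using assms b by (simp add: emeasure_hausdorff_measure)
qed

lemma cell_borel [measurable, simp]: "cell n p \<in> sets borel"
  by (simp add: compact_cell compact_imp_closed)

lemma cell_sets: "p \<in> carpet_pos n \<Longrightarrow> cell n p \<in> sets carpet_measure"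
  using cell_subset_carpet[of p n] by (auto simp: sets_carpet_measure sets_restrict_space)

lemma emeasure_cell:
  assumes "p \<in> carpet_pos n"
  shows "emeasure carpet_measure (cell n p) = ennreal (1 / 8 ^ n)"
proof -
  have "emeasure carpet_measure (cell n p) = ennreal (1 / 8 ^ n) * carpet_H carpet / carpet_H carpet"
    using emeasure_carpet_measure[OF cell_borel cell_subset_carpet[OF assms]]
    unfolding carpet_H_cell .
  also have "\<dots> = ennreal (1 / 8 ^ n) * (carpet_H carpet / carpet_H carpet)"
    by (rule ennreal_times_divide[symmetric])
  also have "carpet_H carpet / carpet_H carpet = 1"
    using carpet_H_finite carpet_H_pos by (intro ennreal_divide_self) auto
  finally show ?thesis by simp
qed

lemma emeasure_carpet: "emeasure carpet_measure carpet = 1"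
  using emeasure_cell[of "(0, 0)" 0] by (simp add: cell_def)

lemma emeasure_small_set_le:
  assumes V: "V \<in> sets carpet_measure" and small: "\<And>y. y \<in> V \<Longrightarrow> dist y x \<le> 1 / 3 ^ n"
  shows "emeasure carpet_measure V \<le> ennreal (16 / 8 ^ n)"
proof -
  have V': "V \<subseteq> carpet" using sets.sets_into_space[OF V] by simp
  have "V \<subseteq> (\<Union>p\<in>near_cells n x. cell n p)"
  proof
    fix y assume y: "y \<in> V"
    then obtain p where "p \<in> carpet_pos n" "y \<in> cell n p" using V' carpet_eq_cells[of n] by blast
    then show "y \<in> (\<Union>p\<in>near_cells n x. cell n p)"
      using small[OF y] by (intro UN_I[of p]) (auto simp: near_cells_def)
  qed
  then have "emeasure carpet_measure V \<le> emeasure carpet_measure (\<Union>p\<in>near_cells n x. cell n p)"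
    by (rule emeasure_mono) (auto simp: near_cells_def intro!: sets.finite_UN cell_sets)
  also have "\<dots> \<le> (\<Sum>p\<in>near_cells n x. emeasure carpet_measure (cell n p))"
    by (rule emeasure_subadditive_finite) (auto simp: near_cells_def cell_sets)
  also have "\<dots> = (\<Sum>p\<in>near_cells n x. ennreal (1 / 8 ^ n))"
    by (intro sum.cong refl emeasure_cell) (auto simp: near_cells_def)
  also have "\<dots> = ennreal (real (card (near_cells n x)) * (1 / 8 ^ n))"
    by (simp add: ennreal_of_nat_eq_real_of_nat ennreal_mult[symmetric])
  also have "\<dots> \<le> ennreal (16 * (1 / 8 ^ n))"
    using card_near_cells[of n x] by (intro ennreal_leI mult_right_mono) auto
  finally show ?thesis by simp
qed

lemma emeasure_ball_ge:
  assumes x: "x \<in> carpet"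
  shows "ennreal (1 / 8 ^ n) \<le> emeasure carpet_measure (cball x (2 / 3 ^ n) \<inter> carpet)"
proof -
  obtain p where p: "p \<in> carpet_pos n" "x \<in> cell n p" using x carpet_eq_cells[of n] by blast
  have "cell n p \<subseteq> cball x (2 / 3 ^ n) \<inter> carpet"
    using dist_cell_le[OF p(2)] cell_subset_carpet[OF p(1)] by auto
  then have "emeasure carpet_measure (cell n p) \<le> emeasure carpet_measure (cball x (2 / 3 ^ n) \<inter> carpet)"
    by (rule emeasure_mono) (auto simp: sets_carpet_measure sets_restrict_space)
  then show ?thesis by (simp add: emeasure_cell[OF p(1)])
qed

section \<open>Square integrable functions and averages\<close>

lemma L2_funsI: "u \<in> borel_measurable M \<Longrightarrow> integrable M (\<lambda>x. (u x)\<^sup>2) \<Longrightarrow> u \<in> L2_funs M"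
  and L2_funs_measurable: "u \<in> L2_funs M \<Longrightarrow> u \<in> borel_measurable M"
  and L2_funs_integrable: "u \<in> L2_funs M \<Longrightarrow> integrable M (\<lambda>x. (u x)\<^sup>2)"
  by (auto simp: L2_funs_def)

lemma L2_funs_mult_integrable:
  assumes "u \<in> L2_funs M" "v \<in> L2_funs M"
  shows "integrable M (\<lambda>x. u x * v x)"
proof (rule Bochner_Integration.integrable_bound)
  show "integrable M (\<lambda>x. (u x)\<^sup>2 + (v x)\<^sup>2)"
    using assms by (intro Bochner_Integration.integrable_add L2_funs_integrable)
  have "\<bar>a * b\<bar> \<le> \<bar>a\<^sup>2 + b\<^sup>2\<bar>" for a b :: real
  proof -
    have "2 * (\<bar>a\<bar> * \<bar>b\<bar>) \<le> a\<^sup>2 + b\<^sup>2"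
      using sum_squares_bound[of "\<bar>a\<bar>" "\<bar>b\<bar>"] by (simp add: mult.assoc)
    moreover have "0 \<le> \<bar>a\<bar> * \<bar>b\<bar>" by simp
    ultimately show ?thesis unfolding abs_mult by linarith
  qed
  then show "AE x in M. norm (u x * v x) \<le> norm ((u x)\<^sup>2 + (v x)\<^sup>2)" by simp
  show "(\<lambda>x. u x * v x) \<in> borel_measurable M"
    using assms[THEN L2_funs_measurable] by measurable
qed

lemma L2_funs_add:
  assumes "u \<in> L2_funs M" "v \<in> L2_funs M"
  shows "(\<lambda>x. u x + v x) \<in> L2_funs M"
proof (rule L2_funsI)
  show "(\<lambda>x. u x + v x) \<in> borel_measurable M"
    using assms[THEN L2_funs_measurable] by measurable
  have "integrable M (\<lambda>x. (u x)\<^sup>2 + (v x)\<^sup>2 + 2 * (u x * v x))"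
    using assms by (intro Bochner_Integration.integrable_add L2_funs_integrable integrable_mult_right
        L2_funs_mult_integrable)
  then show "integrable M (\<lambda>x. (u x + v x)\<^sup>2)"
    by (simp add: power2_sum mult.assoc)
qed

lemma L2_funs_scale: "u \<in> L2_funs M \<Longrightarrow> (\<lambda>x. c * u x) \<in> L2_funs M"
  unfolding L2_funs_def by (auto simp: power_mult_distrib)

lemma L2_funs_diff: "u \<in> L2_funs M \<Longrightarrow> v \<in> L2_funs M \<Longrightarrow> (\<lambda>x. u x - v x) \<in> L2_funs M"
  using L2_funs_add[of u M "\<lambda>x. (-1) * v x"] L2_funs_scale[of v M "-1"] by simp

lemma (in finite_measure) L2_funs_bounded:
  assumes "u \<in> borel_measurable M" "\<And>x. x \<in> space M \<Longrightarrow> \<bar>u x\<bar> \<le> B"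
  shows "u \<in> L2_funs M"
proof (rule L2_funsI[OF assms(1)])
  show "integrable M (\<lambda>x. (u x)\<^sup>2)"
  proof (rule integrable_const_bound)
    show "AE x in M. norm ((u x)\<^sup>2) \<le> B\<^sup>2"
    proof (rule AE_I2)
      fix x assume "x \<in> space M"
      then have "\<bar>u x\<bar>\<^sup>2 \<le> B\<^sup>2" using assms(2) by (intro power_mono) auto
      then show "norm ((u x)\<^sup>2) \<le> B\<^sup>2" by simp
    qed
    show "(\<lambda>x. (u x)\<^sup>2) \<in> borel_measurable M" using assms(1) by measurable
  qed
qed

lemma (in finite_measure) L2_funs_integrable1:
  assumes "u \<in> L2_funs M"
  shows "integrable M u"
  using L2_funs_mult_integrable[OF assms L2_funs_bounded[of "\<lambda>_. 1" 1]] by simp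

definition average :: "'a measure \<Rightarrow> 'a set \<Rightarrow> ('a \<Rightarrow> real) \<Rightarrow> real" where
  "average M A u = (\<integral>x. indicator A x * u x \<partial>M) / measure M A"

text \<open>Among all constants the average is the best approximation of \<open>u\<close> in the mean square over \<open>A\<close>.\<close>

lemma (in finite_measure) average_deviation:
  assumes u: "u \<in> L2_funs M" and A: "A \<in> sets M" and pos: "measure M A > 0"
  shows "ennreal ((average M A u - c)\<^sup>2) * emeasure M A \<le> (\<integral>\<^sup>+x\<in>A. ennreal ((u x - c)\<^sup>2) \<partial>M)"
proof -
  let ?m = "measure M A" and ?a = "average M A u"
  note [measurable] = A L2_funs_measurable[OF u]
  have [simp]: "integrable M (\<lambda>x. indicator A x * (u x)\<^sup>2)" "integrable M (\<lambda>x. indicator A x * u x)"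
    "integrable M (indicator A :: _ \<Rightarrow> real)"
    using integrable_real_mult_indicator[OF A L2_funs_integrable[OF u]]
      integrable_real_mult_indicator[OF A L2_funs_integrable1[OF u]] A
    by (simp_all add: mult.commute emeasure_eq_measure)
  have expand: "(\<integral>x. indicator A x * (u x - t)\<^sup>2 \<partial>M)
      = (\<integral>x. indicator A x * (u x)\<^sup>2 \<partial>M) - 2 * t * (?a * ?m) + t\<^sup>2 * ?m" for t
  proof -
    have "(\<integral>x. indicator A x * (u x - t)\<^sup>2 \<partial>M)
        = (\<integral>x. indicator A x * (u x)\<^sup>2 - 2 * t * (indicator A x * u x) + t\<^sup>2 * indicator A x \<partial>M)"
      by (intro Bochner_Integration.integral_cong refl) (simp add: power2_diff algebra_simps)
    also have "\<dots> = (\<integral>x. indicator A x * (u x)\<^sup>2 \<partial>M) - 2 * t * (\<integral>x. indicator A x * u x \<partial>M) + t\<^sup>2 * ?m"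
      using A by (simp add: Bochner_Integration.integral_add Bochner_Integration.integral_diff)
    also have "(\<integral>x. indicator A x * u x \<partial>M) = ?a * ?m"
      using pos by (simp add: average_def)
    finally show ?thesis .
  qed
  have "0 \<le> (\<integral>x. indicator A x * (u x - ?a)\<^sup>2 \<partial>M)"
    by (rule integral_nonneg_AE) auto
  also have "\<dots> = (\<integral>x. indicator A x * (u x - c)\<^sup>2 \<partial>M) - (?a - c)\<^sup>2 * ?m"
    unfolding expand by (simp add: power2_eq_square algebra_simps)
  finally have "(?a - c)\<^sup>2 * ?m \<le> (\<integral>x. indicator A x * (u x - c)\<^sup>2 \<partial>M)" by simp
  then have "ennreal ((?a - c)\<^sup>2 * ?m) \<le> ennreal (\<integral>x. indicator A x * (u x - c)\<^sup>2 \<partial>M)"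
    by (rule ennreal_leI)
  also have "\<dots> = (\<integral>\<^sup>+x. ennreal (indicator A x * (u x - c)\<^sup>2) \<partial>M)"
  proof (rule nn_integral_eq_integral[symmetric])
    have "(\<lambda>x. u x - c) \<in> L2_funs M"
      by (rule L2_funs_diff[OF u L2_funs_bounded[of "\<lambda>_. c" "\<bar>c\<bar>"]]) auto
    then show "integrable M (\<lambda>x. indicator A x * (u x - c)\<^sup>2)"
      using integrable_real_mult_indicator[OF A L2_funs_integrable] by (simp add: mult.commute)
  qed auto
  also have "\<dots> = (\<integral>\<^sup>+x\<in>A. ennreal ((u x - c)\<^sup>2) \<partial>M)"
    by (intro nn_integral_cong) (auto split: split_indicator)
  finally show ?thesis
    by (simp add: emeasure_eq_measure ennreal_mult)
qed

text \<open>The deviation inequality is applied twice: first over \<open>A\<close> with the constant average over \<open>B\<close>, then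
  over \<open>B\<close> with the constant \<open>u x\<close>.\<close>

lemma (in finite_measure) average_difference:
  assumes u: "u \<in> L2_funs M" and A: "A \<in> sets M" "measure M A > 0" and B: "B \<in> sets M" "measure M B > 0"
  shows "ennreal ((average M A u - average M B u)\<^sup>2) * emeasure M A * emeasure M B
     \<le> (\<integral>\<^sup>+x\<in>A. (\<integral>\<^sup>+y\<in>B. ennreal ((u x - u y)\<^sup>2) \<partial>M) \<partial>M)"
proof -
  note [measurable] = A(1) B(1) L2_funs_measurable[OF u]
  have "ennreal ((average M A u - average M B u)\<^sup>2) * emeasure M A
      \<le> (\<integral>\<^sup>+x\<in>A. ennreal ((u x - average M B u)\<^sup>2) \<partial>M)"
    by (rule average_deviation[OF u A])
  then have "ennreal ((average M A u - average M B u)\<^sup>2) * emeasure M A * emeasure M B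
      \<le> (\<integral>\<^sup>+x\<in>A. ennreal ((u x - average M B u)\<^sup>2) \<partial>M) * emeasure M B"
    by (rule mult_right_mono) simp
  also have "\<dots> = (\<integral>\<^sup>+x\<in>A. (ennreal ((average M B u - u x)\<^sup>2) * emeasure M B) \<partial>M)"
    by (subst nn_integral_multc[symmetric]) (auto intro!: nn_integral_cong simp: power2_commute ac_simps)
  also have "\<dots> \<le> (\<integral>\<^sup>+x\<in>A. (\<integral>\<^sup>+y\<in>B. ennreal ((u x - u y)\<^sup>2) \<partial>M) \<partial>M)"
    using average_deviation[OF u B]
    by (intro nn_integral_mono mult_right_mono) (simp_all add: power2_commute)
  finally show ?thesis .
qed

section \<open>Jump forms\<close>

text \<open>The forms of the theorem for a finite measure on the Borel sets of a subset of a Euclidean space. The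
  exponent \<open>s\<close> is \<open>carpet_dim + \<beta>\<close> in the application.\<close>

locale jump_form = finite_measure M for M :: "'a::euclidean_space measure" +
  fixes s :: real
  assumes sets_eq: "sets M = sets (restrict_space borel (space M))"
begin

lemma ident_measurable [measurable]: "(\<lambda>x. x) \<in> measurable M borel"
  using measurable_restrict_space1[OF measurable_ident, of borel "space M"]
  by (simp add: measurable_cong_sets[OF sets_eq refl] id_def)

text \<open>The map \<open>u \<mapsto> increment u\<close> is linear and turns the form into the inner product of square integrable
  functions on the product space. All algebraic properties of the form are inherited from there. On
  the diagonal the quotient has the value zero.\<close>

definition increment :: "('a \<Rightarrow> real) \<Rightarrow> 'a \<times> 'a \<Rightarrow> real" where
  "increment u p = (u (fst p) - u (snd p)) / sqrt (norm (fst p - snd p) powr s)"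

definition energy :: "('a \<Rightarrow> real) \<Rightarrow> ennreal" where
  "energy u = (\<integral>\<^sup>+x. \<integral>\<^sup>+y. ennreal ((u x - u y)\<^sup>2 / norm (x - y) powr s) \<partial>M \<partial>M)"

definition form :: "('a \<Rightarrow> real) \<Rightarrow> ('a \<Rightarrow> real) \<Rightarrow> real" where
  "form u v = (\<integral>x. \<integral>y. (u x - u y) * (v x - v y) / norm (x - y) powr s \<partial>M \<partial>M)"

definition form_domain :: "('a \<Rightarrow> real) set" where
  "form_domain = {u \<in> L2_funs M. energy u < \<infinity>}"

sublocale pair: pair_sigma_finite M M ..

lemma increment_measurable [measurable]:
  assumes [measurable]: "u \<in> borel_measurable M"
  shows "increment u \<in> borel_measurable (M \<Otimes>\<^sub>M M)"
  unfolding increment_def by measurable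

lemma increment_mult:
  "increment u (x, y) * increment v (x, y) = (u x - u y) * (v x - v y) / norm (x - y) powr s"
  by (simp add: increment_def)

lemma increment_square: "(increment u (x, y))\<^sup>2 = (u x - u y)\<^sup>2 / norm (x - y) powr s"
  using increment_mult[of u x y u] by (simp add: power2_eq_square)

lemma energy_eq:
  assumes [measurable]: "u \<in> borel_measurable M"
  shows "energy u = (\<integral>\<^sup>+p. ennreal ((increment u p)\<^sup>2) \<partial>(M \<Otimes>\<^sub>M M))"
  unfolding energy_def by (subst nn_integral_fst[symmetric]) (simp_all add: increment_square)

lemma form_domain_eq:
  "form_domain = {u \<in> L2_funs M. increment u \<in> L2_funs (M \<Otimes>\<^sub>M M)}"
proof -
  have "energy u < \<infinity> \<longleftrightarrow> increment u \<in> L2_funs (M \<Otimes>\<^sub>M M)" if "u \<in> L2_funs M" for u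
  proof -
    note [measurable] = L2_funs_measurable[OF that]
    show ?thesis
      by (auto simp: energy_eq L2_funs_def integrable_iff_bounded)
  qed
  then show ?thesis by (auto simp: form_domain_def)
qed

lemma form_domainD:
  assumes "u \<in> form_domain"
  shows "u \<in> L2_funs M" "u \<in> borel_measurable M" "increment u \<in> L2_funs (M \<Otimes>\<^sub>M M)"
  using assms by (auto simp: form_domain_eq L2_funs_measurable)

lemma form_eq:
  assumes "u \<in> form_domain" "v \<in> form_domain"
  shows "form u v = (\<integral>p. increment u p * increment v p \<partial>(M \<Otimes>\<^sub>M M))"
proof -
  have "integrable (M \<Otimes>\<^sub>M M) (\<lambda>p. increment u p * increment v p)"
    using assms by (intro L2_funs_mult_integrable form_domainD)
  then have "(\<integral>x. \<integral>y. increment u (x, y) * increment v (x, y) \<partial>M \<partial>M)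
      = (\<integral>p. increment u p * increment v p \<partial>(M \<Otimes>\<^sub>M M))"
    by (rule pair.integral_fst')
  then show ?thesis by (simp add: form_def increment_mult)
qed

lemma energy_form: "u \<in> form_domain \<Longrightarrow> energy u = ennreal (form u u)"
  using nn_integral_eq_integral[of "M \<Otimes>\<^sub>M M" "\<lambda>p. (increment u p)\<^sup>2"]
  by (simp add: energy_eq form_domainD form_eq L2_funs_integrable flip: power2_eq_square)

lemma form_nonneg: "u \<in> form_domain \<Longrightarrow> form u u \<ge> 0"
  by (simp add: form_eq)

lemma increment_add: "increment (\<lambda>x. u x + v x) = (\<lambda>p. increment u p + increment v p)"
  by (auto simp: increment_def fun_eq_iff add_divide_distrib diff_divide_distrib)

lemma increment_scale: "increment (\<lambda>x. c * u x) = (\<lambda>p. c * increment u p)"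
  by (auto simp: increment_def fun_eq_iff algebra_simps diff_divide_distrib)

lemma increment_diff: "increment (\<lambda>x. u x - v x) = (\<lambda>p. increment u p - increment v p)"
  by (auto simp: increment_def fun_eq_iff diff_divide_distrib)

lemma increment_AE:
  assumes [measurable]: "u \<in> borel_measurable M" "v \<in> borel_measurable M" and eq: "AE x in M. u x = v x"
  shows "AE p in M \<Otimes>\<^sub>M M. increment u p = increment v p"
proof (rule pair.AE_pair_measure)
  show "{p \<in> space (M \<Otimes>\<^sub>M M). increment u p = increment v p} \<in> sets (M \<Otimes>\<^sub>M M)" by measurable
  show "AE x in M. AE y in M. increment u (x, y) = increment v (x, y)"
    using eq
  proof eventually_elim
    case (elim x)
    from eq show ?case
      by eventually_elim (simp add: increment_def elim)
  qed
qed

lemma form_domain_add: "u \<in> form_domain \<Longrightarrow> v \<in> form_domain \<Longrightarrow> (\<lambda>x. u x + v x) \<in> form_domain"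
  by (simp add: form_domain_eq increment_add L2_funs_add)

lemma form_domain_scale: "u \<in> form_domain \<Longrightarrow> (\<lambda>x. c * u x) \<in> form_domain"
  by (simp add: form_domain_eq increment_scale L2_funs_scale)

lemma form_domain_diff: "u \<in> form_domain \<Longrightarrow> v \<in> form_domain \<Longrightarrow> (\<lambda>x. u x - v x) \<in> form_domain"
  by (simp add: form_domain_eq increment_diff L2_funs_diff)

lemma form_domain_const: "(\<lambda>x. c) \<in> form_domain"
proof -
  have "(\<lambda>x. c) \<in> L2_funs M" by (rule L2_funs_bounded[of _ "\<bar>c\<bar>"]) auto
  then show ?thesis by (simp add: form_domain_def energy_def)
qed

lemma form_domain_AE:
  assumes u: "u \<in> form_domain" and v: "v \<in> borel_measurable M" and eq: "AE x in M. u x = v x"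
  shows "v \<in> form_domain"
proof -
  note [measurable] = v form_domainD(2)[OF u]
  have "v \<in> L2_funs M"
  proof (rule L2_funsI[OF v])
    have "integrable M (\<lambda>x. (u x)\<^sup>2) = integrable M (\<lambda>x. (v x)\<^sup>2)"
      by (rule integrable_cong_AE) (use eq in auto)
    then show "integrable M (\<lambda>x. (v x)\<^sup>2)" using u by (simp add: form_domainD L2_funs_integrable)
  qed
  moreover have "increment v \<in> L2_funs (M \<Otimes>\<^sub>M M)"
  proof (rule L2_funsI)
    have "integrable (M \<Otimes>\<^sub>M M) (\<lambda>x. (increment u x)\<^sup>2) = integrable (M \<Otimes>\<^sub>M M) (\<lambda>x. (increment v x)\<^sup>2)"
      by (rule integrable_cong_AE) (use increment_AE[OF _ v eq] in auto)
    then show "integrable (M \<Otimes>\<^sub>M M) (\<lambda>x. (increment v x)\<^sup>2)"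
      using u by (simp add: form_domainD L2_funs_integrable)
  qed auto
  ultimately show ?thesis by (simp add: form_domain_eq)
qed

lemma form_AE:
  assumes u: "u \<in> form_domain" and u': "u' \<in> form_domain" and v: "v \<in> form_domain"
    and eq: "AE x in M. u x = u' x"
  shows "form u v = form u' v"
proof -
  note [measurable] = form_domainD(2)[OF u] form_domainD(2)[OF u'] form_domainD(2)[OF v]
  show ?thesis
    unfolding form_eq[OF u v] form_eq[OF u' v]
    by (rule integral_cong_AE) (use increment_AE[OF _ _ eq] in auto)
qed

lemma form_sym: "form u v = form v u"
  by (simp add: form_def mult.commute)

lemma form_add:
  assumes "u \<in> form_domain" "v \<in> form_domain" "w \<in> form_domain"
  shows "form (\<lambda>x. u x + v x) w = form u w + form v w"
  using assms
  by (simp add: form_eq form_domain_add increment_add distrib_right L2_funs_mult_integrable form_domainD)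

lemma form_scale:
  assumes "u \<in> form_domain" "v \<in> form_domain"
  shows "form (\<lambda>x. c * u x) v = c * form u v"
  using assms
  by (simp add: form_eq form_domain_scale increment_scale mult.assoc)

text \<open>All other clauses of the definition hold for every exponent.\<close>

lemma symmetric_form_iff_dense:
  "symmetric_form M form form_domain \<longleftrightarrow>
     (\<forall>u\<in>L2_funs M. \<forall>e>0. \<exists>v\<in>form_domain. (\<integral>x. (u x - v x)\<^sup>2 \<partial>M) < e)"
proof
  assume "\<forall>u\<in>L2_funs M. \<forall>e>0. \<exists>v\<in>form_domain. (\<integral>x. (u x - v x)\<^sup>2 \<partial>M) < e"
  then show "symmetric_form M form form_domain"
    unfolding symmetric_form_def
    by (intro conjI ballI allI impI subsetI form_domainD(1) form_domain_const form_domain_add form_domain_scale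
        form_AE form_sym form_add form_scale form_nonneg)
       (auto intro: form_domain_AE L2_funs_measurable)
qed (simp add: symmetric_form_def)

text \<open>Truncation to the unit interval does not increase the modulus of any increment.\<close>

lemma markovian: "markovian_form form form_domain"
  unfolding markovian_form_def Let_def
proof (intro ballI conjI)
  fix u assume u: "u \<in> form_domain"
  let ?v = "\<lambda>x. min (max 0 (u x)) 1"
  note [measurable] = form_domainD(2)[OF u]
  have incr: "(increment ?v p)\<^sup>2 \<le> (increment u p)\<^sup>2" for p
  proof -
    have "\<bar>?v (fst p) - ?v (snd p)\<bar> \<le> \<bar>u (fst p) - u (snd p)\<bar>" by auto
    then show ?thesis
      by (auto simp: increment_def power_divide abs_le_square_iff intro!: divide_right_mono)
  qed
  have int: "integrable (M \<Otimes>\<^sub>M M) (\<lambda>p. (increment u p)\<^sup>2)"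
    using u by (intro L2_funs_integrable form_domainD)
  have int': "integrable (M \<Otimes>\<^sub>M M) (\<lambda>p. (increment ?v p)\<^sup>2)"
    by (rule Bochner_Integration.integrable_bound[OF int]) (use incr in auto)
  show v: "?v \<in> form_domain"
    using int' L2_funs_bounded[of ?v 1] by (auto simp: form_domain_eq intro!: L2_funsI)
  show "form ?v ?v \<le> form u u"
    unfolding form_eq[OF u u] form_eq[OF v v] power2_eq_square[symmetric]
    by (rule integral_mono[OF int' int incr])
qed

text \<open>The product rule \<open>u x * v x - u y * v y = v x * (u x - u y) + u y * (v x - v y)\<close>.\<close>

lemma form_domain_bounded_mult:
  assumes u: "u \<in> form_domain" and v: "v \<in> form_domain"
    and bu: "\<And>x. x \<in> space M \<Longrightarrow> \<bar>u x\<bar> \<le> B" and bv: "\<And>x. x \<in> space M \<Longrightarrow> \<bar>v x\<bar> \<le> B"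
  shows "(\<lambda>x. u x * v x) \<in> form_domain"
proof -
  note [measurable] = form_domainD(2)[OF u] form_domainD(2)[OF v]
  have "(\<lambda>x. u x * v x) \<in> L2_funs M"
  proof (rule L2_funs_bounded[of _ "B * B"])
    show "\<bar>u x * v x\<bar> \<le> B * B" if "x \<in> space M" for x
      using bu[OF that] bv[OF that] by (auto simp: abs_mult intro!: mult_mono)
  qed auto
  moreover have "integrable (M \<Otimes>\<^sub>M M) (\<lambda>p. (increment (\<lambda>x. u x * v x) p)\<^sup>2)"
  proof (rule Bochner_Integration.integrable_bound)
    show "integrable (M \<Otimes>\<^sub>M M) (\<lambda>p. 2 * B\<^sup>2 * ((increment u p)\<^sup>2 + (increment v p)\<^sup>2))"
      using u v by (intro integrable_mult_right Bochner_Integration.integrable_add L2_funs_integrable form_domainD)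
    show "AE p in M \<Otimes>\<^sub>M M. norm ((increment (\<lambda>x. u x * v x) p)\<^sup>2)
        \<le> norm (2 * B\<^sup>2 * ((increment u p)\<^sup>2 + (increment v p)\<^sup>2))"
    proof (rule AE_I2)
      fix p assume p: "p \<in> space (M \<Otimes>\<^sub>M M)"
      have xy: "fst p \<in> space M" "snd p \<in> space M" using p by (auto simp: space_pair_measure)
      have "increment (\<lambda>x. u x * v x) p = v (fst p) * increment u p + u (snd p) * increment v p"
        by (simp add: increment_def add_divide_distrib[symmetric] algebra_simps)
      also have "\<dots>\<^sup>2 \<le> 2 * (v (fst p) * increment u p)\<^sup>2 + 2 * (u (snd p) * increment v p)\<^sup>2"
        by (rule order_trans[OF _ order_refl]) (use sum_squares_bound[of "v (fst p) * increment u p" "u (snd p) * increment v p"] in \<open>simp add: power2_sum\<close>)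
      also have "\<dots> \<le> 2 * (B\<^sup>2 * (increment u p)\<^sup>2) + 2 * (B\<^sup>2 * (increment v p)\<^sup>2)"
      proof -
        have "(v (fst p))\<^sup>2 \<le> B\<^sup>2" "(u (snd p))\<^sup>2 \<le> B\<^sup>2"
          using bv[OF xy(1)] bu[OF xy(2)] by (simp_all add: abs_le_square_iff[symmetric])
        then show ?thesis
          by (intro add_mono mult_left_mono) (auto simp: power_mult_distrib intro!: mult_right_mono)
      qed
      finally show "norm ((increment (\<lambda>x. u x * v x) p)\<^sup>2)
        \<le> norm (2 * B\<^sup>2 * ((increment u p)\<^sup>2 + (increment v p)\<^sup>2))"
        by (simp add: algebra_simps)
    qed
  qed auto
  ultimately show ?thesis by (auto simp: form_domain_eq intro!: L2_funsI)
qed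

end

section \<open>A Morrey inequality on the carpet\<close>

lemma geometric_increments_limit:
  fixes a :: "nat \<Rightarrow> real"
  assumes step: "\<And>n. \<bar>a (Suc n) - a n\<bar> \<le> K * \<tau> ^ n" and \<tau>: "0 \<le> \<tau>" "\<tau> < 1"
  obtains l where "\<And>n. \<bar>a n - l\<bar> \<le> K * \<tau> ^ n / (1 - \<tau>)"
proof -
  have K: "K \<ge> 0" using step[of 0] by simp
  have tail: "\<bar>a (n + k) - a n\<bar> \<le> K * \<tau> ^ n / (1 - \<tau>)" for n k
  proof -
    have "\<bar>a (n + k) - a n\<bar> \<le> (\<Sum>i<k. K * \<tau> ^ (n + i))"
    proof (induction k)
      case (Suc k)
      then show ?case using step[of "n + k"] by simp
    qed simp
    also have "\<dots> = K * \<tau> ^ n * (\<Sum>i<k. \<tau> ^ i)"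
      by (simp add: sum_distrib_left power_add mult.assoc)
    also have "\<dots> \<le> K * \<tau> ^ n * (1 / (1 - \<tau>))"
    proof (intro mult_left_mono)
      have "(\<Sum>i<k. \<tau> ^ i) = (1 - \<tau> ^ k) / (1 - \<tau>)"
        using \<tau> by (simp add: sum_gp_strict)
      also have "\<dots> \<le> 1 / (1 - \<tau>)" using \<tau> by (intro divide_right_mono) auto
      finally show "(\<Sum>i<k. \<tau> ^ i) \<le> 1 / (1 - \<tau>)" .
    qed (use K \<tau> in simp)
    finally show ?thesis by simp
  qed
  have "(\<lambda>n. K * \<tau> ^ n / (1 - \<tau>)) \<longlonglongrightarrow> K * 0 / (1 - \<tau>)"
    using \<tau> by (intro tendsto_intros LIMSEQ_realpow_zero) auto
  then have lim0: "(\<lambda>n. K * \<tau> ^ n / (1 - \<tau>)) \<longlonglongrightarrow> 0" by simp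
  have "Cauchy a"
  proof (rule metric_CauchyI)
    fix e :: real assume "e > 0"
    then obtain N where N: "K * \<tau> ^ N / (1 - \<tau>) < e / 2"
      using order_tendstoD(2)[OF lim0, of "e / 2"] by (auto simp: eventually_sequentially)
    have close: "dist (a m) (a N) < e / 2" if "m \<ge> N" for m
      using le_less_trans[OF tail[of N "m - N"] N] that by (simp add: dist_real_def)
    show "\<exists>M. \<forall>m\<ge>M. \<forall>n\<ge>M. dist (a m) (a n) < e"
      using close dist_triangle_half_l[of _ "a N" e] by (intro exI[of _ N]) (auto simp: dist_commute)
  qed
  then obtain l where l: "a \<longlonglongrightarrow> l" using Cauchy_convergent convergent_def by blast
  have "\<bar>a n - l\<bar> \<le> K * \<tau> ^ n / (1 - \<tau>)" for n
  proof (rule LIMSEQ_le_const2)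
    show "(\<lambda>k. \<bar>a n - a (k + n)\<bar>) \<longlonglongrightarrow> \<bar>a n - l\<bar>"
      by (intro tendsto_intros LIMSEQ_ignore_initial_segment l)
    show "\<exists>N. \<forall>k\<ge>N. \<bar>a n - a (k + n)\<bar> \<le> K * \<tau> ^ n / (1 - \<tau>)"
      using tail[of n] by (auto simp: abs_minus_commute add.commute)
  qed
  then show ?thesis using that by blast
qed

context jump_form
begin

text \<open>The weight \<open>w\<close> selects pairs of points at distance at most \<open>\<rho>\<close>, where the kernel is at least
  \<open>1 / \<rho> powr s\<close>. Admitting weights with values up to \<open>m\<close> treats a single pair of sets and overlapping
  families of pairs in the same way.\<close>

lemma weighted_energy_bound:
  fixes w :: "'a \<Rightarrow> 'a \<Rightarrow> ennreal"
  assumes [measurable]: "u \<in> borel_measurable M" and s: "s \<ge> 0"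
    and w: "\<And>x y. x \<in> space M \<Longrightarrow> y \<in> space M \<Longrightarrow> w x y \<noteq> 0 \<Longrightarrow> norm (x - y) \<le> \<rho> \<and> w x y \<le> m"
  shows "(\<integral>\<^sup>+x. \<integral>\<^sup>+y. w x y * ennreal ((u x - u y)\<^sup>2) \<partial>M \<partial>M) \<le> m * ennreal (\<rho> powr s) * energy u"
proof -
  have "w x y * ennreal ((u x - u y)\<^sup>2)
      \<le> m * ennreal (\<rho> powr s) * ennreal ((u x - u y)\<^sup>2 / norm (x - y) powr s)"
    if "x \<in> space M" "y \<in> space M" for x y
  proof (cases "w x y = 0 \<or> x = y")
    case False
    then have "norm (x - y) powr s \<le> \<rho> powr s" and wm: "w x y \<le> m"
      using w[OF that] s by (auto intro: powr_mono2)
    then have "(u x - u y)\<^sup>2 \<le> \<rho> powr s * ((u x - u y)\<^sup>2 / norm (x - y) powr s)"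
      using False by (simp add: field_simps mult_right_mono)
    then have "w x y * ennreal ((u x - u y)\<^sup>2)
        \<le> m * ennreal (\<rho> powr s * ((u x - u y)\<^sup>2 / norm (x - y) powr s))"
      by (intro mult_mono wm ennreal_leI) auto
    then show ?thesis by (subst mult.assoc) (simp add: ennreal_mult[symmetric])
  qed auto
  then have "(\<integral>\<^sup>+x. \<integral>\<^sup>+y. w x y * ennreal ((u x - u y)\<^sup>2) \<partial>M \<partial>M)
      \<le> (\<integral>\<^sup>+x. \<integral>\<^sup>+y. m * ennreal (\<rho> powr s) * ennreal ((u x - u y)\<^sup>2 / norm (x - y) powr s) \<partial>M \<partial>M)"
    by (intro nn_integral_mono) auto
  also have "\<dots> = m * ennreal (\<rho> powr s) * energy u"
    unfolding energy_def by (simp add: nn_integral_cmult)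
  finally show ?thesis .
qed

lemma average_difference_energy:
  assumes u: "u \<in> form_domain" and s: "s \<ge> 0"
    and A: "A \<in> sets M" "measure M A \<ge> a" "a > 0" and B: "B \<in> sets M" "measure M B \<ge> b" "b > 0"
    and near: "\<And>x y. x \<in> A \<Longrightarrow> y \<in> B \<Longrightarrow> norm (x - y) \<le> \<rho>"
  shows "(average M A u - average M B u)\<^sup>2 * (a * b) \<le> \<rho> powr s * form u u"
proof -
  note [measurable] = A(1) B(1) form_domainD(2)[OF u]
  have pos: "measure M A > 0" "measure M B > 0" using A B by linarith+
  have "ennreal ((average M A u - average M B u)\<^sup>2 * (a * b))
      = ennreal ((average M A u - average M B u)\<^sup>2) * ennreal a * ennreal b"
    using A B by (simp add: ennreal_mult mult.assoc)
  also have "\<dots> \<le> ennreal ((average M A u - average M B u)\<^sup>2) * emeasure M A * emeasure M B"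
    using A B by (intro mult_mono) (auto simp: emeasure_eq_measure ennreal_leI)
  also have "\<dots> \<le> (\<integral>\<^sup>+x\<in>A. (\<integral>\<^sup>+y\<in>B. ennreal ((u x - u y)\<^sup>2) \<partial>M) \<partial>M)"
    by (rule average_difference[OF form_domainD(1)[OF u] A(1) pos(1) B(1) pos(2)])
  also have "\<dots> = (\<integral>\<^sup>+x. \<integral>\<^sup>+y. (indicator A x * indicator B y) * ennreal ((u x - u y)\<^sup>2) \<partial>M \<partial>M)"
    by (subst nn_integral_multc[symmetric]) (auto intro!: nn_integral_cong simp: ac_simps)
  also have "\<dots> \<le> 1 * ennreal (\<rho> powr s) * energy u"
    by (rule weighted_energy_bound) (use s near in \<open>auto split: split_indicator simp: indicator_def split: if_splits\<close>)
  also have "\<dots> = ennreal (\<rho> powr s * form u u)"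
    using u by (simp add: energy_form ennreal_mult form_nonneg)
  finally show ?thesis using u by (simp add: form_nonneg)
qed

end

interpretation carpet: jump_form carpet_measure "carpet_dim + \<beta>"
  rewrites "jump_form.energy carpet_measure (carpet_dim + \<beta>) = carpet_energy \<beta>"
    and "jump_form.form carpet_measure (carpet_dim + \<beta>) = carpet_form \<beta>"
    and "jump_form.form_domain carpet_measure (carpet_dim + \<beta>) = carpet_domain \<beta>"
  for \<beta>
proof -
  fix \<beta> :: real
  show *: "jump_form carpet_measure"
  proof (intro jump_form.intro finite_measureI jump_form_axioms.intro)
    show "emeasure carpet_measure (space carpet_measure) \<noteq> \<infinity>" by (simp add: emeasure_carpet)
    show "sets carpet_measure = sets (restrict_space borel (space carpet_measure))"
      by (simp add: sets_carpet_measure)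
  qed
  show e: "jump_form.energy carpet_measure (carpet_dim + \<beta>) = carpet_energy \<beta>"
    by (simp add: fun_eq_iff jump_form.energy_def[OF *] carpet_energy_def)
  show "jump_form.form carpet_measure (carpet_dim + \<beta>) = carpet_form \<beta>"
    by (simp add: fun_eq_iff jump_form.form_def[OF *] carpet_form_def)
  show "jump_form.form_domain carpet_measure (carpet_dim + \<beta>) = carpet_domain \<beta>"
    by (simp add: jump_form.form_domain_def[OF *] carpet_domain_def e)
qed

lemma carpet_dim_add_nonneg: "\<beta> > 0 \<Longrightarrow> 0 \<le> carpet_dim + \<beta>"
  by (intro add_nonneg_nonneg less_imp_le carpet_dim_pos)

lemma measure_carpet [simp]: "measure carpet_measure carpet = 1"
  by (simp add: measure_def emeasure_carpet)

text \<open>The radius is such that the ball contains a whole cell of level \<open>n\<close>, which gives the lower bound for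
  its measure.\<close>

definition carpet_ball :: "nat \<Rightarrow> real \<times> real \<Rightarrow> (real \<times> real) set" where
  "carpet_ball n x = cball x (2 / 3 ^ n) \<inter> carpet"

lemma carpet_ball_sets [measurable]: "carpet_ball n x \<in> sets carpet_measure"
  by (auto simp: carpet_ball_def sets_carpet_measure sets_restrict_space)

lemma measure_carpet_ball: "x \<in> carpet \<Longrightarrow> 1 / 8 ^ n \<le> measure carpet_measure (carpet_ball n x)"
  using emeasure_ball_ge[of x n] carpet.emeasure_eq_measure[of "carpet_ball n x"]
  by (simp add: carpet_ball_def)

lemma three_power_powr: "(3 ^ n) powr (carpet_dim + \<beta>) = (8 * 3 powr \<beta>) ^ n"
proof -
  have "(3 ^ n) powr (carpet_dim + \<beta>) = (3 powr (carpet_dim + \<beta>)) powr real n"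
    by (simp add: powr_powr powr_realpow[symmetric] mult.commute)
  also have "\<dots> = (8 * 3 powr \<beta>) ^ n"
    by (simp add: powr_realpow powr_add three_powr_carpet_dim)
  finally show ?thesis .
qed

lemma scale_powr: "c \<ge> 0 \<Longrightarrow> (c / 3 ^ n) powr (carpet_dim + \<beta>) = c powr (carpet_dim + \<beta>) / (8 * 3 powr \<beta>) ^ n"
  by (simp add: powr_divide three_power_powr)

definition ball_average :: "(real \<times> real \<Rightarrow> real) \<Rightarrow> nat \<Rightarrow> real \<times> real \<Rightarrow> real" where
  "ball_average u n x = average carpet_measure (carpet_ball n x) u"

text \<open>Two balls of level \<open>n\<close> or \<open>n + 1\<close> with nearby centers lie within distance \<open>5 / 3 ^ n\<close> of each other.
  Their masses contribute \<open>64 ^ n\<close> and the kernel contributes \<open>(8 * 3 powr \<beta>) ^ n\<close> in the denominator,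
  which leaves the ratio \<open>8 / 3 powr \<beta>\<close> for the square.\<close>

lemma ball_average_difference:
  assumes u: "u \<in> carpet_domain \<beta>" and \<beta>: "\<beta> > 0" and xy: "x \<in> carpet" "y \<in> carpet"
    and d: "dist x y \<le> 1 / 3 ^ n" and m: "m = n \<or> m = Suc n"
  shows "\<bar>ball_average u n x - ball_average u m y\<bar>
    \<le> sqrt (8 * 5 powr (carpet_dim + \<beta>) * carpet_form \<beta> u u) * sqrt (8 / 3 powr \<beta>) ^ n"
proof -
  have near: "norm (z - w) \<le> 5 / 3 ^ n" if "z \<in> carpet_ball n x" "w \<in> carpet_ball m y" for z w
  proof -
    have "dist x z \<le> 2 / 3 ^ n" "dist y w \<le> 2 / 3 ^ m" using that by (auto simp: carpet_ball_def)
    moreover have "2 / 3 ^ m \<le> (2 / 3 ^ n :: real)" using m by (auto intro!: divide_left_mono)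
    moreover have "dist z w \<le> dist x z + dist x y + dist y w"
      using dist_triangle[of z w x] dist_triangle[of x w y] by (simp add: dist_commute)
    ultimately have "dist z w \<le> 2 / 3 ^ n + 1 / 3 ^ n + 2 / 3 ^ n" using d by linarith
    then show ?thesis by (simp add: dist_norm add_divide_distrib[symmetric])
  qed
  have "(ball_average u n x - ball_average u m y)\<^sup>2 * (1 / 8 ^ n * (1 / 8 ^ m))
      \<le> (5 / 3 ^ n) powr (carpet_dim + \<beta>) * carpet_form \<beta> u u"
    unfolding ball_average_def
    by (rule carpet.average_difference_energy[OF u _ carpet_ball_sets measure_carpet_ball _ carpet_ball_sets measure_carpet_ball])
       (use xy near carpet_dim_add_nonneg[OF \<beta>] in auto)
  then have "(ball_average u n x - ball_average u m y)\<^sup>2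
      \<le> 8 ^ n * 8 ^ m * ((5 / 3 ^ n) powr (carpet_dim + \<beta>) * carpet_form \<beta> u u)"
    by (simp add: field_simps)
  also have "\<dots> \<le> 8 ^ n * (8 * 8 ^ n) * ((5 / 3 ^ n) powr (carpet_dim + \<beta>) * carpet_form \<beta> u u)"
    using m carpet.form_nonneg[OF u] by (intro mult_right_mono) auto
  also have "\<dots> = 8 * 5 powr (carpet_dim + \<beta>) * carpet_form \<beta> u u * (8 / 3 powr \<beta>) ^ n"
    by (simp add: scale_powr power_mult_distrib power_divide)
  also have "\<dots> = (sqrt (8 * 5 powr (carpet_dim + \<beta>) * carpet_form \<beta> u u) * sqrt (8 / 3 powr \<beta>) ^ n)\<^sup>2"
    using carpet.form_nonneg[OF u] by (simp add: power_mult_distrib power_mult[symmetric] mult.commute[of n] power_mult)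
  finally have "\<bar>ball_average u n x - ball_average u m y\<bar>
      \<le> \<bar>sqrt (8 * 5 powr (carpet_dim + \<beta>) * carpet_form \<beta> u u) * sqrt (8 / 3 powr \<beta>) ^ n\<bar>"
    by (simp only: abs_le_square_iff)
  also have "\<dots> = sqrt (8 * 5 powr (carpet_dim + \<beta>) * carpet_form \<beta> u u) * sqrt (8 / 3 powr \<beta>) ^ n"
    using carpet.form_nonneg[OF u] by (intro abs_of_nonneg) simp
  finally show ?thesis .
qed

lemma borel_measurable_continuous_carpet:
  fixes v :: "real \<times> real \<Rightarrow> real"
  assumes "continuous_on carpet v"
  shows "v \<in> borel_measurable carpet_measure"
  using borel_measurable_continuous_on_restrict[OF assms]
  by (simp add: measurable_cong_sets[OF sets_carpet_measure refl])

lemma form_1_nonneg: "u \<in> carpet_domain \<beta> \<Longrightarrow> form_1 carpet_measure (carpet_form \<beta>) u u \<ge> 0"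
  by (simp add: form_1_def carpet.form_nonneg)

text \<open>For \<open>\<beta> > carpet_dim\<close> the ratio \<open>\<tau>\<^sup>2 = 8 / 3 powr \<beta>\<close> is below one, so the averages over shrinking balls
  form a uniformly Cauchy sequence with a geometric rate. The limit \<open>v\<close> is continuous, since averages
  with nearby centers are close. It is bounded by the average at level zero, which the norm of \<open>u\<close>
  controls, plus a multiple of the root of the energy. It agrees with \<open>u\<close> almost everywhere because
  the mean square distance of \<open>u\<close> to its averages at level \<open>n\<close> is \<open>O ((1 / 3 powr \<beta>) ^ n)\<close>.\<close>

theorem morrey:
  assumes \<beta>: "\<beta> > carpet_dim"
  obtains C where "C \<ge> 0" and
    "\<And>u. u \<in> carpet_domain \<beta> \<Longrightarrow> \<exists>v. continuous_on carpet v \<and> (AE x in carpet_measure. u x = v x) \<and>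
       (\<forall>x\<in>carpet. (v x)\<^sup>2 \<le> C * form_1 carpet_measure (carpet_form \<beta>) u u)"
proof -
  define \<tau> where "\<tau> = sqrt (8 / 3 powr \<beta>)"
  have "3 powr carpet_dim < 3 powr \<beta>" using \<beta> by simp
  then have \<tau>: "0 < \<tau>" "\<tau> < 1" by (simp_all add: \<tau>_def three_powr_carpet_dim)
  have \<beta>0: "\<beta> > 0" using \<beta> carpet_dim_pos by linarith
  define B where "B = 8 * 5 powr (carpet_dim + \<beta>) / (1 - \<tau>)\<^sup>2"
  have B: "B \<ge> 0" by (simp add: B_def)
  have "\<exists>v. continuous_on carpet v \<and> (AE x in carpet_measure. u x = v x) \<and>
       (\<forall>x\<in>carpet. (v x)\<^sup>2 \<le> (2 * B + 2) * form_1 carpet_measure (carpet_form \<beta>) u u)"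
    if u: "u \<in> carpet_domain \<beta>" for u
  proof -
    note [measurable] = carpet.form_domainD(2)[OF u]
    let ?E = "carpet_form \<beta> u u"
    have E: "?E \<ge> 0" by (rule carpet.form_nonneg[OF u])
    define K where "K = sqrt (8 * 5 powr (carpet_dim + \<beta>) * ?E)"
    have K: "K \<ge> 0" using E by (simp add: K_def)
    have step: "\<bar>ball_average u n x - ball_average u m y\<bar> \<le> K * \<tau> ^ n"
      if "x \<in> carpet" "y \<in> carpet" "dist x y \<le> 1 / 3 ^ n" "m = n \<or> m = Suc n" for n m x y
      unfolding K_def \<tau>_def by (rule ball_average_difference[OF u \<beta>0 that])
    have "\<exists>l. \<forall>n. \<bar>ball_average u n x - l\<bar> \<le> K * \<tau> ^ n / (1 - \<tau>)" if x: "x \<in> carpet" for x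
    proof -
      obtain l where "\<And>n. \<bar>ball_average u n x - l\<bar> \<le> K * \<tau> ^ n / (1 - \<tau>)"
      proof (rule geometric_increments_limit)
        show "\<bar>ball_average u (Suc n) x - ball_average u n x\<bar> \<le> K * \<tau> ^ n" for n
          using step[of x x n "Suc n"] x by (simp add: abs_minus_commute)
      qed (use \<tau> in auto)
      then show ?thesis by blast
    qed
    then have "\<forall>x\<in>carpet. \<exists>l. \<forall>n. \<bar>ball_average u n x - l\<bar> \<le> K * \<tau> ^ n / (1 - \<tau>)" by blast
    from bchoice[OF this] obtain v
      where v: "\<And>x n. x \<in> carpet \<Longrightarrow> \<bar>ball_average u n x - v x\<bar> \<le> K * \<tau> ^ n / (1 - \<tau>)"
      by blast
    have lim0: "(\<lambda>n. c * \<tau> ^ n) \<longlonglongrightarrow> 0" for c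
      using tendsto_mult[OF tendsto_const LIMSEQ_realpow_zero[of \<tau>], of c] \<tau> by simp
    have cont: "continuous_on carpet v"
      unfolding continuous_on_iff
    proof (intro ballI allI impI)
      fix x and e :: real assume x: "x \<in> carpet" and e: "e > 0"
      obtain n where n: "(K + 2 * K / (1 - \<tau>)) * \<tau> ^ n < e"
        using order_tendstoD(2)[OF lim0 e] by (auto simp: eventually_sequentially)
      show "\<exists>d>0. \<forall>y\<in>carpet. dist y x < d \<longrightarrow> dist (v y) (v x) < e"
      proof (intro exI conjI ballI impI)
        show "(0::real) < 1 / 3 ^ n" by simp
        fix y assume y: "y \<in> carpet" "dist y x < 1 / 3 ^ n"
        have "\<bar>v y - v x\<bar> \<le> K * \<tau> ^ n / (1 - \<tau>) + K * \<tau> ^ n + K * \<tau> ^ n / (1 - \<tau>)"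
          using v[OF y(1), of n] v[OF x, of n] step[of y x n n] x y by (simp add: abs_le_iff)
        also have "\<dots> = (K + 2 * K / (1 - \<tau>)) * \<tau> ^ n" by (simp add: field_simps)
        finally show "dist (v y) (v x) < e" using n by (simp add: dist_real_def)
      qed
    qed
    note [measurable] = borel_measurable_continuous_carpet[OF cont]
    have "(\<integral>\<^sup>+x. ennreal ((u x - v x)\<^sup>2) \<partial>carpet_measure) = 0"
    proof -
      define c where "c n = 2 * (K * \<tau> ^ n / (1 - \<tau>))\<^sup>2 + 2 * (2 powr (carpet_dim + \<beta>) * ?E) * (1 / 3 powr \<beta>) ^ n" for n
      have "(\<integral>\<^sup>+x. ennreal ((u x - v x)\<^sup>2) \<partial>carpet_measure) \<le> ennreal (c n)" for n
      proof -
        let ?d = "K * \<tau> ^ n / (1 - \<tau>)"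
        let ?J = "\<lambda>x. \<integral>\<^sup>+y. indicator {p. norm (fst p - snd p) \<le> 2 / 3 ^ n} (x, y) * ennreal ((u x - u y)\<^sup>2) \<partial>carpet_measure"
        have pt: "ennreal ((u x - v x)\<^sup>2) \<le> ennreal (2 * ?d\<^sup>2) + ennreal (2 * 8 ^ n) * ?J x" if x: "x \<in> carpet" for x
        proof -
          have "ennreal ((ball_average u n x - u x)\<^sup>2) * ennreal (1 / 8 ^ n)
              \<le> ennreal ((ball_average u n x - u x)\<^sup>2) * emeasure carpet_measure (carpet_ball n x)"
            using measure_carpet_ball[OF x, of n]
            by (intro mult_left_mono) (auto simp: carpet.emeasure_eq_measure ennreal_leI)
          also have "\<dots> \<le> (\<integral>\<^sup>+y\<in>carpet_ball n x. ennreal ((u y - u x)\<^sup>2) \<partial>carpet_measure)"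
            unfolding ball_average_def
          proof (rule carpet.average_deviation)
            show "0 < measure carpet_measure (carpet_ball n x)"
              by (rule less_le_trans[OF _ measure_carpet_ball[OF x]]) simp
          qed (use carpet.form_domainD(1)[OF u] in auto)
          also have "\<dots> \<le> ?J x"
            by (intro nn_integral_mono)
               (auto simp: carpet_ball_def dist_norm power2_commute split: split_indicator)
          finally have "ennreal (2 * 8 ^ n) * (ennreal ((ball_average u n x - u x)\<^sup>2) * ennreal (1 / 8 ^ n)) \<le> ennreal (2 * 8 ^ n) * ?J x"
            by (rule mult_left_mono) simp
          then have avg: "ennreal (2 * (ball_average u n x - u x)\<^sup>2) \<le> ennreal (2 * 8 ^ n) * ?J x"
            by (simp add: ennreal_mult[symmetric] mult_ac)
          have "(ball_average u n x - v x)\<^sup>2 \<le> ?d\<^sup>2"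
            using v[OF x, of n] by (metis abs_ge_zero power2_abs power_mono)
          moreover have "(a - b)\<^sup>2 \<le> 2 * (t - b)\<^sup>2 + 2 * (t - a)\<^sup>2" for a b t :: real
            using zero_le_power2[of "(t - b) + (t - a)"] by (simp add: power2_eq_square algebra_simps)
          ultimately have "(u x - v x)\<^sup>2 \<le> 2 * ?d\<^sup>2 + 2 * (ball_average u n x - u x)\<^sup>2"
            by (smt (verit))
          then have "ennreal ((u x - v x)\<^sup>2) \<le> ennreal (2 * ?d\<^sup>2) + ennreal (2 * (ball_average u n x - u x)\<^sup>2)"
            by (simp add: ennreal_plus[symmetric] ennreal_leI del: ennreal_plus)
          also have "\<dots> \<le> ennreal (2 * ?d\<^sup>2) + ennreal (2 * 8 ^ n) * ?J x"
            by (intro add_left_mono avg)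
          finally show ?thesis .
        qed
        have "(\<integral>\<^sup>+x. ?J x \<partial>carpet_measure) \<le> 1 * ennreal ((2 / 3 ^ n) powr (carpet_dim + \<beta>)) * carpet_energy \<beta> u"
          by (rule carpet.weighted_energy_bound)
             (use carpet_dim_add_nonneg[OF \<beta>0] in \<open>auto simp: indicator_def split: if_splits\<close>)
        also have "\<dots> = ennreal ((2 / 3 ^ n) powr (carpet_dim + \<beta>) * ?E)"
          using E by (simp add: carpet.energy_form[OF u] ennreal_mult)
        finally have J: "(\<integral>\<^sup>+x. ?J x \<partial>carpet_measure) \<le> ennreal ((2 / 3 ^ n) powr (carpet_dim + \<beta>) * ?E)" .
        have "(\<integral>\<^sup>+x. ennreal ((u x - v x)\<^sup>2) \<partial>carpet_measure)
            \<le> (\<integral>\<^sup>+x. ennreal (2 * ?d\<^sup>2) + ennreal (2 * 8 ^ n) * ?J x \<partial>carpet_measure)"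
          using pt by (intro nn_integral_mono) auto
        also have "\<dots> = (\<integral>\<^sup>+x. ennreal (2 * ?d\<^sup>2) \<partial>carpet_measure) + ennreal (2 * 8 ^ n) * (\<integral>\<^sup>+x. ?J x \<partial>carpet_measure)"
          by (subst nn_integral_add) (auto simp: nn_integral_cmult)
        also have "\<dots> \<le> ennreal (2 * ?d\<^sup>2) + ennreal (2 * 8 ^ n) * ennreal ((2 / 3 ^ n) powr (carpet_dim + \<beta>) * ?E)"
          by (intro add_mono mult_left_mono J) (auto simp: emeasure_carpet)
        also have "\<dots> = ennreal (2 * ?d\<^sup>2 + 2 * 8 ^ n * ((2 / 3 ^ n) powr (carpet_dim + \<beta>) * ?E))"
          using E by (simp add: ennreal_mult[symmetric])
        also have "2 * ?d\<^sup>2 + 2 * 8 ^ n * ((2 / 3 ^ n) powr (carpet_dim + \<beta>) * ?E) = c n"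
          by (simp add: c_def scale_powr power_mult_distrib power_divide)
        finally show ?thesis .
      qed
      moreover have "(\<lambda>n. ennreal (c n)) \<longlonglongrightarrow> ennreal 0"
      proof (rule tendsto_ennrealI)
        have "3 powr 0 < 3 powr \<beta>" using \<beta>0 by (subst powr_less_cancel_iff) auto
        then have p: "(\<lambda>n. (1 / 3 powr \<beta>) ^ n) \<longlonglongrightarrow> 0"
          by (intro LIMSEQ_realpow_zero) auto
        have q: "(\<lambda>n. K * \<tau> ^ n / (1 - \<tau>)) \<longlonglongrightarrow> 0"
          using lim0[of "K / (1 - \<tau>)"] by simp
        have "c \<longlonglongrightarrow> 2 * 0\<^sup>2 + 2 * (2 powr (carpet_dim + \<beta>) * ?E) * 0"
          unfolding c_def
          by (rule tendsto_add[OF tendsto_mult[OF tendsto_const tendsto_power[OF q]] tendsto_mult[OF tendsto_const p]])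
        then show "c \<longlonglongrightarrow> 0" by simp
      qed
      ultimately have "(\<integral>\<^sup>+x. ennreal ((u x - v x)\<^sup>2) \<partial>carpet_measure) \<le> ennreal 0"
        by (intro LIMSEQ_le_const[of "\<lambda>n. ennreal (c n)"]) auto
      then show ?thesis by simp
    qed
    then have "AE x in carpet_measure. u x = v x"
      by (subst (asm) nn_integral_0_iff_AE) auto
    moreover have "(v x)\<^sup>2 \<le> (2 * B + 2) * form_1 carpet_measure (carpet_form \<beta>) u u" if x: "x \<in> carpet" for x
    proof -
      let ?I = "\<integral>x. u x * u x \<partial>carpet_measure"
      have I: "?I \<ge> 0" by simp
      have ball0: "measure carpet_measure (carpet_ball 0 x) \<ge> 1"
        using measure_carpet_ball[OF x, of 0] by simp
      have "ennreal ((ball_average u 0 x - 0)\<^sup>2) * 1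
          \<le> ennreal ((ball_average u 0 x - 0)\<^sup>2) * emeasure carpet_measure (carpet_ball 0 x)"
        using ball0 by (intro mult_left_mono) (auto simp: carpet.emeasure_eq_measure)
      also have "\<dots> \<le> (\<integral>\<^sup>+y\<in>carpet_ball 0 x. ennreal ((u y - 0)\<^sup>2) \<partial>carpet_measure)"
        unfolding ball_average_def
        by (rule carpet.average_deviation) (use carpet.form_domainD(1)[OF u] ball0 in auto)
      also have "\<dots> \<le> (\<integral>\<^sup>+y. ennreal ((u y)\<^sup>2) \<partial>carpet_measure)"
        by (intro nn_integral_mono) (auto split: split_indicator)
      also have "\<dots> = ennreal ?I"
        unfolding power2_eq_square
        by (intro nn_integral_eq_integral L2_funs_mult_integrable carpet.form_domainD(1)[OF u]) auto
      finally have 1: "(ball_average u 0 x)\<^sup>2 \<le> ?I" using I by simp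
      have "\<bar>ball_average u 0 x - v x\<bar> \<le> K / (1 - \<tau>)" using v[OF x, of 0] by simp
      then have "(ball_average u 0 x - v x)\<^sup>2 \<le> (K / (1 - \<tau>))\<^sup>2"
        by (metis abs_ge_zero power2_abs power_mono)
      also have "\<dots> = B * ?E"
        using E by (simp add: B_def K_def power_divide)
      finally have 2: "(ball_average u 0 x - v x)\<^sup>2 \<le> B * ?E" .
      have "(v x)\<^sup>2 \<le> 2 * (ball_average u 0 x - v x)\<^sup>2 + 2 * (ball_average u 0 x)\<^sup>2"
        using zero_le_power2[of "(ball_average u 0 x - v x) + ball_average u 0 x"]
        by (simp add: power2_eq_square algebra_simps)
      also have "\<dots> \<le> 2 * (B * ?E) + 2 * ?I" using 1 2 by simp
      also have "\<dots> \<le> (2 * B + 2) * (?E + ?I)"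
        using B E I by (simp add: algebra_simps)
      finally show ?thesis by (simp add: form_1_def)
    qed
    ultimately show ?thesis using cont by blast
  qed
  moreover have "2 * B + 2 \<ge> 0" using B by simp
  ultimately show ?thesis using that by blast
qed

section \<open>Density of continuous functions\<close>

lemma L2_triangle:
  assumes "u \<in> L2_funs M" "v \<in> L2_funs M" "w \<in> L2_funs M"
  shows "(\<integral>x. (u x - w x)\<^sup>2 \<partial>M) \<le> 2 * (\<integral>x. (u x - v x)\<^sup>2 \<partial>M) + 2 * (\<integral>x. (v x - w x)\<^sup>2 \<partial>M)"
proof -
  have i: "integrable M (\<lambda>x. (f x - g x)\<^sup>2)" if "f \<in> L2_funs M" "g \<in> L2_funs M" for f g
    using that by (intro L2_funs_integrable L2_funs_diff)
  have "(\<integral>x. (u x - w x)\<^sup>2 \<partial>M) \<le> (\<integral>x. 2 * (u x - v x)\<^sup>2 + 2 * (v x - w x)\<^sup>2 \<partial>M)"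
  proof (rule integral_mono)
    show "(u x - w x)\<^sup>2 \<le> 2 * (u x - v x)\<^sup>2 + 2 * (v x - w x)\<^sup>2" for x
      using zero_le_power2[of "(u x - v x) - (v x - w x)"] by (simp add: power2_eq_square algebra_simps)
  qed (use assms i in auto)
  also have "\<dots> = 2 * (\<integral>x. (u x - v x)\<^sup>2 \<partial>M) + 2 * (\<integral>x. (v x - w x)\<^sup>2 \<partial>M)"
    using assms i by simp
  finally show ?thesis .
qed

context jump_form
begin

text \<open>The approximating functions are continuous on the whole space, hence on every set that carries the
  measure.\<close>

definition approximable :: "('a \<Rightarrow> real) \<Rightarrow> bool" where
  "approximable u \<longleftrightarrow> u \<in> L2_funs M \<and>
     (\<forall>e>0. \<exists>v. continuous_on UNIV v \<and> v \<in> L2_funs M \<and> (\<integral>x. (u x - v x)\<^sup>2 \<partial>M) < e)"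

lemma approximable_limit:
  assumes u: "u \<in> L2_funs M" and f: "\<And>n::nat. approximable (f n)"
    and lim: "(\<lambda>n. \<integral>x. (u x - f n x)\<^sup>2 \<partial>M) \<longlonglongrightarrow> 0"
  shows "approximable u"
  unfolding approximable_def
proof (intro conjI allI impI u)
  fix e :: real assume e: "e > 0"
  obtain n where n: "(\<integral>x. (u x - f n x)\<^sup>2 \<partial>M) < e / 4"
    using order_tendstoD(2)[OF lim, of "e / 4"] e by (auto simp: eventually_sequentially)
  have fn: "f n \<in> L2_funs M" using f[of n] by (simp add: approximable_def)
  have "e / 4 > 0" using e by simp
  then obtain v where v: "continuous_on UNIV v" "v \<in> L2_funs M" "(\<integral>x. (f n x - v x)\<^sup>2 \<partial>M) < e / 4"
    using f[of n] unfolding approximable_def by blast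
  have "(\<integral>x. (u x - v x)\<^sup>2 \<partial>M) < e"
    using L2_triangle[OF u fn v(2)] n v(3) by simp
  then show "\<exists>v. continuous_on UNIV v \<and> v \<in> L2_funs M \<and> (\<integral>x. (u x - v x)\<^sup>2 \<partial>M) < e"
    using v by blast
qed

lemma approximable_continuous:
  assumes "continuous_on UNIV v" "v \<in> L2_funs M"
  shows "approximable v"
  unfolding approximable_def using assms by (auto intro!: exI[of _ v])

lemma approximable_add:
  assumes u: "approximable u" and w: "approximable w"
  shows "approximable (\<lambda>x. u x + w x)"
  unfolding approximable_def
proof (intro conjI allI impI)
  have u': "u \<in> L2_funs M" and w': "w \<in> L2_funs M" using u w by (auto simp: approximable_def)
  then show uw: "(\<lambda>x. u x + w x) \<in> L2_funs M" by (rule L2_funs_add)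
  fix e :: real assume "e > 0"
  then have e: "e / 4 > 0" by simp
  obtain v where v: "continuous_on UNIV v" "v \<in> L2_funs M" "(\<integral>x. (u x - v x)\<^sup>2 \<partial>M) < e / 4"
    using u e unfolding approximable_def by blast
  obtain z where z: "continuous_on UNIV z" "z \<in> L2_funs M" "(\<integral>x. (w x - z x)\<^sup>2 \<partial>M) < e / 4"
    using w e unfolding approximable_def by blast
  have "(\<integral>x. ((u x + w x) - (v x + z x))\<^sup>2 \<partial>M) < e"
    using L2_triangle[OF uw L2_funs_add[OF v(2) w'] L2_funs_add[OF v(2) z(2)]] v(3) z(3) by simp
  then show "\<exists>v. continuous_on UNIV v \<and> v \<in> L2_funs M \<and> (\<integral>x. (u x + w x - v x)\<^sup>2 \<partial>M) < e"
    using v z by (intro exI[of _ "\<lambda>x. v x + z x"]) (auto intro: continuous_on_add L2_funs_add)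
qed

lemma approximable_scale:
  assumes u: "approximable u"
  shows "approximable (\<lambda>x. c * u x)"
  unfolding approximable_def
proof (intro conjI allI impI)
  have u': "u \<in> L2_funs M" using u by (auto simp: approximable_def)
  then show "(\<lambda>x. c * u x) \<in> L2_funs M" by (rule L2_funs_scale)
  fix e :: real assume "e > 0"
  then have e: "e / (c\<^sup>2 + 1) > 0" by (simp add: add_nonneg_pos)
  obtain v where v: "continuous_on UNIV v" "v \<in> L2_funs M" "(\<integral>x. (u x - v x)\<^sup>2 \<partial>M) < e / (c\<^sup>2 + 1)"
    using u e unfolding approximable_def by blast
  let ?I = "\<integral>x. (u x - v x)\<^sup>2 \<partial>M"
  have "(\<integral>x. (c * u x - c * v x)\<^sup>2 \<partial>M) = (\<integral>x. c\<^sup>2 * (u x - v x)\<^sup>2 \<partial>M)"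
    by (simp add: right_diff_distrib[symmetric] power_mult_distrib)
  also have "\<dots> = c\<^sup>2 * ?I" by simp
  also have "\<dots> \<le> (c\<^sup>2 + 1) * ?I" by (intro mult_right_mono) auto
  also have "\<dots> < e" using v(3) by (simp add: pos_less_divide_eq add_nonneg_pos mult.commute)
  finally show "\<exists>v. continuous_on UNIV v \<and> v \<in> L2_funs M \<and> (\<integral>x. (c * u x - v x)\<^sup>2 \<partial>M) < e"
    using v by (intro exI[of _ "\<lambda>x. c * v x"]) (auto intro: continuous_on_mult_left L2_funs_scale)
qed

lemma approximable_sum: "finite I \<Longrightarrow> (\<And>i. i \<in> I \<Longrightarrow> approximable (f i)) \<Longrightarrow> approximable (\<lambda>x. \<Sum>i\<in>I. f i x)"
proof (induction I rule: finite_induct)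
  case empty
  have "(\<lambda>x. 0) \<in> L2_funs M" by (rule L2_funs_bounded[of _ 0]) auto
  then show ?case by (simp add: approximable_continuous)
next
  case (insert i I)
  then show ?case using approximable_add[of "f i" "\<lambda>x. \<Sum>i\<in>I. f i x"] by simp
qed

lemma approximable_bounded_limit:
  assumes u: "u \<in> borel_measurable M" and f: "\<And>n::nat. approximable (f n)"
    and lim: "\<And>x. x \<in> space M \<Longrightarrow> (\<lambda>n. f n x) \<longlonglongrightarrow> u x"
    and w: "w \<in> L2_funs M" "\<And>x n. x \<in> space M \<Longrightarrow> \<bar>u x - f n x\<bar> \<le> w x"
    and u2: "u \<in> L2_funs M"
  shows "approximable u"
proof (rule approximable_limit[OF u2 f])
  have [measurable]: "f n \<in> borel_measurable M" for n
    using f[of n] by (simp add: approximable_def L2_funs_measurable)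
  note [measurable] = u
  have "(\<lambda>n. \<integral>x. (u x - f n x)\<^sup>2 \<partial>M) \<longlonglongrightarrow> (\<integral>x. 0 \<partial>M)"
  proof (rule integral_dominated_convergence)
    show "integrable M (\<lambda>x. (w x)\<^sup>2)" by (rule L2_funs_integrable[OF w(1)])
    show "AE x in M. (\<lambda>n. (u x - f n x)\<^sup>2) \<longlonglongrightarrow> 0"
    proof (rule AE_I2)
      fix x assume "x \<in> space M"
      then have "(\<lambda>n. (u x - f n x)\<^sup>2) \<longlonglongrightarrow> (u x - u x)\<^sup>2" by (intro tendsto_intros lim)
      then show "(\<lambda>n. (u x - f n x)\<^sup>2) \<longlonglongrightarrow> 0" by simp
    qed
    show "AE x in M. norm ((u x - f n x)\<^sup>2) \<le> (w x)\<^sup>2" for n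
    proof (rule AE_I2)
      fix x assume "x \<in> space M"
      then have "\<bar>u x - f n x\<bar>\<^sup>2 \<le> (w x)\<^sup>2" using w(2) by (intro power_mono) auto
      then show "norm ((u x - f n x)\<^sup>2) \<le> (w x)\<^sup>2" by simp
    qed
  qed auto
  then show "(\<lambda>n. \<integral>x. (u x - f n x)\<^sup>2 \<partial>M) \<longlonglongrightarrow> 0" by simp
qed

lemma borel_indicator_measurable: "A \<in> sets borel \<Longrightarrow> (indicator A :: 'a \<Rightarrow> real) \<in> borel_measurable M"
  using measurable_compose[OF ident_measurable, of "indicator A :: 'a \<Rightarrow> real"] by simp

lemma borel_indicator_L2: "A \<in> sets borel \<Longrightarrow> (indicator A :: 'a \<Rightarrow> real) \<in> L2_funs M"
  by (rule L2_funs_bounded[of _ 1]) (auto simp: borel_indicator_measurable split: split_indicator)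

lemma const_L2: "(\<lambda>x. c) \<in> L2_funs M"
  by (rule L2_funs_bounded[of _ "\<bar>c\<bar>"]) auto

text \<open>The indicator is the limit of \<open>max 0 (1 - n * infdist x C)\<close>.\<close>

lemma approximable_indicator_closed:
  assumes C: "closed C"
  shows "approximable (indicator C)"
proof (cases "C = {}")
  case True
  have "indicator {} = (\<lambda>x::'a. 0::real)" by (auto simp: fun_eq_iff)
  then show ?thesis using True const_L2[of 0] by (simp add: approximable_continuous)
next
  case False
  define f where "f n x = max 0 (1 - real n * infdist x C)" for n x
  have cont: "continuous_on UNIV (f n)" for n unfolding f_def by (intro continuous_intros)
  have bd: "0 \<le> f n x" "f n x \<le> 1" for n x by (auto simp: f_def infdist_nonneg)
  show ?thesis
  proof (rule approximable_bounded_limit[where f = f])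
    show "approximable (f n)" for n
    proof (rule approximable_continuous[OF cont L2_funs_bounded[of _ 1]])
      show "f n \<in> borel_measurable M"
        using measurable_compose[OF ident_measurable borel_measurable_continuous_onI[OF cont[of n]]] by simp
      show "\<bar>f n x\<bar> \<le> 1" for x using bd[of n x] by simp
    qed
    show "(\<lambda>n. f n x) \<longlonglongrightarrow> indicator C x" for x
    proof (cases "x \<in> C")
      case True
      then show ?thesis by (simp add: f_def)
    next
      case notin: False
      then have pos: "infdist x C > 0" using C False by (simp add: infdist_pos_not_in_closed)
      obtain N where N: "real N * infdist x C > 1"
        using reals_Archimedean3[OF pos] by blast
      have "f n x = 0" if "n \<ge> N" for n
      proof -
        have "real N * infdist x C \<le> real n * infdist x C"
          using that pos by (intro mult_right_mono) auto
        then show ?thesis using N by (simp add: f_def)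
      qed
      then show ?thesis
        using notin by (intro tendsto_eventually) (auto simp: eventually_sequentially)
    qed
    show "\<bar>indicator C x - f n x\<bar> \<le> 1" for x n using bd[of n x] by (auto simp: indicator_def)
  qed (use C in \<open>auto simp: borel_indicator_measurable borel_indicator_L2 const_L2\<close>)
qed

text \<open>A Dynkin system argument: closed sets are stable under intersection and generate the Borel sets.\<close>

lemma approximable_indicator:
  assumes "A \<in> sets borel"
  shows "approximable (indicator A)"
proof -
  have "Int_stable (Collect closed)" by (auto simp: Int_stable_def)
  moreover have "Collect closed \<subseteq> Pow (UNIV :: 'a set)" by simp
  moreover have "A \<in> sigma_sets UNIV (Collect closed)" using assms by (simp add: borel_eq_closed)
  ultimately show ?thesis
  proof (induction rule: sigma_sets_induct_disjoint)
    case (basic A)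
    then show ?case by (simp add: approximable_indicator_closed)
  next
    case empty
    show ?case by (rule approximable_indicator_closed) simp
  next
    case (compl A)
    have "approximable (\<lambda>x. 1 + (-1) * indicator A x)"
      by (intro approximable_add approximable_scale compl approximable_continuous const_L2) auto
    moreover have "(\<lambda>x. 1 + (-1) * indicator A x) = (indicator (UNIV - A) :: 'a \<Rightarrow> real)"
      by (auto simp: fun_eq_iff split: split_indicator)
    ultimately show ?case by simp
  next
    case (union A)
    have A: "A i \<in> sets borel" for i using union(2) by (auto simp: borel_eq_closed)
    have eq: "(\<Sum>i<n. indicator (A i) x) = (indicator (\<Union>i<n. A i) x :: real)" for n x
      using union(1) by (subst indicator_UN_disjoint) (auto intro: disjoint_family_on_mono)
    show ?case
    proof (rule approximable_bounded_limit[where f = "\<lambda>n x. \<Sum>i<n. indicator (A i) x"])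
      show "approximable (\<lambda>x. \<Sum>i<n. indicator (A i) x)" for n
        using union(3) by (intro approximable_sum) auto
      show "(\<lambda>n. \<Sum>i<n. indicator (A i) x) \<longlonglongrightarrow> (indicator (\<Union>i. A i) x :: real)" for x
        unfolding eq by (rule LIMSEQ_indicator_UN)
      show "\<bar>indicator (\<Union>i. A i) x - (\<Sum>i<n. indicator (A i) x)\<bar> \<le> (1::real)" for x n
        unfolding eq by (auto split: split_indicator)
    qed (use A in \<open>auto simp: borel_indicator_measurable borel_indicator_L2 const_L2\<close>)
  qed
qed

lemma approximable_cong:
  assumes u: "approximable u" and eq: "\<And>x. x \<in> space M \<Longrightarrow> u x = v x"
  shows "approximable v"
  unfolding approximable_def
proof (intro conjI allI impI)
  have u2: "u \<in> L2_funs M" using u by (simp add: approximable_def)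
  show "v \<in> L2_funs M"
  proof (rule L2_funsI)
    show "v \<in> borel_measurable M"
      using L2_funs_measurable[OF u2] by (rule measurable_cong[THEN iffD1, rotated]) (rule eq)
    show "integrable M (\<lambda>x. (v x)\<^sup>2)"
      using L2_funs_integrable[OF u2]
      by (rule Bochner_Integration.integrable_cong[THEN iffD1, OF refl, rotated]) (simp add: eq)
  qed
  fix e :: real assume "e > 0"
  then obtain w where w: "continuous_on UNIV w" "w \<in> L2_funs M" "(\<integral>x. (u x - w x)\<^sup>2 \<partial>M) < e"
    using u unfolding approximable_def by blast
  have "(\<integral>x. (u x - w x)\<^sup>2 \<partial>M) = (\<integral>x. (v x - w x)\<^sup>2 \<partial>M)"
    by (rule Bochner_Integration.integral_cong[OF refl]) (simp add: eq)
  then show "\<exists>w. continuous_on UNIV w \<and> w \<in> L2_funs M \<and> (\<integral>x. (v x - w x)\<^sup>2 \<partial>M) < e"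
    using w by auto
qed

text \<open>Simple functions dominated by \<open>2 * \<bar>u\<bar>\<close> converge to \<open>u\<close>, and the mean square convergence follows from
  dominated convergence.\<close>

lemma L2_approximable:
  assumes u: "u \<in> L2_funs M"
  shows "approximable u"
proof -
  note [measurable] = L2_funs_measurable[OF u]
  obtain f where f: "\<And>i. simple_function M (f i)" "\<And>x. x \<in> space M \<Longrightarrow> (\<lambda>i. f i x) \<longlonglongrightarrow> u x"
    "\<And>i x. x \<in> space M \<Longrightarrow> dist (f i x) 0 \<le> 2 * dist (u x) 0"
    using borel_measurable_implies_sequence_metric[OF L2_funs_measurable[OF u], of 0] by blast
  have simple: "approximable (f i)" for i
  proof (rule approximable_cong)
    show "approximable (\<lambda>x. \<Sum>y\<in>f i ` space M. y * indicator (f i -` {y} \<inter> space M) x)"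
    proof (intro approximable_sum approximable_scale)
      show "finite (f i ` space M)" using f(1) by (rule simple_functionD)
      fix y
      have "f i -` {y} \<inter> space M \<in> sets M" using f(1) by (rule simple_functionD)
      then obtain A where A: "A \<in> sets borel" "f i -` {y} \<inter> space M = space M \<inter> A"
        unfolding sets_eq sets_restrict_space by blast
      show "approximable (indicator (f i -` {y} \<inter> space M))"
        by (rule approximable_cong[OF approximable_indicator[OF A(1)]]) (simp add: A(2) indicator_def)
    qed
    show "(\<Sum>y\<in>f i ` space M. y * indicator (f i -` {y} \<inter> space M) x) = f i x" if "x \<in> space M" for x
    proof -
      have "(\<Sum>y\<in>f i ` space M. y * indicator (f i -` {y} \<inter> space M) x)
          = (\<Sum>y\<in>f i ` space M. indicator (f i -` {y} \<inter> space M) x *\<^sub>R y)"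
        by (simp only: real_scaleR_def mult.commute)
      also have "\<dots> = f i x" by (rule simple_function_indicator_representation_banach[OF f(1) that, symmetric])
      finally show ?thesis .
    qed
  qed
  show ?thesis
  proof (rule approximable_bounded_limit[OF _ simple f(2) _ _ u])
    show "(\<lambda>x. 3 * \<bar>u x\<bar>) \<in> L2_funs M"
    proof (rule L2_funsI)
      show "integrable M (\<lambda>x. (3 * \<bar>u x\<bar>)\<^sup>2)"
        using L2_funs_integrable[OF L2_funs_scale[OF u, of 3]] by (simp add: power_mult_distrib)
    qed simp
    show "\<bar>u x - f n x\<bar> \<le> 3 * \<bar>u x\<bar>" if "x \<in> space M" for x n
      using f(3)[OF that, of n] by (simp add: dist_real_def)
  qed auto
qed

end

section \<open>Closedness and regularity\<close>

lemma openin_carpet_sets: "openin (top_of_set carpet) U \<Longrightarrow> U \<in> sets carpet_measure"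
  by (auto simp: openin_open sets_carpet_measure sets_restrict_space)

text \<open>Every point of an open set is the center of a ball inside it that contains a cell.\<close>

lemma carpet_open_positive:
  assumes U: "openin (top_of_set carpet) U" "U \<noteq> {}"
  shows "emeasure carpet_measure U > 0"
proof -
  obtain x where x: "x \<in> U" using U(2) by blast
  obtain e where e: "e > 0" "cball x e \<inter> carpet \<subseteq> U"
    using U(1) x unfolding openin_contains_cball by blast
  have xc: "x \<in> carpet" using U(1) x openin_subset by fastforce
  obtain n where "(1 / 3) ^ n < e / 2" using real_arch_pow_inv[of "e / 2" "1 / 3"] e by auto
  then have "2 / 3 ^ n \<le> e" by (simp add: power_one_over field_simps)
  then have sub: "carpet_ball n x \<subseteq> U" using e(2) by (auto simp: carpet_ball_def)
  have "0 < (1 / 8 ^ n :: real)" by simp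
  also have "\<dots> \<le> measure carpet_measure (carpet_ball n x)" by (rule measure_carpet_ball[OF xc])
  also have "\<dots> \<le> measure carpet_measure U"
    by (intro carpet.finite_measure_mono sub openin_carpet_sets U)
  finally show ?thesis by (simp add: carpet.emeasure_eq_measure)
qed

lemma dirichlet_base_carpet: "dirichlet_base carpet_measure"
  unfolding dirichlet_base_def
proof (intro conjI allI impI)
  show "locally compact (space carpet_measure)"
    using carpet_closed by (simp add: closed_imp_locally_compact)
  show "sets carpet_measure = sets (restrict_space borel (space carpet_measure))"
    by (simp add: sets_carpet_measure)
  show "emeasure carpet_measure C < \<infinity>" for C
    using carpet.emeasure_finite[of C] by (simp add: less_top[symmetric])
qed (simp add: carpet_open_positive)

text \<open>The set where two continuous functions differ is open, and nonempty open sets have positive measure.\<close>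

lemma continuous_AE_eq:
  assumes v: "continuous_on carpet v" and w: "continuous_on carpet w"
    and eq: "AE x in carpet_measure. v x = (w x :: real)" and x: "x \<in> carpet"
  shows "v x = w x"
proof (rule ccontr)
  assume neq: "v x \<noteq> w x"
  let ?U = "carpet \<inter> (\<lambda>x. v x - w x) -` (- {0})"
  have op: "openin (top_of_set carpet) ?U"
    by (intro continuous_openin_preimage_gen continuous_on_diff v w) auto
  have "x \<in> ?U" using neq x by simp
  then have "emeasure carpet_measure ?U > 0" using carpet_open_positive[OF op] by blast
  moreover have "emeasure carpet_measure ?U = 0"
    using eq by (subst (asm) AE_iff_measurable[OF openin_carpet_sets[OF op]]) auto
  ultimately show False by simp
qed

lemma continuous_carpet_L2: "continuous_on carpet v \<Longrightarrow> v \<in> L2_funs carpet_measure"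
proof -
  assume v: "continuous_on carpet v"
  obtain B where "\<And>x. x \<in> carpet \<Longrightarrow> \<bar>v x\<bar> \<le> B"
    using compact_imp_bounded[OF compact_continuous_image[OF v compact_carpet]]
    unfolding bounded_iff by auto
  then show ?thesis
    using borel_measurable_continuous_carpet[OF v] by (intro carpet.L2_funs_bounded) auto
qed

lemma sqdist_uniform:
  fixes u :: "real \<times> real \<Rightarrow> real"
  assumes u: "u \<in> borel_measurable carpet_measure" "\<And>x. x \<in> carpet \<Longrightarrow> \<bar>u x\<bar> \<le> d"
  shows "(\<integral>x. (u x)\<^sup>2 \<partial>carpet_measure) \<le> d\<^sup>2"
proof -
  have "(\<integral>x. (u x)\<^sup>2 \<partial>carpet_measure) \<le> (\<integral>x. d\<^sup>2 \<partial>carpet_measure)"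
  proof (rule integral_mono)
    show "integrable carpet_measure (\<lambda>x. (u x)\<^sup>2)"
      by (rule L2_funs_integrable[OF carpet.L2_funs_bounded[OF u(1)]]) (use u(2) in auto)
    fix x assume "x \<in> space carpet_measure"
    then have "\<bar>u x\<bar>\<^sup>2 \<le> d\<^sup>2" using u(2) by (intro power_mono) auto
    then show "(u x)\<^sup>2 \<le> d\<^sup>2" by simp
  qed simp
  then show ?thesis by simp
qed

lemma form_1_AE:
  assumes u: "u \<in> carpet_domain \<beta>" and v: "v \<in> carpet_domain \<beta>" and eq: "AE x in carpet_measure. u x = v x"
  shows "form_1 carpet_measure (carpet_form \<beta>) u u = form_1 carpet_measure (carpet_form \<beta>) v v"
proof -
  have "carpet_form \<beta> u u = carpet_form \<beta> v u" by (rule carpet.form_AE[OF u v u eq])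
  also have "\<dots> = carpet_form \<beta> u v" by (rule carpet.form_sym)
  also have "\<dots> = carpet_form \<beta> v v" by (rule carpet.form_AE[OF u v v eq])
  finally have "carpet_form \<beta> u u = carpet_form \<beta> v v" .
  moreover have "(\<integral>x. u x * u x \<partial>carpet_measure) = (\<integral>x. v x * v x \<partial>carpet_measure)"
    using eq carpet.form_domainD(2)[OF u] carpet.form_domainD(2)[OF v] by (intro integral_cong_AE) auto
  ultimately show ?thesis by (simp add: form_1_def)
qed

text \<open>By the Morrey inequality the continuous versions \<open>v n\<close> of the members of a Cauchy sequence are
  uniformly Cauchy, so they converge everywhere to a continuous \<open>w\<close>. Fatou's lemma on the product space bounds the energy of
  \<open>v n - w\<close> by the lower limit of the energies of \<open>v n - v m\<close>.\<close>

lemma closed_form_carpet: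
  assumes \<beta>: "\<beta> > carpet_dim"
  shows "closed_form carpet_measure (carpet_form \<beta>) (carpet_domain \<beta>)"
  unfolding closed_form_def
proof (intro allI impI)
  let ?E1 = "form_1 carpet_measure (carpet_form \<beta>)"
  let ?d = "form_1_sqdist carpet_measure (carpet_form \<beta>)"
  fix u :: "nat \<Rightarrow> real \<times> real \<Rightarrow> real"
  assume u: "\<forall>n. u n \<in> carpet_domain \<beta>"
    and cauchy: "\<forall>e>0. \<exists>N. \<forall>m\<ge>N. \<forall>n\<ge>N. ?d (u m) (u n) < e"
  obtain C where C: "C \<ge> 0" "\<And>u. u \<in> carpet_domain \<beta> \<Longrightarrow> \<exists>v. continuous_on carpet v \<and>
      (AE x in carpet_measure. u x = v x) \<and> (\<forall>x\<in>carpet. (v x)\<^sup>2 \<le> C * ?E1 u u)"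
    using morrey[OF \<beta>] by blast
  have "\<forall>n. \<exists>v. continuous_on carpet v \<and> (AE x in carpet_measure. u n x = v x)"
    using C(2) u by blast
  from choice[OF this] obtain v where "\<forall>n. continuous_on carpet (v n) \<and> (AE x in carpet_measure. u n x = v n x)" ..
  then have cont: "continuous_on carpet (v n)" and ae: "AE x in carpet_measure. u n x = v n x" for n by auto
  note vm [measurable] = borel_measurable_continuous_carpet[OF cont]
  have v: "v n \<in> carpet_domain \<beta>" for n
    by (rule carpet.form_domain_AE[OF u[rule_format] vm ae])
  have dist_eq: "?E1 (\<lambda>x. u n x - w x) (\<lambda>x. u n x - w x) = ?E1 (\<lambda>x. v n x - w x) (\<lambda>x. v n x - w x)"
    if "w \<in> carpet_domain \<beta>" for w n
  proof (rule form_1_AE)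
    show "AE x in carpet_measure. u n x - w x = v n x - w x" using ae[of n] by eventually_elim simp
  qed (simp_all add: carpet.form_domain_diff u[rule_format] v that)
  have sup: "(v m x - v n x)\<^sup>2 \<le> C * ?d (u m) (u n)" if x: "x \<in> carpet" for m n x
  proof -
    let ?u = "\<lambda>x. u m x - u n x"
    have "?u \<in> carpet_domain \<beta>" using u by (simp add: carpet.form_domain_diff)
    then obtain z where z: "continuous_on carpet z" "AE x in carpet_measure. ?u x = z x"
      "\<And>x. x \<in> carpet \<Longrightarrow> (z x)\<^sup>2 \<le> C * ?E1 ?u ?u" using C(2) by blast
    have "AE x in carpet_measure. v m x - v n x = z x"
      using z(2) ae[of m] ae[of n] by eventually_elim simp
    then have "v m x - v n x = z x"
      by (intro continuous_AE_eq[of "\<lambda>x. v m x - v n x"] continuous_on_diff cont z x)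
    then show ?thesis using z(3)[OF x] by (simp add: form_1_sqdist_def)
  qed
  have unif: "\<exists>N. \<forall>m\<ge>N. \<forall>n\<ge>N. \<forall>x\<in>carpet. \<bar>v m x - v n x\<bar> < e" if e: "e > 0" for e
  proof -
    have "e\<^sup>2 / (C + 1) > 0" using e C(1) by simp
    from cauchy[rule_format, OF this] obtain N where "\<forall>m\<ge>N. \<forall>n\<ge>N. ?d (u m) (u n) < e\<^sup>2 / (C + 1)" ..
    then have N: "m \<ge> N \<Longrightarrow> n \<ge> N \<Longrightarrow> ?d (u m) (u n) < e\<^sup>2 / (C + 1)" for m n by simp
    have "\<bar>v m x - v n x\<bar> < e" if "m \<ge> N" "n \<ge> N" "x \<in> carpet" for m n x
    proof -
      have "0 \<le> ?d (u m) (u n)" using u by (simp add: form_1_sqdist_def form_1_nonneg carpet.form_domain_diff)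
      then have "(v m x - v n x)\<^sup>2 \<le> (C + 1) * ?d (u m) (u n)"
        using sup[OF that(3), of m n] by (simp add: distrib_right)
      also have "\<dots> < e\<^sup>2" using N[OF that(1,2)] C(1) by (simp add: pos_less_divide_eq mult.commute)
      finally have "\<bar>v m x - v n x\<bar>\<^sup>2 < e\<^sup>2" by simp
      then show ?thesis by (rule power_less_imp_less_base) (use e in simp)
    qed
    then show ?thesis by blast
  qed
  have "uniformly_Cauchy_on carpet v"
    unfolding uniformly_Cauchy_on_def dist_real_def using unif by blast
  then obtain w where w: "uniform_limit carpet v w sequentially"
    using Cauchy_uniformly_convergent unfolding uniformly_convergent_on_def by blast
  have wcont: "continuous_on carpet w"
    by (rule uniform_limit_theorem[OF _ w]) (auto simp: cont)
  note wm [measurable] = borel_measurable_continuous_carpet[OF wcont]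
  have lim: "(\<lambda>n. v n x) \<longlonglongrightarrow> w x" if "x \<in> carpet" for x
    by (rule tendsto_uniform_limitI[OF w that])
  have small: "(\<lambda>x. v n x - w x) \<in> carpet_domain \<beta> \<and> carpet_form \<beta> (\<lambda>x. v n x - w x) (\<lambda>x. v n x - w x) \<le> e"
    if N: "\<And>m n. m \<ge> N \<Longrightarrow> n \<ge> N \<Longrightarrow> ?d (u m) (u n) < e" and n: "n \<ge> N" and e: "e > 0" for e N n
  proof -
    let ?P = "carpet_measure \<Otimes>\<^sub>M carpet_measure"
    have dvm: "(\<lambda>x. v n x - v m x) \<in> carpet_domain \<beta>" for m using v by (intro carpet.form_domain_diff)
    have en: "carpet_energy \<beta> (\<lambda>x. v n x - v m x) \<le> ennreal e" if "m \<ge> N" for m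
    proof -
      have "carpet_form \<beta> (\<lambda>x. v n x - v m x) (\<lambda>x. v n x - v m x) \<le> ?E1 (\<lambda>x. v n x - v m x) (\<lambda>x. v n x - v m x)"
        by (simp add: form_1_def)
      also have "\<dots> = ?E1 (\<lambda>x. u n x - v m x) (\<lambda>x. u n x - v m x)" by (rule dist_eq[OF v, symmetric])
      also have "\<dots> = ?E1 (\<lambda>x. u n x - u m x) (\<lambda>x. u n x - u m x)"
      proof (rule form_1_AE)
        show "AE x in carpet_measure. u n x - v m x = u n x - u m x" using ae[of m] by eventually_elim simp
      qed (simp_all add: carpet.form_domain_diff u[rule_format] v)
      also have "\<dots> \<le> e" using N[OF n that] by (simp add: form_1_sqdist_def)
      finally show ?thesis by (simp add: carpet.energy_form[OF dvm] ennreal_leI)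
    qed
    have "carpet_energy \<beta> (\<lambda>x. v n x - w x)
        = (\<integral>\<^sup>+p. liminf (\<lambda>m. ennreal ((carpet.increment \<beta> (\<lambda>x. v n x - v m x) p)\<^sup>2)) \<partial>?P)"
    proof (subst carpet.energy_eq, measurable, rule nn_integral_cong)
      fix p assume "p \<in> space ?P"
      then have p: "fst p \<in> carpet" "snd p \<in> carpet" by (auto simp: space_pair_measure)
      have "(\<lambda>m. ennreal ((carpet.increment \<beta> (\<lambda>x. v n x - v m x) p)\<^sup>2))
          \<longlonglongrightarrow> ennreal ((carpet.increment \<beta> (\<lambda>x. v n x - w x) p)\<^sup>2)"
        unfolding carpet.increment_def divide_inverse by (intro tendsto_intros tendsto_ennrealI lim p)
      then show "ennreal ((carpet.increment \<beta> (\<lambda>x. v n x - w x) p)\<^sup>2)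
          = liminf (\<lambda>m. ennreal ((carpet.increment \<beta> (\<lambda>x. v n x - v m x) p)\<^sup>2))"
        by (intro lim_imp_Liminf[symmetric]) auto
    qed
    also have "\<dots> \<le> liminf (\<lambda>m. \<integral>\<^sup>+p. ennreal ((carpet.increment \<beta> (\<lambda>x. v n x - v m x) p)\<^sup>2) \<partial>?P)"
      by (rule nn_integral_liminf) measurable
    also have "\<dots> = liminf (\<lambda>m. carpet_energy \<beta> (\<lambda>x. v n x - v m x))"
      by (subst carpet.energy_eq) auto
    also have "\<dots> \<le> ennreal e"
      by (rule Liminf_le) (auto simp: eventually_sequentially intro!: exI[of _ N] en)
    finally have fin: "carpet_energy \<beta> (\<lambda>x. v n x - w x) \<le> ennreal e" .
    have "(\<lambda>x. v n x - w x) \<in> carpet_domain \<beta>"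
      unfolding carpet_domain_def
      using fin continuous_carpet_L2[OF continuous_on_diff[OF cont wcont]] by (auto intro: le_less_trans)
    then show ?thesis using fin e by (simp add: carpet.energy_form)
  qed
  have w_dom: "w \<in> carpet_domain \<beta>"
  proof -
    from cauchy[rule_format, OF zero_less_one] obtain N where "\<forall>m\<ge>N. \<forall>n\<ge>N. ?d (u m) (u n) < 1" ..
    then have "(\<lambda>x. v N x - w x) \<in> carpet_domain \<beta>" using small[of N 1 N] by simp
    then have "(\<lambda>x. v N x - (v N x - w x)) \<in> carpet_domain \<beta>" by (rule carpet.form_domain_diff[OF v])
    then show ?thesis by simp
  qed
  have "(\<lambda>n. ?d (u n) w) \<longlonglongrightarrow> 0"
  proof (rule LIMSEQ_I)
    fix r :: real assume r: "r > 0"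
    then have "r / 4 > 0" by simp
    from cauchy[rule_format, OF this] obtain N1 where "\<forall>m\<ge>N1. \<forall>n\<ge>N1. ?d (u m) (u n) < r / 4" ..
    then have N1: "m \<ge> N1 \<Longrightarrow> n \<ge> N1 \<Longrightarrow> ?d (u m) (u n) < r / 4" for m n by simp
    define \<delta> where "\<delta> = sqrt (r / 4)"
    have \<delta>: "\<delta> > 0" "\<delta>\<^sup>2 = r / 4" using r by (auto simp: \<delta>_def)
    have "\<exists>N. \<forall>n\<ge>N. \<forall>x\<in>carpet. \<bar>v n x - w x\<bar> < \<delta>"
      using w \<delta>(1) unfolding uniform_limit_iff eventually_sequentially dist_real_def by simp
    then obtain N2 where "\<forall>n\<ge>N2. \<forall>x\<in>carpet. \<bar>v n x - w x\<bar> < \<delta>" ..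
    then have N2: "n \<ge> N2 \<Longrightarrow> x \<in> carpet \<Longrightarrow> \<bar>v n x - w x\<bar> < \<delta>" for n x by simp
    have "norm (?d (u n) w - 0) < r" if n: "n \<ge> max N1 N2" for n
    proof -
      have "?d (u n) w = carpet_form \<beta> (\<lambda>x. v n x - w x) (\<lambda>x. v n x - w x) + (\<integral>x. (v n x - w x)\<^sup>2 \<partial>carpet_measure)"
        unfolding form_1_sqdist_def dist_eq[OF w_dom] by (simp add: form_1_def power2_eq_square)
      also have "\<dots> \<le> r / 4 + \<delta>\<^sup>2"
        using small[OF N1, of n] n r N2[of n]
        by (intro add_mono sqdist_uniform) (auto intro: less_imp_le)
      finally have "?d (u n) w < r" using \<delta> r by simp
      moreover have "?d (u n) w \<ge> 0"
        using u w_dom by (simp add: form_1_sqdist_def form_1_nonneg carpet.form_domain_diff)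
      ultimately show ?thesis by simp
    qed
    then show "\<exists>no. \<forall>n\<ge>no. norm (?d (u n) w - 0) < r" by blast
  qed
  then show "\<exists>w\<in>carpet_domain \<beta>. (\<lambda>n. ?d (u n) w) \<longlonglongrightarrow> 0" using w_dom by blast
qed

text \<open>By the Morrey inequality every element of the domain has a continuous version, so continuous
  functions are dense in the domain for trivial reasons. The continuous elements of the domain form an
  algebra with unit. If it separates points, the Stone-Weierstrass theorem gives uniform density, and
  density in the square integrable functions follows from the density of continuous functions there.\<close>

theorem regular_if_separating:
  assumes \<beta>: "\<beta> > carpet_dim"
    and sep: "\<And>x y. x \<in> carpet \<Longrightarrow> y \<in> carpet \<Longrightarrow> x \<noteq> y \<Longrightarrow>
      \<exists>f\<in>carpet_domain \<beta>. continuous_on carpet f \<and> f x \<noteq> f y"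
  shows "regular_dirichlet_form carpet_measure (carpet_form \<beta>) (carpet_domain \<beta>)"
proof -
  define R where "R = {f \<in> carpet_domain \<beta>. continuous_on carpet f}"
  interpret R: function_ring_on R carpet
  proof
    fix f g assume f: "f \<in> R" and g: "g \<in> R"
    show "(\<lambda>x. f x * g x) \<in> R"
    proof -
      have cf: "continuous_on carpet f" and cg: "continuous_on carpet g" using f g by (auto simp: R_def)
      obtain B1 where B1: "\<And>x. x \<in> carpet \<Longrightarrow> \<bar>f x\<bar> \<le> B1"
        using compact_imp_bounded[OF compact_continuous_image[OF cf compact_carpet]] by (auto simp: bounded_iff)
      obtain B2 where B2: "\<And>x. x \<in> carpet \<Longrightarrow> \<bar>g x\<bar> \<le> B2"
        using compact_imp_bounded[OF compact_continuous_image[OF cg compact_carpet]] by (auto simp: bounded_iff)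
      have "(\<lambda>x. f x * g x) \<in> carpet_domain \<beta>"
      proof (rule carpet.form_domain_bounded_mult[where B = "max B1 B2"])
        show "\<bar>f x\<bar> \<le> max B1 B2" "\<bar>g x\<bar> \<le> max B1 B2" if "x \<in> space carpet_measure" for x
          using B1[of x] B2[of x] that by auto
      qed (use f g in \<open>auto simp: R_def\<close>)
      then show ?thesis using cf cg by (auto simp: R_def intro: continuous_on_mult)
    qed
  next
    fix x y assume "x \<in> carpet" "y \<in> carpet" "x \<noteq> y"
    then show "\<exists>f\<in>R. f x \<noteq> f y" using sep[of x y] by (auto simp: R_def)
  qed (auto simp: R_def compact_carpet carpet.form_domain_const carpet.form_domain_add intro: continuous_on_add)
  have Cc: "Cc_funs carpet = {f. continuous_on carpet f}"
    using compact_carpet by (auto simp: Cc_funs_def)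
  have uniform: "\<exists>v\<in>R. \<forall>x\<in>carpet. \<bar>g x - v x\<bar> < e" if "continuous_on carpet g" "e > 0" for g e
    using R.Stone_Weierstrass_basic[OF that] .
  have dense: "\<exists>v\<in>carpet_domain \<beta>. (\<integral>x. (u x - v x)\<^sup>2 \<partial>carpet_measure) < e"
    if u: "u \<in> L2_funs carpet_measure" and e: "e > 0" for u e
  proof -
    have e4: "e / 4 > 0" using e by simp
    then obtain g where g: "continuous_on UNIV g" "g \<in> L2_funs carpet_measure"
      "(\<integral>x. (u x - g x)\<^sup>2 \<partial>carpet_measure) < e / 4"
      using carpet.L2_approximable[OF u] unfolding carpet.approximable_def by blast
    have "continuous_on carpet g" using g(1) by (rule continuous_on_subset) simp
    then obtain v where v: "v \<in> R" "\<And>x. x \<in> carpet \<Longrightarrow> \<bar>g x - v x\<bar> < sqrt (e / 4)"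
      using uniform[of g "sqrt (e / 4)"] e4 by auto
    have v': "v \<in> L2_funs carpet_measure" using v(1) by (auto simp: R_def carpet.form_domainD)
    have "(\<integral>x. (g x - v x)\<^sup>2 \<partial>carpet_measure) \<le> (sqrt (e / 4))\<^sup>2"
      by (rule sqdist_uniform) (use g(2) v' v(2) in \<open>auto intro: L2_funs_measurable L2_funs_diff less_imp_le\<close>)
    then have "(\<integral>x. (u x - v x)\<^sup>2 \<partial>carpet_measure) < e"
      using L2_triangle[OF u g(2) v'] g(3) e by simp
    then show ?thesis using v(1) by (auto simp: R_def)
  qed
  show ?thesis
    unfolding regular_dirichlet_form_def dirichlet_form_def space_carpet_measure Cc
  proof (intro conjI ballI allI impI)
    show "dirichlet_base carpet_measure" by (rule dirichlet_base_carpet)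
    show "symmetric_form carpet_measure (carpet_form \<beta>) (carpet_domain \<beta>)"
      unfolding carpet.symmetric_form_iff_dense using dense by blast
    show "closed_form carpet_measure (carpet_form \<beta>) (carpet_domain \<beta>)" by (rule closed_form_carpet[OF \<beta>])
    show "markovian_form (carpet_form \<beta>) (carpet_domain \<beta>)" by (rule carpet.markovian)
  next
    fix u and e :: real assume u: "u \<in> carpet_domain \<beta>" and e: "e > 0"
    have "\<exists>v. continuous_on carpet v \<and> (AE x in carpet_measure. u x = v x)"
      by (rule morrey[OF \<beta>]) (use u in blast)
    then obtain v where v: "continuous_on carpet v" "AE x in carpet_measure. u x = v x" by blast
    have vd: "v \<in> carpet_domain \<beta>"
      by (rule carpet.form_domain_AE[OF u borel_measurable_continuous_carpet[OF v(1)] v(2)])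
    have "form_1_sqdist carpet_measure (carpet_form \<beta>) u v = form_1 carpet_measure (carpet_form \<beta>) (\<lambda>x. 0) (\<lambda>x. 0)"
      unfolding form_1_sqdist_def
    proof (rule form_1_AE)
      show "AE x in carpet_measure. u x - v x = 0" using v(2) by eventually_elim simp
    qed (use u vd in \<open>auto simp: carpet.form_domain_diff carpet.form_domain_const\<close>)
    also have "\<dots> = 0" by (simp add: form_1_def carpet_form_def)
    finally show "\<exists>v\<in>carpet_domain \<beta> \<inter> {f. continuous_on carpet f}. form_1_sqdist carpet_measure (carpet_form \<beta>) u v < e"
      using v(1) vd e by (intro bexI[of _ v] IntI CollectI) simp_all
  next
    fix g :: "real \<times> real \<Rightarrow> real" and e :: real
    assume "g \<in> {f. continuous_on carpet f}" "e > 0"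
    then have "continuous_on carpet g" "e > 0" by simp_all
    from uniform[OF this] show
      "\<exists>v\<in>carpet_domain \<beta> \<inter> {f. continuous_on carpet f}. \<forall>x\<in>carpet. \<bar>g x - v x\<bar> < e"
      unfolding R_def by blast
  qed
qed

section \<open>A singular function of finite energy\<close>

text \<open>At the first level the carpet has columns of 3, 2 and 3 cells. If each column is shorted, its
  resistance is 1/3, 1/2 and 1/3, and the potential drops across the columns are these numbers
  divided by their sum 7/6.\<close>

definition digit_weight :: "nat \<Rightarrow> real" where
  "digit_weight d = (if d = 1 then 3 / 7 else 2 / 7)"

text \<open>The increment, across column \<open>i\<close> of level \<open>n\<close>, of the potential obtained by shorting at every level.
  Only the last \<open>n\<close> ternary digits of \<open>i\<close> matter, so indices beyond \<open>3 ^ n\<close> continue the function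
  periodically and no boundary case arises for the last column.\<close>

primrec column_weight :: "nat \<Rightarrow> nat \<Rightarrow> real" where
  "column_weight 0 i = 1"
| "column_weight (Suc n) i = column_weight n (i div 3) * digit_weight (i mod 3)"

lemma digit_weight_pos: "digit_weight d > 0"
  by (simp add: digit_weight_def)

lemma column_weight_pos: "column_weight n i > 0"
  by (induction n arbitrary: i) (simp_all add: digit_weight_pos)

lemma column_weight_le: "column_weight n i \<le> (3 / 7) ^ n"
proof (induction n arbitrary: i)
  case (Suc n)
  have "column_weight n (i div 3) * digit_weight (i mod 3) \<le> (3 / 7) ^ n * (3 / 7)"
    using digit_weight_pos by (intro mult_mono Suc) (auto simp: digit_weight_def)
  then show ?case by (simp add: mult.commute)
qed simp

text \<open>Two consecutive numbers share their ternary digits up to a place where the digits \<open>d\<close> and \<open>d + 1\<close>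
  stand, followed only by the digit 2 in one and only by the digit 0 in the other. The weights of 0 and
  2 are equal, so the ratio of the products is that of a single pair of digits.\<close>

lemma column_weight_neighbours:
  "column_weight n i \<le> 3 / 2 * column_weight n (Suc i) \<and> column_weight n (Suc i) \<le> 3 / 2 * column_weight n i"
proof (induction n arbitrary: i)
  case (Suc n)
  show ?case
  proof (cases "i mod 3 = 2")
    case True
    then have "Suc i div 3 = Suc (i div 3)" "Suc i mod 3 = 0" by presburger+
    then show ?thesis using Suc[of "i div 3"] True by (simp add: digit_weight_def)
  next
    case False
    then have *: "Suc i div 3 = i div 3" "Suc i mod 3 = Suc (i mod 3)" by presburger+
    have "i mod 3 = 0 \<or> i mod 3 = 1" using False by presburger
    then have "digit_weight (i mod 3) \<le> 3 / 2 * digit_weight (Suc (i mod 3))"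
      "digit_weight (Suc (i mod 3)) \<le> 3 / 2 * digit_weight (i mod 3)"
      by (auto simp: digit_weight_def)
    from mult_left_mono[OF this(1), of "column_weight n (i div 3)"]
      mult_left_mono[OF this(2), of "column_weight n (i div 3)"]
    show ?thesis using column_weight_pos[of n "i div 3"] by (simp add: * mult_ac)
  qed
qed simp

definition partial_weight :: "nat \<Rightarrow> nat \<Rightarrow> real" where
  "partial_weight n k = (\<Sum>i<k. column_weight n i)"

lemma partial_weight_Suc: "partial_weight n (Suc k) = partial_weight n k + column_weight n k"
  by (simp add: partial_weight_def)

lemma partial_weight_mono: "k \<le> l \<Longrightarrow> partial_weight n k \<le> partial_weight n l"
  unfolding partial_weight_def by (intro sum_mono2) (auto simp: column_weight_pos less_imp_le)

lemma partial_weight_strict_mono: "k < l \<Longrightarrow> partial_weight n k < partial_weight n l"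
  using partial_weight_mono[of "Suc k" l n] column_weight_pos[of n k] by (simp add: partial_weight_Suc)

lemma partial_weight_refine1: "partial_weight (Suc n) (3 * k) = partial_weight n k"
proof (induction k)
  case (Suc k)
  have "3 * Suc k = Suc (Suc (Suc (3 * k)))" by simp
  moreover have "Suc (3 * k) div 3 = k" "Suc (Suc (3 * k)) div 3 = k" "Suc (3 * k) mod 3 = 1"
    "Suc (Suc (3 * k)) mod 3 = 2" by presburger+
  ultimately have "partial_weight (Suc n) (3 * Suc k) = partial_weight (Suc n) (3 * k)
      + column_weight n k * digit_weight 0 + column_weight n k * digit_weight 1 + column_weight n k * digit_weight 2"
    by (simp only: partial_weight_Suc column_weight.simps) simp
  then show ?case using Suc by (simp add: digit_weight_def partial_weight_Suc)
qed (simp add: partial_weight_def)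

lemma partial_weight_refine: "partial_weight (n + j) (3 ^ j * k) = partial_weight n k"
proof (induction j)
  case (Suc j)
  then show ?case using partial_weight_refine1[of "n + j" "3 ^ j * k"] by (simp add: mult.assoc)
qed simp

lemma partial_weight_0: "partial_weight 0 k = real k"
  by (simp add: partial_weight_def)

definition singular_approx :: "nat \<Rightarrow> real \<Rightarrow> real" where
  "singular_approx n x = partial_weight n (nat \<lfloor>3 ^ n * x\<rfloor>)"

text \<open>The distribution function of the Bernoulli measure on ternary digits with probabilities 2/7, 3/7, 2/7.
  The approximations count the mass of the full columns to the left of \<open>x\<close> and increase with \<open>n\<close>.\<close>

definition singular :: "real \<Rightarrow> real" where
  "singular x = (SUP n. singular_approx n x)"

lemma singular_approx_le:
  assumes x: "x \<ge> 0" and k: "3 ^ n * x \<le> real k"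
  shows "singular_approx m x \<le> partial_weight n k"
proof -
  have fl: "real (nat \<lfloor>3 ^ m * x\<rfloor>) \<le> 3 ^ m * x" using x by simp
  show ?thesis
  proof (cases "m \<le> n")
    case True
    then obtain j where n: "n = m + j" by (auto simp: le_iff_add)
    have "real (3 ^ j * nat \<lfloor>3 ^ m * x\<rfloor>) \<le> 3 ^ j * (3 ^ m * x)"
      using fl by simp
    also have "\<dots> \<le> real k" using k by (simp add: n power_add mult_ac)
    finally have "3 ^ j * nat \<lfloor>3 ^ m * x\<rfloor> \<le> k" by (simp only: of_nat_le_iff)
    then have "partial_weight (m + j) (3 ^ j * nat \<lfloor>3 ^ m * x\<rfloor>) \<le> partial_weight (m + j) k"
      by (rule partial_weight_mono)
    then show ?thesis unfolding partial_weight_refine by (simp add: n singular_approx_def)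
  next
    case False
    then obtain j where m: "m = n + j" by (metis le_iff_add nat_le_linear)
    have "real (nat \<lfloor>3 ^ m * x\<rfloor>) \<le> 3 ^ j * (3 ^ n * x)" using fl by (simp add: m power_add mult_ac)
    also have "\<dots> \<le> 3 ^ j * real k" using k by (intro mult_left_mono) auto
    also have "\<dots> = real (3 ^ j * k)" by simp
    finally have "nat \<lfloor>3 ^ m * x\<rfloor> \<le> 3 ^ j * k" by (simp only: of_nat_le_iff)
    then have "partial_weight (n + j) (nat \<lfloor>3 ^ m * x\<rfloor>) \<le> partial_weight (n + j) (3 ^ j * k)"
      by (rule partial_weight_mono)
    then show ?thesis unfolding partial_weight_refine by (simp add: m singular_approx_def)
  qed
qed

lemma singular_le: "x \<ge> 0 \<Longrightarrow> 3 ^ n * x \<le> real k \<Longrightarrow> singular x \<le> partial_weight n k"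
  unfolding singular_def by (intro cSUP_least singular_approx_le) auto

lemma singular_ge:
  assumes x: "x \<ge> 0" and k: "real k \<le> 3 ^ n * x"
  shows "partial_weight n k \<le> singular x"
proof -
  have "partial_weight n k \<le> singular_approx n x"
    unfolding singular_approx_def using k by (intro partial_weight_mono) (simp add: le_nat_floor)
  also have "\<dots> \<le> singular x"
    unfolding singular_def
  proof (rule cSUP_upper)
    obtain k where k: "3 ^ 0 * x \<le> real k" using real_arch_simple[of x] by auto
    show "bdd_above (range (\<lambda>n. singular_approx n x))"
      by (rule bdd_aboveI2[where M = "partial_weight 0 k"]) (rule singular_approx_le[OF x k])
  qed simp
  finally show ?thesis .
qed

lemma singular_0_1: "x \<in> {0..1} \<Longrightarrow> 0 \<le> singular x \<and> singular x \<le> 1"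
  using singular_ge[of x 0 0] singular_le[of x 0 1] by (simp add: partial_weight_0)

lemma singular_increment:
  assumes xy: "x \<ge> 0" "y \<ge> 0" and i: "real i \<le> 3 ^ n * x" "3 ^ n * x \<le> real i + 1"
    and d: "\<bar>x - y\<bar> \<le> 1 / 3 ^ n"
  shows "\<bar>singular x - singular y\<bar> \<le> 4 * column_weight n i"
proof -
  have "3 ^ n * \<bar>x - y\<bar> \<le> 1" using d by (simp add: field_simps)
  then have d': "\<bar>3 ^ n * x - 3 ^ n * y\<bar> \<le> 1" unfolding abs_diff_scaled .
  let ?P = "partial_weight n i" and ?w = "column_weight n i"
  have w: "?w > 0" by (rule column_weight_pos)
  have x1: "?P \<le> singular x" using singular_ge[OF xy(1) i(1)] .
  have "3 ^ n * x \<le> real (Suc i)" using i(2) by simp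
  from singular_le[OF xy(1) this] have x2: "singular x \<le> ?P + ?w" by (simp add: partial_weight_Suc)
  have "3 ^ n * y \<le> real (Suc (Suc i))" using i(2) d' by simp
  from singular_le[OF xy(2) this] have y2: "singular y \<le> ?P + ?w + column_weight n (Suc i)"
    by (simp add: partial_weight_Suc)
  have y1: "?P - 3 / 2 * ?w \<le> singular y"
  proof (cases i)
    case 0
    then show ?thesis using singular_ge[OF xy(2), of 0 n] xy(2) w by (simp add: partial_weight_def)
  next
    case (Suc i')
    have "real i' \<le> 3 ^ n * y" using i(1) d' Suc by simp
    from singular_ge[OF xy(2) this] have "partial_weight n i' \<le> singular y" .
    then show ?thesis using column_weight_neighbours[of n i'] by (simp add: Suc partial_weight_Suc)
  qed
  show ?thesis using x1 x2 y1 y2 w column_weight_neighbours[of n i] by (simp add: abs_le_iff)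
qed

lemma singular_strict_mono:
  assumes x: "x \<ge> 0" and xy: "x < y"
  shows "singular x < singular y"
proof -
  obtain n where "(1 / 3) ^ n < (y - x) / 3" using real_arch_pow_inv[of "(y - x) / 3" "1 / 3"] xy by auto
  then have n: "3 < 3 ^ n * y - 3 ^ n * x" by (simp add: power_one_over field_simps)
  define k where "k = nat \<lceil>3 ^ n * x\<rceil>"
  define l where "l = nat \<lfloor>3 ^ n * y\<rfloor>"
  have k: "3 ^ n * x \<le> real k" "real k < 3 ^ n * x + 1"
    using x by (auto simp: k_def real_nat_ceiling_ge ceiling_correct) linarith
  have l: "real l \<le> 3 ^ n * y" "3 ^ n * y < real l + 1"
    using x xy by (auto simp: l_def)
  have "k < l" using k l n by linarith
  have "singular x \<le> partial_weight n k" using singular_le[OF x k(1)] .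
  also have "\<dots> < partial_weight n l" by (rule partial_weight_strict_mono[OF \<open>k < l\<close>])
  also have "\<dots> \<le> singular y" using singular_ge[OF _ l(1)] x xy by simp
  finally show ?thesis .
qed

lemma continuous_on_singular: "continuous_on {0..} singular"
  unfolding continuous_on_iff
proof (intro ballI allI impI)
  fix x e :: real assume x: "x \<in> {0..}" and e: "e > 0"
  obtain n where n: "(3 / 7) ^ n < e / 4" using real_arch_pow_inv[of "e / 4" "3 / 7"] e by auto
  show "\<exists>d>0. \<forall>y\<in>{0..}. dist y x < d \<longrightarrow> dist (singular y) (singular x) < e"
  proof (intro exI conjI ballI impI)
    show "(0::real) < 1 / 3 ^ n" by simp
    fix y :: real assume y: "y \<in> {0..}" "dist y x < 1 / 3 ^ n"
    define i where "i = nat \<lfloor>3 ^ n * x\<rfloor>"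
    have "\<bar>singular x - singular y\<bar> \<le> 4 * column_weight n i"
    proof (rule singular_increment)
      show "real i \<le> 3 ^ n * x" using x by (simp add: i_def)
      show "3 ^ n * x \<le> real i + 1"
        using x by (simp add: i_def)
    qed (use x y in \<open>auto simp: dist_real_def abs_minus_commute\<close>)
    also have "\<dots> < e" using column_weight_le[of n i] n by linarith
    finally show "dist (singular y) (singular x) < e" by (simp add: dist_real_def abs_minus_commute)
  qed
qed

text \<open>The energy of the shorted network: one level contributes
  \<open>3 * (2/7)\<^sup>2 + 2 * (3/7)\<^sup>2 + 3 * (2/7)\<^sup>2 = 6/7\<close>.\<close>

lemma sum_column_weight_squares:
  assumes idx: "idx = fst \<or> idx = snd"
  shows "(\<Sum>p\<in>carpet_pos n. (column_weight n (idx p))\<^sup>2) = (6 / 7) ^ n"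
proof (induction n)
  case (Suc n)
  have "(\<Sum>p\<in>carpet_pos (Suc n). (column_weight (Suc n) (idx p))\<^sup>2)
      = (\<Sum>(p, a)\<in>carpet_pos n \<times> carpet_digits. (column_weight n (idx p))\<^sup>2 * (digit_weight (idx a))\<^sup>2)"
    unfolding carpet_pos.simps
    by (subst sum.reindex[OF inj_on_subdivision], intro sum.cong refl)
       (use idx in \<open>auto dest!: carpet_digits_less simp: power_mult_distrib\<close>)
  also have "\<dots> = (\<Sum>p\<in>carpet_pos n. (column_weight n (idx p))\<^sup>2) * (\<Sum>a\<in>carpet_digits. (digit_weight (idx a))\<^sup>2)"
    by (simp add: sum.cartesian_product[symmetric] sum_product)
  also have "(\<Sum>a\<in>carpet_digits. (digit_weight (idx a))\<^sup>2) = 6 / 7"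
    using idx by (auto simp: carpet_digits_def digit_weight_def power2_eq_square)
  finally show ?case using Suc by simp
qed (use idx in auto)

text \<open>For a point \<open>x\<close> of a cell in column \<open>i\<close> and a point \<open>y\<close> within \<open>1 / 3 ^ n\<close>, the increment is at most
  \<open>4 * column_weight n i\<close>. The set of such \<open>y\<close> has measure at most \<open>16 / 8 ^ n\<close>, the cell has measure
  \<open>1 / 8 ^ n\<close>, and summation over the cells gives the power of 6/7. The same computation applies
  to rows, which is why the coordinate is a parameter.\<close>

lemma singular_energy_at_scale:
  fixes coord :: "real \<times> real \<Rightarrow> real" and idx :: "nat \<times> nat \<Rightarrow> nat"
  assumes coord: "coord = fst \<and> idx = fst \<or> coord = snd \<and> idx = snd"
  shows "(\<integral>\<^sup>+x. \<integral>\<^sup>+y. indicator {(x, y). dist x y \<le> 1 / 3 ^ n} (x, y)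
      * ennreal ((singular (coord x) - singular (coord y))\<^sup>2) \<partial>carpet_measure \<partial>carpet_measure)
    \<le> ennreal (256 * (6 / 7) ^ n / 64 ^ n)"
proof -
  let ?w = "\<lambda>p. column_weight n (idx p)"
  let ?I = "\<lambda>x y. indicator {(x, y). dist x y \<le> 1 / 3 ^ n} (x, y) :: ennreal"
  let ?u = "\<lambda>x. singular (coord x)"
  have c1: "0 \<le> coord x" if "x \<in> carpet" for x using coord carpet_coordD[OF that] by auto
  have c2: "\<bar>coord x - coord y\<bar> \<le> dist x y" for x y
    using coord dist_fst_le[of x y] dist_snd_le[of x y] by (auto simp: dist_real_def)
  have c3: "real (idx p) \<le> 3 ^ n * coord x \<and> 3 ^ n * coord x \<le> real (idx p) + 1" if "x \<in> cell n p" for x p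
    using coord cell_coords[of x n "fst p" "snd p"] that by auto
  have inner: "(\<integral>\<^sup>+y. ?I x y * ennreal ((?u x - ?u y)\<^sup>2) \<partial>carpet_measure)
      \<le> (\<Sum>p\<in>carpet_pos n. ennreal (256 * (?w p)\<^sup>2 / 8 ^ n) * indicator (cell n p) x)"
    if x: "x \<in> carpet" for x
  proof -
    obtain p where p: "p \<in> carpet_pos n" "x \<in> cell n p" using x carpet_eq_cells[of n] by blast
    let ?B = "cball x (1 / 3 ^ n) \<inter> carpet"
    have B: "?B \<in> sets carpet_measure" by (auto simp: sets_carpet_measure sets_restrict_space)
    have "(\<integral>\<^sup>+y. ?I x y * ennreal ((?u x - ?u y)\<^sup>2) \<partial>carpet_measure)
        \<le> (\<integral>\<^sup>+y. ennreal (16 * (?w p)\<^sup>2) * indicator ?B y \<partial>carpet_measure)"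
    proof (rule nn_integral_mono)
      fix y assume "y \<in> space carpet_measure"
      then have y: "y \<in> carpet" by simp
      show "?I x y * ennreal ((?u x - ?u y)\<^sup>2) \<le> ennreal (16 * (?w p)\<^sup>2) * indicator ?B y"
      proof (cases "dist x y \<le> 1 / 3 ^ n")
        case True
        have "\<bar>?u x - ?u y\<bar> \<le> 4 * ?w p"
          using True c2[of x y] c3[OF p(2)] by (intro singular_increment c1 x y) auto
        then have "\<bar>?u x - ?u y\<bar>\<^sup>2 \<le> (4 * ?w p)\<^sup>2" by (intro power_mono) auto
        then have "(?u x - ?u y)\<^sup>2 \<le> 16 * (?w p)\<^sup>2" by (simp add: power_mult_distrib)
        then show ?thesis using True y by (simp add: ennreal_leI)
      qed simp
    qed
    also have "\<dots> = ennreal (16 * (?w p)\<^sup>2) * emeasure carpet_measure ?B"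
      using B by (rule nn_integral_cmult_indicator)
    also have "\<dots> \<le> ennreal (16 * (?w p)\<^sup>2) * ennreal (16 / 8 ^ n)"
      by (intro mult_left_mono emeasure_small_set_le[OF B, of x]) (auto simp: dist_commute)
    also have "\<dots> = ennreal (256 * (?w p)\<^sup>2 / 8 ^ n) * indicator (cell n p) x"
      using p(2) by (simp add: ennreal_mult[symmetric])
    also have "\<dots> \<le> (\<Sum>p\<in>carpet_pos n. ennreal (256 * (?w p)\<^sup>2 / 8 ^ n) * indicator (cell n p) x)"
      by (rule member_le_sum[OF p(1)]) auto
    finally show ?thesis .
  qed
  have "(\<integral>\<^sup>+x. \<integral>\<^sup>+y. ?I x y * ennreal ((?u x - ?u y)\<^sup>2) \<partial>carpet_measure \<partial>carpet_measure)
      \<le> (\<integral>\<^sup>+x. (\<Sum>p\<in>carpet_pos n. ennreal (256 * (?w p)\<^sup>2 / 8 ^ n) * indicator (cell n p) x) \<partial>carpet_measure)"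
    using inner by (intro nn_integral_mono) auto
  also have "\<dots> = (\<Sum>p\<in>carpet_pos n. \<integral>\<^sup>+x. ennreal (256 * (?w p)\<^sup>2 / 8 ^ n) * indicator (cell n p) x \<partial>carpet_measure)"
    by (rule nn_integral_sum) (auto intro!: borel_measurable_times_ennreal borel_measurable_indicator cell_sets)
  also have "\<dots> = (\<Sum>p\<in>carpet_pos n. ennreal (256 * (?w p)\<^sup>2 / 8 ^ n * (1 / 8 ^ n)))"
  proof (rule sum.cong[OF refl])
    fix p assume p: "p \<in> carpet_pos n"
    have "(\<integral>\<^sup>+x. ennreal (256 * (?w p)\<^sup>2 / 8 ^ n) * indicator (cell n p) x \<partial>carpet_measure)
        = ennreal (256 * (?w p)\<^sup>2 / 8 ^ n) * emeasure carpet_measure (cell n p)"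
      by (rule nn_integral_cmult_indicator[OF cell_sets[OF p]])
    then show "(\<integral>\<^sup>+x. ennreal (256 * (?w p)\<^sup>2 / 8 ^ n) * indicator (cell n p) x \<partial>carpet_measure)
        = ennreal (256 * (?w p)\<^sup>2 / 8 ^ n * (1 / 8 ^ n))"
      by (simp add: emeasure_cell[OF p] ennreal_mult[symmetric])
  qed
  also have "\<dots> = ennreal (\<Sum>p\<in>carpet_pos n. 256 / 64 ^ n * (?w p)\<^sup>2)"
    by (subst sum_ennreal) (auto intro!: arg_cong[where f = ennreal] sum.cong simp: power_mult_distrib[symmetric])
  also have "(\<Sum>p\<in>carpet_pos n. 256 / 64 ^ n * (?w p)\<^sup>2) = 256 / 64 ^ n * (6 / 7) ^ n"
    using sum_column_weight_squares[of idx n] coord by (subst sum_distrib_left[symmetric]) auto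
  finally show ?thesis by simp
qed

lemma continuous_on_singular_coord:
  fixes coord :: "real \<times> real \<Rightarrow> real"
  assumes coord: "coord = fst \<or> coord = snd"
  shows "continuous_on carpet (\<lambda>z. singular (coord z))"
proof (rule continuous_on_compose2[OF continuous_on_singular])
  show "continuous_on carpet coord" using coord by (auto intro: continuous_intros)
  show "coord ` carpet \<subseteq> {0..}" using coord carpet_coordD by auto
qed

text \<open>Splitting the energy by the triadic size of the distance produces a geometric series with ratio
  \<open>(8 * 3 powr \<beta>) / 64 * (6 / 7)\<close>, which is below one precisely for \<open>3 powr \<beta> < 28 / 3\<close>.\<close>

theorem singular_coord_domain:
  fixes coord :: "real \<times> real \<Rightarrow> real"
  assumes coord: "coord = fst \<or> coord = snd" and \<beta>: "\<beta> > 0" "3 powr \<beta> < 28 / 3"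
  shows "(\<lambda>z. singular (coord z)) \<in> carpet_domain \<beta>"
proof -
  let ?u = "\<lambda>z. singular (coord z)" and ?s = "carpet_dim + \<beta>"
  let ?I = "\<lambda>n x y. indicator {(x, y). dist x y \<le> 1 / 3 ^ n} (x, y) :: ennreal"
  obtain idx :: "nat \<times> nat \<Rightarrow> nat" where idx: "coord = fst \<and> idx = fst \<or> coord = snd \<and> idx = snd"
    using coord by blast
  have cont: "continuous_on carpet ?u" by (rule continuous_on_singular_coord[OF coord])
  note [measurable] = borel_measurable_continuous_carpet[OF cont]
  have bd: "0 \<le> ?u x \<and> ?u x \<le> 1" if "x \<in> carpet" for x
    using coord carpet_coordD[OF that] by (intro singular_0_1) auto
  have L2: "?u \<in> L2_funs carpet_measure"
    by (rule carpet.L2_funs_bounded[of _ 1]) (use bd in auto)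
  define a where "a = 8 * 3 powr \<beta>"
  have s: "?s \<ge> 0" using \<beta>(1) by (rule carpet_dim_add_nonneg)
  have a: "a > 0" "a < 8 * (28 / 3)" using \<beta>(2) by (simp_all add: a_def)
  \<comment> \<open>The kernel is dominated by its values at the triadic scales.\<close>
  have pt: "ennreal ((?u x - ?u y)\<^sup>2 / norm (x - y) powr ?s)
      \<le> 1 + (\<Sum>n. ennreal (a ^ Suc n) * (?I n x y * ennreal ((?u x - ?u y)\<^sup>2)))"
    if xy: "x \<in> carpet" "y \<in> carpet" for x y
  proof (cases "x = y")
    case False
    define r where "r = norm (x - y)"
    have r: "r > 0" using False by (simp add: r_def)
    show ?thesis
    proof (cases "r \<le> 1")
      case True
      obtain m where "(1 / 3) ^ m < r" using real_arch_pow_inv[OF r, of "1 / 3"] by auto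
      then have m: "1 / 3 ^ m < r" by (simp add: power_one_over)
      define n where "n = (LEAST m. 1 / 3 ^ m < r)"
      have n: "1 / 3 ^ n < r" unfolding n_def by (rule LeastI[of _ m]) (rule m)
      have "n \<noteq> 0" using n True by (cases n) auto
      then obtain l where l: "n = Suc l" using not0_implies_Suc by blast
      have "\<not> 1 / 3 ^ l < r" using not_less_Least[of l "\<lambda>m. 1 / 3 ^ m < r"] l unfolding n_def by simp
      then have rl: "dist x y \<le> 1 / 3 ^ l" by (simp add: r_def dist_norm)
      have "(1 / 3 ^ n) powr ?s \<le> r powr ?s" using n s by (intro powr_mono2) (auto simp: less_imp_le)
      then have "1 / a ^ n \<le> r powr ?s" using scale_powr[of 1 n \<beta>] by (simp add: a_def)
      then have "1 \<le> a ^ n * r powr ?s" using a(1) by (simp add: field_simps)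
      then have "(?u x - ?u y)\<^sup>2 * 1 \<le> (?u x - ?u y)\<^sup>2 * (a ^ n * r powr ?s)"
        by (rule mult_left_mono) simp
      then have "(?u x - ?u y)\<^sup>2 / r powr ?s \<le> a ^ Suc l * (?u x - ?u y)\<^sup>2"
        using r by (simp add: l field_simps)
      then have "ennreal ((?u x - ?u y)\<^sup>2 / r powr ?s) \<le> ennreal (a ^ Suc l) * (?I l x y * ennreal ((?u x - ?u y)\<^sup>2))"
        using rl a(1) by (simp add: ennreal_mult[symmetric] ennreal_leI)
      also have "\<dots> = (\<Sum>n\<in>{l}. ennreal (a ^ Suc n) * (?I n x y * ennreal ((?u x - ?u y)\<^sup>2)))" by simp
      also have "\<dots> \<le> (\<Sum>n. ennreal (a ^ Suc n) * (?I n x y * ennreal ((?u x - ?u y)\<^sup>2)))"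
        by (rule sum_le_suminf) auto
      also have "\<dots> \<le> 1 + \<dots>" by simp
      finally show ?thesis by (simp add: r_def)
    next
      case False
      have "1 \<le> r powr ?s" using False s by (simp add: ge_one_powr_ge_zero)
      moreover have "(?u x - ?u y)\<^sup>2 \<le> 1"
      proof -
        have "\<bar>?u x - ?u y\<bar> \<le> 1" using bd[OF xy(1)] bd[OF xy(2)] by linarith
        then show ?thesis by (simp add: abs_square_le_1)
      qed
      ultimately have "(?u x - ?u y)\<^sup>2 / r powr ?s \<le> 1"
        by (intro iffD2[OF divide_le_eq_1_pos]) linarith+
      then have "ennreal ((?u x - ?u y)\<^sup>2 / r powr ?s) \<le> 1" using ennreal_leI by fastforce
      also have "\<dots> \<le> 1 + (\<Sum>n. ennreal (a ^ Suc n) * (?I n x y * ennreal ((?u x - ?u y)\<^sup>2)))" by simp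
      finally show ?thesis by (simp add: r_def)
    qed
  qed simp
  define b where "b = a / 64 * (6 / 7)"
  have b: "0 < b" "b < 1" using a by (simp_all add: b_def)
  have "carpet_energy \<beta> ?u
      \<le> (\<integral>\<^sup>+x. \<integral>\<^sup>+y. 1 + (\<Sum>n. ennreal (a ^ Suc n) * (?I n x y * ennreal ((?u x - ?u y)\<^sup>2))) \<partial>carpet_measure \<partial>carpet_measure)"
    unfolding carpet_energy_def using pt by (intro nn_integral_mono) auto
  also have "\<dots> = 1 + (\<Sum>n. ennreal (a ^ Suc n) *
      (\<integral>\<^sup>+x. \<integral>\<^sup>+y. ?I n x y * ennreal ((?u x - ?u y)\<^sup>2) \<partial>carpet_measure \<partial>carpet_measure))"
    by (simp add: nn_integral_add nn_integral_suminf nn_integral_cmult emeasure_carpet)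
  also have "\<dots> \<le> 1 + (\<Sum>n. ennreal (a ^ Suc n) * ennreal (256 * (6 / 7) ^ n / 64 ^ n))"
    by (intro add_left_mono suminf_le mult_left_mono singular_energy_at_scale[OF idx]) auto
  also have "\<dots> = 1 + (\<Sum>n. ennreal (256 * a * b ^ n))"
  proof -
    have "b ^ n = a ^ n / 64 ^ n * (6 / 7) ^ n" for n
      unfolding b_def power_mult_distrib power_divide[of a 64] ..
    then show ?thesis using a(1) by (simp add: ennreal_mult[symmetric] mult_ac)
  qed
  also have "\<dots> = 1 + ennreal (\<Sum>n. 256 * a * b ^ n)"
    using a b by (subst suminf_ennreal2) (auto intro!: summable_mult summable_geometric)
  also have "\<dots> < \<infinity>" by simp
  finally show ?thesis using L2 by (simp add: carpet_domain_def)
qed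

section \<open>Continuous functions of finite energy above the upper bound\<close>

lemma carpet_pos_swap: "(i, j) \<in> carpet_pos n \<Longrightarrow> (j, i) \<in> carpet_pos n"
proof (induction n arbitrary: i j)
  case (Suc n)
  from Suc.prems obtain i' j' a b where *: "(i, j) = (3 * i' + a, 3 * j' + b)"
    "(i', j') \<in> carpet_pos n" "(a, b) \<in> carpet_digits" by (rule carpet_pos_SucE)
  have "(b, a) \<in> carpet_digits" using *(3) by (auto simp: carpet_digits_def)
  then show ?case using carpet_pos_SucI[OF Suc.IH[OF *(2)]] *(1) by simp
qed simp

text \<open>The indices of the rows of level \<open>n\<close> that meet the middle third Cantor set. No ternary digit is 1, so
  such a row is crossed by the carpet in its entire length.\<close>

primrec cantor_rows :: "nat \<Rightarrow> nat set" where
  "cantor_rows 0 = {0}"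
| "cantor_rows (Suc n) = (\<lambda>(j, b). 3 * j + b) ` (cantor_rows n \<times> {0, 2})"

lemma finite_cantor_rows [simp]: "finite (cantor_rows n)"
  by (induction n) auto

lemma card_cantor_rows: "card (cantor_rows n) = 2 ^ n"
proof (induction n)
  case (Suc n)
  have "inj_on (\<lambda>(j, b). 3 * j + b) (cantor_rows n \<times> {0, 2})"
    by (rule inj_on_inverseI[where g = "\<lambda>x. (x div 3, x mod 3)"])
       (auto simp del: add_2_eq_Suc add_2_eq_Suc')
  then show ?case using Suc by (simp add: card_image card_cartesian_product)
qed simp

lemma cantor_rows_less: "j \<in> cantor_rows n \<Longrightarrow> j < 3 ^ n"
  by (induction n arbitrary: j) force+

lemma cantor_rows_mono1: "j \<in> cantor_rows n \<Longrightarrow> j \<in> cantor_rows (Suc n)"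
proof (induction n arbitrary: j)
  case 0
  then show ?case by force
next
  case (Suc n)
  from Suc.prems obtain j' b where "j = 3 * j' + b" "j' \<in> cantor_rows n" "b \<in> {0, 2}" by auto
  with Suc.IH[of j'] show ?case
    unfolding cantor_rows.simps(2)[of "Suc n"] by (intro image_eqI[of _ _ "(j', b)"]) auto
qed

lemma cantor_rows_mono: "j \<in> cantor_rows n \<Longrightarrow> j \<in> cantor_rows (m + n)"
  by (induction m) (auto intro: cantor_rows_mono1 simp del: cantor_rows.simps)

lemma cantor_row_in_carpet: "j \<in> cantor_rows n \<Longrightarrow> i < 3 ^ n \<Longrightarrow> (i, j) \<in> carpet_pos n"
proof (induction n arbitrary: i j)
  case (Suc n)
  from Suc.prems obtain j' b where *: "j = 3 * j' + b" "j' \<in> cantor_rows n" "b \<in> {0, 2}" by auto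
  have "i div 3 < 3 ^ n" using Suc.prems(2) by (simp add: less_mult_imp_div_less mult.commute)
  then have "(i div 3, j') \<in> carpet_pos n" using Suc.IH *(2) by blast
  moreover have "(i mod 3, b) \<in> carpet_digits"
  proof -
    have "i mod 3 = 0 \<or> i mod 3 = 1 \<or> i mod 3 = 2" by presburger
    then show ?thesis using *(3) by (auto simp: carpet_digits_def)
  qed
  ultimately have "(3 * (i div 3) + i mod 3, 3 * j' + b) \<in> carpet_pos (Suc n)" by (rule carpet_pos_SucI)
  then show ?case using *(1) by simp
qed simp

definition cell_average :: "(real \<times> real \<Rightarrow> real) \<Rightarrow> nat \<Rightarrow> nat \<times> nat \<Rightarrow> real" where
  "cell_average u n p = average carpet_measure (cell n p) u"

lemma measure_cell: "p \<in> carpet_pos n \<Longrightarrow> measure carpet_measure (cell n p) = 1 / 8 ^ n"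
  using emeasure_cell[of p n] by (simp add: measure_def)

text \<open>The squared difference of the averages over two adjacent cells is at most \<open>64 ^ N\<close> times the integral
  of \<open>(u x - u y)\<^sup>2\<close> over the two cells, on which the kernel is at least of order
  \<open>(8 * 3 powr \<beta>) ^ N\<close>. The sum of all these integrals is controlled by the energy because the pairs of
  cells overlap boundedly.\<close>

lemma edge_energy:
  fixes p q :: "'e \<Rightarrow> nat \<times> nat"
  assumes u: "u \<in> carpet_domain \<beta>" and \<beta>: "\<beta> > 0"
    and I: "finite I" "inj_on p I" and pq: "\<And>e. e \<in> I \<Longrightarrow> p e \<in> carpet_pos N" "\<And>e. e \<in> I \<Longrightarrow> q e \<in> carpet_pos N"
    and near: "\<And>e z w. e \<in> I \<Longrightarrow> z \<in> cell N (p e) \<Longrightarrow> w \<in> cell N (q e) \<Longrightarrow> dist z w \<le> 3 / 3 ^ N"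
  shows "(\<Sum>e\<in>I. (cell_average u N (p e) - cell_average u N (q e))\<^sup>2)
     \<le> 16 * 3 powr (carpet_dim + \<beta>) * carpet_form \<beta> u u * (8 / 3 powr \<beta>) ^ N"
proof -
  let ?D = "\<lambda>e. (cell_average u N (p e) - cell_average u N (q e))\<^sup>2"
  let ?w = "\<lambda>x y. \<Sum>e\<in>I. indicator (cell N (p e)) x * indicator (cell N (q e)) y :: ennreal"
  note [measurable] = carpet.form_domainD(2)[OF u]
  have [measurable]: "cell N (p e) \<in> sets carpet_measure" "cell N (q e) \<in> sets carpet_measure" if "e \<in> I" for e
    using pq[OF that] by (auto intro: cell_sets)
  have E: "carpet_form \<beta> u u \<ge> 0" by (rule carpet.form_nonneg[OF u])
  have w: "norm (x - y) \<le> 3 / 3 ^ N \<and> ?w x y \<le> 16" if ne: "?w x y \<noteq> 0" for x y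
  proof
    obtain e where "e \<in> I" "x \<in> cell N (p e)" "y \<in> cell N (q e)"
      using ne I(1) by (auto simp: indicator_def split: if_splits)
    then show "norm (x - y) \<le> 3 / 3 ^ N" using near by (auto simp: dist_norm)
    \<comment> \<open>A point lies in few cells, and distinct edges start in distinct cells.\<close>
    have "?w x y \<le> (\<Sum>e\<in>I. indicator (near_cells N x) (p e))"
      using pq(1) by (intro sum_mono) (auto simp: indicator_def near_cells_def intro!: bexI[of _ x])
    also have "\<dots> = (\<Sum>r\<in>p ` I. indicator (near_cells N x) r)"
      using I(2) by (simp add: sum.reindex)
    also have "\<dots> = of_nat (card (p ` I \<inter> near_cells N x))"
      using I(1) by (simp add: indicator_def sum.If_cases Int_def)
    also have "\<dots> \<le> of_nat 16"
      unfolding of_nat_le_iff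
      by (rule order_trans[OF card_mono card_near_cells]) auto
    finally show "?w x y \<le> 16" by simp
  qed
  have "ennreal ((\<Sum>e\<in>I. ?D e) / 64 ^ N) = (\<Sum>e\<in>I. ennreal (?D e / 64 ^ N))"
    by (simp add: sum_divide_distrib)
  also have "\<dots> \<le> (\<Sum>e\<in>I. \<integral>\<^sup>+x. \<integral>\<^sup>+y. indicator (cell N (p e)) x * indicator (cell N (q e)) y * ennreal ((u x - u y)\<^sup>2) \<partial>carpet_measure \<partial>carpet_measure)"
  proof (rule sum_mono)
    fix e assume e: "e \<in> I"
    have "ennreal (?D e / 64 ^ N) = ennreal (?D e) * emeasure carpet_measure (cell N (p e)) * emeasure carpet_measure (cell N (q e))"
      using pq[OF e] by (simp add: emeasure_cell ennreal_mult[symmetric] power_mult_distrib[symmetric])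
    also have "\<dots> \<le> (\<integral>\<^sup>+x\<in>cell N (p e). (\<integral>\<^sup>+y\<in>cell N (q e). ennreal ((u x - u y)\<^sup>2) \<partial>carpet_measure) \<partial>carpet_measure)"
      unfolding cell_average_def
      by (rule carpet.average_difference[OF carpet.form_domainD(1)[OF u]])
         (use pq[OF e] in \<open>auto simp: measure_cell intro: cell_sets\<close>)
    also have "\<dots> = (\<integral>\<^sup>+x. \<integral>\<^sup>+y. indicator (cell N (p e)) x * indicator (cell N (q e)) y * ennreal ((u x - u y)\<^sup>2) \<partial>carpet_measure \<partial>carpet_measure)"
    proof (rule nn_integral_cong)
      fix x
      show "(\<integral>\<^sup>+y\<in>cell N (q e). ennreal ((u x - u y)\<^sup>2) \<partial>carpet_measure) * indicator (cell N (p e)) x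
          = (\<integral>\<^sup>+y. indicator (cell N (p e)) x * indicator (cell N (q e)) y * ennreal ((u x - u y)\<^sup>2) \<partial>carpet_measure)"
        by (auto simp: indicator_def mult.commute)
    qed
    finally show "ennreal (?D e / 64 ^ N) \<le> (\<integral>\<^sup>+x. \<integral>\<^sup>+y. indicator (cell N (p e)) x * indicator (cell N (q e)) y * ennreal ((u x - u y)\<^sup>2) \<partial>carpet_measure \<partial>carpet_measure)" .
  qed
  also have "\<dots> = (\<integral>\<^sup>+x. \<integral>\<^sup>+y. ?w x y * ennreal ((u x - u y)\<^sup>2) \<partial>carpet_measure \<partial>carpet_measure)"
    by (simp add: nn_integral_sum sum_distrib_right)
  also have "\<dots> \<le> 16 * ennreal ((3 / 3 ^ N) powr (carpet_dim + \<beta>)) * carpet_energy \<beta> u"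
    by (rule carpet.weighted_energy_bound) (use w carpet_dim_add_nonneg[OF \<beta>] in auto)
  also have "\<dots> = ennreal (16 * (3 / 3 ^ N) powr (carpet_dim + \<beta>) * carpet_form \<beta> u u)"
    using E by (simp add: carpet.energy_form[OF u] ennreal_mult)
  finally have "(\<Sum>e\<in>I. ?D e) / 64 ^ N \<le> 16 * (3 / 3 ^ N) powr (carpet_dim + \<beta>) * carpet_form \<beta> u u"
    using E by simp
  then have "(\<Sum>e\<in>I. ?D e) \<le> 16 * (3 / 3 ^ N) powr (carpet_dim + \<beta>) * carpet_form \<beta> u u * 64 ^ N"
    by (simp add: field_simps)
  also have "\<dots> = 16 * 3 powr (carpet_dim + \<beta>) * carpet_form \<beta> u u * (64 ^ N / (8 * 3 powr \<beta>) ^ N)"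
    by (simp add: scale_powr)
  also have "64 ^ N / (8 * 3 powr \<beta>) ^ N = (8 / 3 powr \<beta>) ^ N"
    unfolding power_divide[symmetric] by simp
  finally show ?thesis .
qed

lemma sum_squared_le_card:
  fixes f :: "'e \<Rightarrow> real"
  shows "(\<Sum>e\<in>I. f e)\<^sup>2 \<le> real (card I) * (\<Sum>e\<in>I. (f e)\<^sup>2)"
  using Cauchy_Schwarz_ineq_sum[of "\<lambda>_. 1" f I] by simp

text \<open>Thomson's principle for the flow that is spread evenly over the paths: the differences along each path
  telescope, and the Cauchy-Schwarz inequality is applied to the sum over all edges.\<close>

lemma parallel_paths_energy:
  fixes P :: "'r \<Rightarrow> nat \<Rightarrow> nat \<times> nat"
  assumes u: "u \<in> carpet_domain \<beta>" and \<beta>: "\<beta> > 0" and R: "finite R"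
    and inj: "inj_on (\<lambda>(r, i). P r i) (R \<times> {..L})"
    and P: "\<And>r i. r \<in> R \<Longrightarrow> i \<le> L \<Longrightarrow> P r i \<in> carpet_pos N"
    and near: "\<And>r i z w. r \<in> R \<Longrightarrow> i < L \<Longrightarrow> z \<in> cell N (P r i) \<Longrightarrow> w \<in> cell N (P r (Suc i)) \<Longrightarrow> dist z w \<le> 3 / 3 ^ N"
  shows "(\<Sum>r\<in>R. cell_average u N (P r 0) - cell_average u N (P r L))\<^sup>2
    \<le> real (card R) * real L * (16 * 3 powr (carpet_dim + \<beta>) * carpet_form \<beta> u u * (8 / 3 powr \<beta>) ^ N)"
proof -
  let ?a = "\<lambda>r i. cell_average u N (P r i)"
  let ?I = "R \<times> {..<L}"
  have "(\<Sum>r\<in>R. ?a r 0 - ?a r L) = (\<Sum>r\<in>R. \<Sum>i<L. ?a r i - ?a r (Suc i))"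
    by (intro sum.cong refl sum_lessThan_telescope'[symmetric])
  also have "\<dots> = (\<Sum>(r, i)\<in>?I. ?a r i - ?a r (Suc i))"
    by (rule sum.cartesian_product)
  also have "\<dots>\<^sup>2 \<le> real (card ?I) * (\<Sum>e\<in>?I. (case e of (r, i) \<Rightarrow> ?a r i - ?a r (Suc i))\<^sup>2)"
    by (rule sum_squared_le_card)
  also have "(\<Sum>e\<in>?I. (case e of (r, i) \<Rightarrow> ?a r i - ?a r (Suc i))\<^sup>2)
      = (\<Sum>e\<in>?I. (cell_average u N (case e of (r, i) \<Rightarrow> P r i) - cell_average u N (case e of (r, i) \<Rightarrow> P r (Suc i)))\<^sup>2)"
    by (intro sum.cong refl) auto
  also have "real (card ?I) * \<dots> \<le> real (card ?I) * (16 * 3 powr (carpet_dim + \<beta>) * carpet_form \<beta> u u * (8 / 3 powr \<beta>) ^ N)"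
  proof (intro mult_left_mono edge_energy[OF u \<beta>])
    show "finite ?I" using R by simp
    show "inj_on (\<lambda>e. case e of (r, i) \<Rightarrow> P r i) ?I" by (rule inj_on_subset[OF inj]) auto
  qed (use P near in auto)
  finally show ?thesis by (simp add: card_cartesian_product)
qed

lemma cell_average_close:
  assumes u: "u \<in> L2_funs carpet_measure" and p: "p \<in> carpet_pos n"
    and close: "\<And>z. z \<in> cell n p \<Longrightarrow> \<bar>u z - c\<bar> \<le> \<epsilon>"
  shows "\<bar>cell_average u n p - c\<bar> \<le> \<epsilon>"
proof -
  obtain z where "z \<in> cell n p" using carpet_nonempty unfolding cell_def by blast
  then have "\<bar>u z - c\<bar> \<le> \<epsilon>" by (rule close)
  then have \<epsilon>: "\<epsilon> \<ge> 0" by linarith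
  note [measurable] = cell_sets[OF p]
  have "ennreal ((cell_average u n p - c)\<^sup>2 * (1 / 8 ^ n)) = ennreal ((cell_average u n p - c)\<^sup>2) * emeasure carpet_measure (cell n p)"
    by (simp add: emeasure_cell[OF p] ennreal_mult[symmetric])
  also have "\<dots> \<le> (\<integral>\<^sup>+x\<in>cell n p. ennreal ((u x - c)\<^sup>2) \<partial>carpet_measure)"
    unfolding cell_average_def
    by (rule carpet.average_deviation[OF u cell_sets[OF p]]) (simp add: measure_cell[OF p])
  also have "\<dots> \<le> (\<integral>\<^sup>+x. ennreal (\<epsilon>\<^sup>2) * indicator (cell n p) x \<partial>carpet_measure)"
  proof (rule nn_integral_mono)
    fix x
    have "(u x - c)\<^sup>2 \<le> \<epsilon>\<^sup>2" if "x \<in> cell n p"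
      using close[OF that] \<epsilon> by (simp add: abs_le_square_iff[symmetric])
    then show "ennreal ((u x - c)\<^sup>2) * indicator (cell n p) x \<le> ennreal (\<epsilon>\<^sup>2) * indicator (cell n p) x"
      by (auto simp: indicator_def ennreal_leI)
  qed
  also have "\<dots> = ennreal (\<epsilon>\<^sup>2 * (1 / 8 ^ n))"
    by (simp add: nn_integral_cmult_indicator emeasure_cell[OF p] ennreal_mult[symmetric])
  finally have "(cell_average u n p - c)\<^sup>2 \<le> \<epsilon>\<^sup>2" by (simp add: divide_right_mono field_simps)
  then show ?thesis using \<epsilon> by (simp add: abs_le_square_iff[symmetric])
qed

definition lattice_point :: "nat \<Rightarrow> nat \<times> nat \<Rightarrow> real \<times> real" where
  "lattice_point n p = (real (fst p) / 3 ^ n, real (snd p) / 3 ^ n)"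

text \<open>Horizontal and vertical paths are treated together; \<open>False\<close> exchanges the coordinates.\<close>

definition orient :: "bool \<Rightarrow> nat \<times> nat \<Rightarrow> nat \<times> nat" where
  "orient h p = (if h then p else prod.swap p)"

lemma lattice_point_in_carpet: "p \<in> carpet_pos n \<Longrightarrow> lattice_point n p \<in> carpet"
  using corner_in_cell[of "fst p" n "snd p"] cell_subset_carpet[of p n] by (auto simp: lattice_point_def)

lemma lattice_point_end_in_carpet:
  assumes "orient h (i, j) \<in> carpet_pos n"
  shows "lattice_point n (orient h (Suc i, j)) \<in> carpet"
proof -
  have "cell_map n (orient h (i, j)) (if h then (1, 0) else (0, 1)) \<in> cell n (orient h (i, j))"
    unfolding cell_def by (rule imageI) simp
  then have "cell_map n (orient h (i, j)) (if h then (1, 0) else (0, 1)) \<in> carpet"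
    using cell_subset_carpet[OF assms] by blast
  then show ?thesis by (simp add: cell_map_def lattice_point_def orient_def add.commute split: if_splits)
qed

lemma dist_lattice_point:
  assumes z: "z \<in> cell n (i, j)"
    and i: "real i \<le> real i' + c" "real i' \<le> real i + c" "real i + 1 \<le> real i' + c"
    and j: "real j \<le> real j' + c" "real j' \<le> real j + c" "real j + 1 \<le> real j' + c"
  shows "dist z (lattice_point n (i', j')) \<le> 2 * c / 3 ^ n"
proof -
  have "\<bar>3 ^ n * fst z - real i'\<bar> \<le> c" "\<bar>3 ^ n * snd z - real j'\<bar> \<le> c"
    using cell_coords[OF z] i j by linarith+
  then have "\<bar>3 ^ n * fst z - 3 ^ n * (real i' / 3 ^ n)\<bar> \<le> c" "\<bar>3 ^ n * snd z - 3 ^ n * (real j' / 3 ^ n)\<bar> \<le> c"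
    by simp_all
  then have "3 ^ n * \<bar>fst z - real i' / 3 ^ n\<bar> \<le> c" "3 ^ n * \<bar>snd z - real j' / 3 ^ n\<bar> \<le> c"
    unfolding abs_diff_scaled .
  then have "dist z (lattice_point n (i', j')) \<le> 3 / 2 * (c / 3 ^ n)"
    by (intro dist_pair_le) (simp_all add: lattice_point_def field_simps)
  also have "\<dots> \<le> 2 * c / 3 ^ n"
    using i by (simp add: field_simps)
  finally show ?thesis .
qed

text \<open>The lower (or left) edge of a cell of level \<open>k\<close> carries at level \<open>k + N\<close>, with \<open>N = m + n\<close>, the
  \<open>2 ^ n\<close> straight paths of \<open>3 ^ N\<close> cells in the Cantor rows of its bottom strip of height
  \<open>1 / 3 ^ (k + m)\<close>. By the path inequality the mean difference between their two ends has a square of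
  at most a constant times \<open>3 ^ N / 2 ^ n * (8 / 3 powr \<beta>) ^ N\<close>. For fixed \<open>m\<close> this is of order
  \<open>(12 / 3 powr \<beta>) ^ n\<close> and tends to zero. All ends lie within \<open>2 / 3 ^ m\<close> of the two corners, so
  continuity transfers the equality to the corners.\<close>

lemma lattice_neighbours_equal:
  assumes u: "u \<in> carpet_domain \<beta>" and cont: "continuous_on carpet u" and \<beta>: "3 powr \<beta> > 12"
    and ij: "orient h (i, j) \<in> carpet_pos k"
  shows "u (lattice_point k (orient h (i, j))) = u (lattice_point k (orient h (Suc i, j)))"
proof -
  have \<beta>0: "\<beta> > 0"
  proof (rule ccontr)
    assume "\<not> \<beta> > 0"
    then have "3 powr \<beta> \<le> 3 powr 0" by (intro powr_mono) auto
    then show False using \<beta> by simp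
  qed
  let ?p = "lattice_point k (orient h (i, j))" and ?q = "lattice_point k (orient h (Suc i, j))"
  have pq: "?p \<in> carpet" "?q \<in> carpet"
    using lattice_point_in_carpet[OF ij] lattice_point_end_in_carpet[OF ij] by auto
  have u2: "u \<in> L2_funs carpet_measure" by (rule carpet.form_domainD(1)[OF u])
  have "\<bar>u ?p - u ?q\<bar> \<le> 3 * \<epsilon>" if \<epsilon>: "\<epsilon> > 0" for \<epsilon>
  proof -
    \<comment> \<open>First \<open>m\<close> is chosen by continuity at the two corners, then \<open>n\<close> such that the paths do not see a
      difference above \<open>\<epsilon>\<close>.\<close>
    obtain d1 where d1: "d1 > 0" "\<And>z. z \<in> carpet \<Longrightarrow> dist z ?p < d1 \<Longrightarrow> dist (u z) (u ?p) < \<epsilon>"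
      using cont pq(1) \<epsilon> unfolding continuous_on_iff by metis
    obtain d2 where d2: "d2 > 0" "\<And>z. z \<in> carpet \<Longrightarrow> dist z ?q < d2 \<Longrightarrow> dist (u z) (u ?q) < \<epsilon>"
      using cont pq(2) \<epsilon> unfolding continuous_on_iff by metis
    obtain m where "(1 / 3) ^ m < min d1 d2 / 2"
      using real_arch_pow_inv[of "min d1 d2 / 2" "1 / 3"] d1(1) d2(1) by auto
    then have m: "2 / 3 ^ m < d1" "2 / 3 ^ m < d2" by (auto simp: power_one_over field_simps)
    define K where "K = 16 * 3 powr (carpet_dim + \<beta>) * carpet_form \<beta> u u"
    have K: "K \<ge> 0" using carpet.form_nonneg[OF u] by (simp add: K_def)
    define c where "c = K * 3 ^ m * (8 / 3 powr \<beta>) ^ (k + m)"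
    have "(\<lambda>n. c * (12 / 3 powr \<beta>) ^ n) \<longlonglongrightarrow> c * 0"
      using \<beta> by (intro tendsto_mult tendsto_const LIMSEQ_realpow_zero) auto
    then obtain n where n: "c * (12 / 3 powr \<beta>) ^ n < \<epsilon>\<^sup>2"
      using order_tendstoD(2)[of "\<lambda>n. c * (12 / 3 powr \<beta>) ^ n" "c * 0" sequentially "\<epsilon>\<^sup>2"] \<epsilon>
      by (auto simp: eventually_sequentially)
    define N where "N = m + n"
    define L where "L = (3::nat) ^ N - 1"
    have L: "Suc L = 3 ^ N" by (simp add: L_def)
    \<comment> \<open>The \<open>2^n\<close> Cantor rows of level \<open>N\<close> inside the bottom \<open>3^n\<close> rows of the cell.\<close>
    define P where "P r t = orient h (3 ^ N * i + t, 3 ^ N * j + r)" for r t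
    have Ppos: "P r t \<in> carpet_pos (k + N)" if "r \<in> cantor_rows n" "t \<le> L" for r t
    proof -
      have "(t, r) \<in> carpet_pos N"
        using cantor_row_in_carpet[of r N t] cantor_rows_mono[OF that(1), of m] that(2) L by (simp add: N_def)
      then show ?thesis
        using ij carpet_pos_addI[of i j k t r N] carpet_pos_addI[of j i k r t N] carpet_pos_swap[of t r N]
        by (cases h) (simp_all add: P_def orient_def)
    qed
    have energy: "(\<Sum>r\<in>cantor_rows n. cell_average u (k + N) (P r 0) - cell_average u (k + N) (P r L))\<^sup>2
        \<le> real (card (cantor_rows n)) * real L * (K * (8 / 3 powr \<beta>) ^ (k + N))"
      unfolding K_def
    proof (rule parallel_paths_energy[OF u \<beta>0 finite_cantor_rows _ Ppos])
      show "inj_on (\<lambda>(r, t). P r t) (cantor_rows n \<times> {..L})"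
        by (auto simp: inj_on_def P_def orient_def split: if_splits)
      show "dist z w \<le> 3 / 3 ^ (k + N)" if "z \<in> cell (k + N) (P r t)" "w \<in> cell (k + N) (P r (Suc t))" for r t z w
        using that by (cases h) (auto simp: P_def orient_def intro: dist_near_cells)
    qed
    also have "\<dots> \<le> 2 ^ n * 3 ^ N * (K * (8 / 3 powr \<beta>) ^ (k + N))"
    proof -
      have "real L \<le> real (3 ^ N)" unfolding of_nat_le_iff by (simp add: L_def)
      then show ?thesis
        using K by (intro mult_right_mono mult_left_mono) (auto simp: card_cantor_rows)
    qed
    also have "\<dots> = (2 ^ n)\<^sup>2 * (c * (12 / 3 powr \<beta>) ^ n)"
    proof -
      have "(12 / 3 powr \<beta>) ^ n = (3 ^ n / 2 ^ n) * (8 / 3 powr \<beta>) ^ n"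
        by (simp add: power_divide[symmetric] power_mult_distrib[symmetric])
      then show ?thesis
        by (simp add: c_def N_def power_add power2_eq_square)
    qed
    also have "\<dots> \<le> (2 ^ n)\<^sup>2 * \<epsilon>\<^sup>2" using n by (intro mult_left_mono) auto
    also have "\<dots> = (2 ^ n * \<epsilon>)\<^sup>2" by (simp add: power_mult_distrib)
    finally have sum: "\<bar>\<Sum>r\<in>cantor_rows n. cell_average u (k + N) (P r 0) - cell_average u (k + N) (P r L)\<bar> \<le> 2 ^ n * \<epsilon>"
      using \<epsilon> by (simp add: abs_le_square_iff[symmetric] abs_mult)
    have kN: "(3::real) ^ (k + N) = 3 ^ N * 3 ^ k" by (simp add: power_add)
    have p_eq: "?p = lattice_point (k + N) (orient h (3 ^ N * i, 3 ^ N * j))"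
      by (simp add: lattice_point_def orient_def power_add)
    have q_eq: "?q = lattice_point (k + N) (orient h (3 ^ N * Suc i, 3 ^ N * j))"
      by (simp add: lattice_point_def orient_def power_add del: mult_Suc_right)
    have scale: "2 * 3 ^ n / 3 ^ (k + N) \<le> (2 / 3 ^ m :: real)"
    proof -
      have "2 * 3 ^ n / 3 ^ (k + N) = 2 / (3 ^ k * 3 ^ m :: real)" by (simp add: N_def power_add)
      also have "\<dots> \<le> 2 / 3 ^ m" by (intro divide_left_mono) auto
      finally show ?thesis .
    qed
    have first: "\<bar>cell_average u (k + N) (P r 0) - u ?p\<bar> \<le> \<epsilon>" if r: "r \<in> cantor_rows n" for r
    proof (rule cell_average_close[OF u2 Ppos[OF r]])
      fix z assume z: "z \<in> cell (k + N) (P r 0)"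
      have "real (Suc r) \<le> real (3 ^ n)"
        unfolding of_nat_le_iff using cantor_rows_less[OF r] by simp
      then have r': "real r + 1 \<le> 3 ^ n" "r \<le> 3 ^ n" using cantor_rows_less[OF r] by simp_all
      have "dist z ?p \<le> 2 * 3 ^ n / 3 ^ (k + N)"
        using z r' unfolding p_eq unfolding P_def orient_def
        by (cases h) (auto intro!: dist_lattice_point)
      then have "dist z ?p < d1" using scale m by linarith
      then show "\<bar>u z - u ?p\<bar> \<le> \<epsilon>"
        using d1(2)[of z] z cell_subset_carpet[OF Ppos[OF r, of 0]] by (force simp: dist_real_def)
    qed simp
    have last: "\<bar>cell_average u (k + N) (P r L) - u ?q\<bar> \<le> \<epsilon>" if r: "r \<in> cantor_rows n" for r
    proof (rule cell_average_close[OF u2 Ppos[OF r]])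
      fix z assume z: "z \<in> cell (k + N) (P r L)"
      have "real (Suc r) \<le> real (3 ^ n)"
        unfolding of_nat_le_iff using cantor_rows_less[OF r] by simp
      then have r': "real r + 1 \<le> 3 ^ n" "r \<le> 3 ^ n" using cantor_rows_less[OF r] by simp_all
      have "3 ^ N * Suc i = Suc (3 ^ N * i + L)" using L by simp
      then have t': "real (3 ^ N * Suc i) = real (3 ^ N * i + L) + 1" by simp
      have "dist z ?q \<le> 2 * 3 ^ n / 3 ^ (k + N)"
        using z r' t' unfolding q_eq unfolding P_def orient_def
        by (cases h) (auto intro!: dist_lattice_point simp del: mult_Suc_right of_nat_mult of_nat_add)
      then have "dist z ?q < d2" using scale m by linarith
      then show "\<bar>u z - u ?q\<bar> \<le> \<epsilon>"
        using d2(2)[of z] z cell_subset_carpet[OF Ppos[OF r, of L]] by (force simp: dist_real_def)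
    qed simp
    have "2 ^ n * (u ?p - u ?q) = (\<Sum>r\<in>cantor_rows n. u ?p - u ?q)"
      by (simp add: card_cantor_rows)
    also have "\<dots> = (\<Sum>r\<in>cantor_rows n. u ?p - cell_average u (k + N) (P r 0))
        + (\<Sum>r\<in>cantor_rows n. cell_average u (k + N) (P r 0) - cell_average u (k + N) (P r L))
        + (\<Sum>r\<in>cantor_rows n. cell_average u (k + N) (P r L) - u ?q)"
      unfolding sum.distrib[symmetric] by (intro sum.cong) auto
    finally have "\<bar>2 ^ n * (u ?p - u ?q)\<bar>
        \<le> \<bar>\<Sum>r\<in>cantor_rows n. u ?p - cell_average u (k + N) (P r 0)\<bar>
        + \<bar>\<Sum>r\<in>cantor_rows n. cell_average u (k + N) (P r 0) - cell_average u (k + N) (P r L)\<bar>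
        + \<bar>\<Sum>r\<in>cantor_rows n. cell_average u (k + N) (P r L) - u ?q\<bar>" by linarith
    also have "\<dots> \<le> 2 ^ n * \<epsilon> + 2 ^ n * \<epsilon> + 2 ^ n * \<epsilon>"
    proof (intro add_mono sum)
      show "\<bar>\<Sum>r\<in>cantor_rows n. u ?p - cell_average u (k + N) (P r 0)\<bar> \<le> 2 ^ n * \<epsilon>"
        by (rule order_trans[OF sum_abs])
           (use sum_bounded_above[of "cantor_rows n" "\<lambda>r. \<bar>u ?p - cell_average u (k + N) (P r 0)\<bar>" \<epsilon>] first
             in \<open>simp add: card_cantor_rows abs_minus_commute\<close>)
      show "\<bar>\<Sum>r\<in>cantor_rows n. cell_average u (k + N) (P r L) - u ?q\<bar> \<le> 2 ^ n * \<epsilon>"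
        by (rule order_trans[OF sum_abs])
           (use sum_bounded_above[of "cantor_rows n" "\<lambda>r. \<bar>cell_average u (k + N) (P r L) - u ?q\<bar>" \<epsilon>] last
             in \<open>simp add: card_cantor_rows\<close>)
    qed
    also have "\<dots> = 2 ^ n * (3 * \<epsilon>)" by simp
    finally show ?thesis by (simp add: abs_mult)
  qed
  then have "\<bar>u ?p - u ?q\<bar> \<le> 0 + e" if "e > 0" for e
    using that by (force dest: spec[of _ "e / 3"])
  then have "\<bar>u ?p - u ?q\<bar> \<le> 0" by (rule field_le_epsilon)
  then show ?thesis by simp
qed

text \<open>Corner values are equal along the lower and the left edge of each cell. From the lower left corner of
  a cell, whose value is shared with its first child, these edges reach the lower left corners of all
  eight children. Hence all lower left corners have the same value, and they are dense.\<close>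

theorem continuous_form_domain_constant:
  assumes u: "u \<in> carpet_domain \<beta>" and cont: "continuous_on carpet u" and \<beta>: "3 powr \<beta> > 12"
    and x: "x \<in> carpet"
  shows "u x = u (0, 0)"
proof -
  have right: "u (lattice_point n (Suc i, j)) = u (lattice_point n (i, j))" if "(i, j) \<in> carpet_pos n" for i j n
    using lattice_neighbours_equal[OF u cont \<beta>, of True i j n] that by (simp add: orient_def)
  have up: "u (lattice_point n (i, Suc j)) = u (lattice_point n (i, j))" if "(i, j) \<in> carpet_pos n" for i j n
    using lattice_neighbours_equal[OF u cont \<beta>, of False j i n] that by (simp add: orient_def)
  have lattice: "u (lattice_point n p) = u (0, 0)" if "p \<in> carpet_pos n" for n p
    using that
  proof (induction n arbitrary: p)
    case 0
    then show ?case by (simp add: lattice_point_def)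
  next
    case (Suc n)
    from Suc.prems obtain i j a b where p: "p = (3 * i + a, 3 * j + b)" "(i, j) \<in> carpet_pos n"
      "(a, b) \<in> carpet_digits" by (rule carpet_pos_SucE)
    let ?V = "\<lambda>a b. u (lattice_point (Suc n) (3 * i + a, 3 * j + b))"
    have "?V 0 0 = u (lattice_point n (i, j))" by (simp add: lattice_point_def)
    also have "\<dots> = u (0, 0)" by (rule Suc.IH[OF p(2)])
    finally have V00: "?V 0 0 = u (0, 0)" .
    have R: "?V (Suc a) b = ?V a b" if "(a, b) \<in> carpet_digits" for a b
      using right[OF carpet_pos_SucI[OF p(2) that]] by simp
    have U: "?V a (Suc b) = ?V a b" if "(a, b) \<in> carpet_digits" for a b
      using up[OF carpet_pos_SucI[OF p(2) that]] by simp
    have "?V 1 0 = u (0, 0)" "?V 0 1 = u (0, 0)"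
      using R[of 0 0] U[of 0 0] V00 by (simp_all add: carpet_digits_def)
    moreover then have "?V 2 0 = u (0, 0)" "?V 0 2 = u (0, 0)"
      using R[of 1 0] U[of 0 1] by (simp_all add: carpet_digits_def numeral_2_eq_2)
    moreover then have "?V 2 1 = u (0, 0)" "?V 1 2 = u (0, 0)"
      using U[of 2 0] R[of 0 2] by (simp_all add: carpet_digits_def)
    moreover then have "?V 2 2 = u (0, 0)"
      using U[of 2 1] by (simp add: carpet_digits_def numeral_2_eq_2)
    ultimately show ?case using p(3) V00 unfolding p(1) carpet_digits_def by auto
  qed
  have "\<forall>n. \<exists>p. p \<in> carpet_pos n \<and> x \<in> cell n p" using x carpet_eq_cells by blast
  from choice[OF this] obtain p where p: "\<forall>n. p n \<in> carpet_pos n \<and> x \<in> cell n (p n)" ..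
  have close: "dist (lattice_point n (p n)) x \<le> 2 * (1 / 3) ^ n" for n
  proof -
    have "lattice_point n (p n) \<in> cell n (p n)"
      using corner_in_cell[of "fst (p n)" n "snd (p n)"] by (simp add: lattice_point_def)
    then show ?thesis using dist_cell_le[of "lattice_point n (p n)" n "p n" x] p by (simp add: power_one_over)
  qed
  have "(\<lambda>n. 2 * (1 / 3) ^ n :: real) \<longlonglongrightarrow> 2 * 0"
    by (rule tendsto_mult[OF tendsto_const LIMSEQ_realpow_zero]) simp_all
  then have "(\<lambda>n. 2 * (1 / 3) ^ n :: real) \<longlonglongrightarrow> 0" by simp
  then have "(\<lambda>n. dist (lattice_point n (p n)) x) \<longlonglongrightarrow> 0"
    by (rule Lim_null_comparison[rotated]) (simp add: close)
  then have "(\<lambda>n. lattice_point n (p n)) \<longlonglongrightarrow> x" by (rule iffD2[OF tendsto_dist_iff])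
  then have "(\<lambda>n. u (lattice_point n (p n))) \<longlonglongrightarrow> u x"
    by (rule continuous_on_tendsto_compose[OF cont]) (use x p lattice_point_in_carpet in auto)
  moreover have "u (lattice_point n (p n)) = u (0, 0)" for n using lattice p by blast
  ultimately show ?thesis by (simp add: LIMSEQ_const_iff)
qed

section \<open>The walk dimension\<close>

lemma three_powr_less_iff: "c > 0 \<Longrightarrow> 3 powr \<beta> < c \<longleftrightarrow> \<beta> < ln c / ln 3"
  and three_powr_greater_iff: "c > 0 \<Longrightarrow> 3 powr \<beta> > c \<longleftrightarrow> \<beta> > ln c / ln 3"
  for c \<beta> :: real
proof -
  assume c: "c > 0"
  have "3 powr \<beta> = exp (\<beta> * ln 3)" by (simp add: powr_def)
  moreover have "c = exp (ln c)" using c by simp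
  ultimately have "(3 powr \<beta> < c) = (\<beta> * ln 3 < ln c)" "(3 powr \<beta> > c) = (\<beta> * ln 3 > ln c)"
    by (metis exp_less_cancel_iff)+
  then show "3 powr \<beta> < c \<longleftrightarrow> \<beta> < ln c / ln 3" "3 powr \<beta> > c \<longleftrightarrow> \<beta> > ln c / ln 3"
    by (simp_all add: pos_less_divide_eq pos_divide_less_eq)
qed

theorem regular_dirichlet_form_carpet:
  assumes "\<beta> > carpet_dim" "3 powr \<beta> < 28 / 3"
  shows "regular_dirichlet_form carpet_measure (carpet_form \<beta>) (carpet_domain \<beta>)"
proof (rule regular_if_separating[OF assms(1)])
  fix x y assume x: "x \<in> carpet" and y: "y \<in> carpet" and neq: "x \<noteq> y"
  obtain coord :: "real \<times> real \<Rightarrow> real" where coord: "coord = fst \<or> coord = snd" "coord x \<noteq> coord y"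
    using neq by (auto simp: prod_eq_iff)
  have "coord x \<ge> 0" "coord y \<ge> 0" using coord(1) carpet_coordD[OF x] carpet_coordD[OF y] by auto
  then have "singular (coord x) \<noteq> singular (coord y)"
    using coord(2) singular_strict_mono by (metis less_irrefl linorder_neqE)
  moreover have "\<beta> > 0" using assms(1) carpet_dim_pos by (rule less_trans[rotated])
  ultimately show "\<exists>f\<in>carpet_domain \<beta>. continuous_on carpet f \<and> f x \<noteq> f y"
    using singular_coord_domain[OF coord(1) _ assms(2)] continuous_on_singular_coord[OF coord(1)] by blast
qed

text \<open>The first coordinate cannot be approximated uniformly by constants.\<close>

theorem not_regular_dirichlet_form_carpet:
  assumes \<beta>: "3 powr \<beta> > 12"
  shows "\<not> regular_dirichlet_form carpet_measure (carpet_form \<beta>) (carpet_domain \<beta>)"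
proof
  assume reg: "regular_dirichlet_form carpet_measure (carpet_form \<beta>) (carpet_domain \<beta>)"
  have "continuous_on carpet (fst :: real \<times> real \<Rightarrow> real)" by (intro continuous_intros)
  then have fst_Cc: "fst \<in> Cc_funs (space carpet_measure)"
    using compact_carpet by (auto simp: Cc_funs_def)
  have uniform: "\<forall>g\<in>Cc_funs (space carpet_measure). \<forall>e>0. \<exists>v\<in>carpet_domain \<beta> \<inter> Cc_funs (space carpet_measure).
      \<forall>x\<in>space carpet_measure. \<bar>g x - v x\<bar> < e"
    using reg unfolding regular_dirichlet_form_def by (elim conjE) assumption
  have "\<exists>v\<in>carpet_domain \<beta> \<inter> Cc_funs (space carpet_measure).
      \<forall>x\<in>space carpet_measure. \<bar>fst x - v x\<bar> < 1 / 3"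
    by (rule bspec[OF uniform fst_Cc, rule_format]) simp
  then obtain v where v: "v \<in> carpet_domain \<beta>" "v \<in> Cc_funs carpet" "\<forall>x\<in>carpet. \<bar>fst x - v x\<bar> < 1 / 3"
    unfolding space_carpet_measure by blast
  have "v (1, 0) = v (0, 0)"
    using v(1,2) by (intro continuous_form_domain_constant[OF _ _ \<beta>]) (auto simp: Cc_funs_def)
  moreover have "\<bar>1 - v (1, 0)\<bar> < 1 / 3" "\<bar>0 - v (0, 0)\<bar> < 1 / 3"
    using bspec[OF v(3), of "(1, 0)"] bspec[OF v(3), of "(0, 0)"] by simp_all
  ultimately show False by linarith
qed

text \<open>The two bounds on \<open>\<beta>\<close> are \<open>3 powr \<beta> = 8 * (7/6) = 28 / 3\<close> and \<open>3 powr \<beta> = 8 * (3/2) = 12\<close>.\<close>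

theorem theorem2p2:
  shows "carpet_walk_dim \<in> {ereal (ln (8 * (7/6)) / ln 3) .. ereal (ln (8 * (3/2)) / ln 3)}"
proof -
  define S where "S = {ereal \<beta> |\<beta>. \<beta> > 0 \<and>
    regular_dirichlet_form carpet_measure (carpet_form \<beta>) (carpet_domain \<beta>)}"
  have "Sup S \<le> ereal (ln 12 / ln 3)"
  proof (rule Sup_least)
    fix b assume "b \<in> S"
    then obtain \<beta> where b: "b = ereal \<beta>"
      "regular_dirichlet_form carpet_measure (carpet_form \<beta>) (carpet_domain \<beta>)" by (auto simp: S_def)
    then have "\<not> 3 powr \<beta> > 12" using not_regular_dirichlet_form_carpet by blast
    then show "b \<le> ereal (ln 12 / ln 3)" by (simp add: b(1) three_powr_greater_iff not_less)
  qed
  moreover have "ereal (ln (28 / 3) / ln 3) \<le> Sup S"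
  proof (rule ccontr)
    assume "\<not> ?thesis"
    moreover have "carpet_dim < ln (28 / 3) / ln 3"
      using three_powr_less_iff[of "28 / 3" carpet_dim] by (simp add: three_powr_carpet_dim)
    ultimately have "max (Sup S) (ereal carpet_dim) < ereal (ln (28 / 3) / ln 3)" by simp
    then obtain \<beta> where \<beta>: "max (Sup S) (ereal carpet_dim) < ereal \<beta>" "ereal \<beta> < ereal (ln (28 / 3) / ln 3)"
      using ereal_dense2 by blast
    have "\<beta> > carpet_dim" using \<beta>(1) by simp
    moreover have "3 powr \<beta> < 28 / 3" by (rule iffD2[OF three_powr_less_iff]) (use \<beta>(2) in simp_all)
    moreover have "\<beta> > 0" using \<open>\<beta> > carpet_dim\<close> carpet_dim_pos by (rule less_trans[rotated])
    ultimately have "ereal \<beta> \<in> S" using regular_dirichlet_form_carpet by (auto simp: S_def)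
    then have "ereal \<beta> \<le> Sup S" by (rule Sup_upper)
    moreover have "Sup S < ereal \<beta>" using \<beta>(1) by simp
    ultimately show False using leD by blast
  qed
  ultimately show ?thesis by (simp add: carpet_walk_dim_def S_def)
qed

end
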